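(* Let $X,Y$ be complex Banach spaces, $A_0,A_1\in\mathcal B(X,Y)$ nonzero, with pencil $A(z)=A_0+zA_1$ satisfying the standing assumptions in the context, and let $\varepsilon=\{\varepsilon_t\}_{t\in\mathbb Z}\in Y^{\mathbb Z}$ be subexponential. For $\zeta\in\sigma$ consider the projected equation of motion $$A_0x_{\zeta,t}+A_1x_{\zeta,t-1}=\varepsilon_{\zeta,t}\quad\text{for all }t\in\mathbb Z,\qquad \varepsilon_{\zeta,t}=Q_\zeta\varepsilon_t,\qquad ( * )$$ for $x_\zeta=\{x_{\zeta,t}\}_{t\in\mathbb Z}\in X_\zeta^{\mathbb Z}$. Choose $t_0\in\mathbb Z$. (i) If $\zeta\in\sigma$ and $|\zeta|\in(1,\infty)$, each $c_{\zeta,t_0,-\infty}\in X_\zeta$ defines a unique forward flow solution of $( * )$, $$x_{\zeta,t}=\sum_{k\in\mathbb N}(-1)^kR_{\zeta,-k}\,\nabla_\zeta^{-k}\varepsilon_{\zeta,t}+H_\zeta^{-(t-t_0)}c_{\zeta,t_0,-\infty}\in X_\zeta\quad\text{for all }t\in\mathbb Z,$$ where $c_{\zeta,t_0,-\infty}=\lim_{r\to\infty}H_\zeta^{-r-t_0}x_{\zeta,-r}$ is the boundary value in the far distant past (that is, this formula gives the unique solution of $( * )$ in $X_\zeta^{\mathbb Z}$ with the prescribed boundary value). The flow is subexponential if and only if $c_{\zeta,t_0,-\infty}=0$. (ii) If $\zeta\in\sigma$ and $|\zeta|\in(0,1)$, each $c_{\zeta,t_0,\infty}\in X_\zeta$ defines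 a unique backward flow solution of $( * )$, $$x_{\zeta,t}=\sum_{k\in\mathbb N}(-1)^kR_{\zeta,-k}\,\Delta_\zeta^{-k}\varepsilon_{\zeta,t+k}+H_\zeta^{-(t-t_0)}c_{\zeta,t_0,\infty}\in X_\zeta\quad\text{for all }t\in\mathbb Z,$$ where $c_{\zeta,t_0,\infty}=\lim_{r\to\infty}H_\zeta^{r-t_0}x_{\zeta,r}$ is the boundary value in the far distant future (again, the unique solution of $( * )$ in $X_\zeta^{\mathbb Z}$ with the prescribed boundary value). The flow is subexponential if and only if $c_{\zeta,t_0,\infty}=0$. (iii) If $\zeta\in\sigma$ and $|\zeta|=1$, each $c_{\zeta,t_0}=x_{\zeta,t_0}\in X_\zeta$ (the initial value) defines a unique outward flow solution of $( * )$, $$x_{\zeta,t}=\begin{cases}\sum_{k\in\mathbb N}(-1)^kR_{\zeta,-k}\,\nabla_\zeta^{-k}\varepsilon_{\zeta,t_0^+,t}+H_\zeta^{-(t-t_0)}c_{\zeta,t_0}\in X_\zeta & \text{for } t>t_0,\\[2pt] \sum_{k\in\mathbb N}(-1)^kR_{\zeta,-k}\,\Delta_\zeta^{-k}\varepsilon_{\zeta,t_0^-,t+k}+H_\zeta^{t_0-t}c_{\zeta,t_0}\in X_\zeta & \text{for } t<t_0.\end{cases}$$ The flow is always subexponential, with $\nabla_\zeta^{-k}\varepsilon_{\zeta,t_0^+,t}=0$ if $t<t_0$ and $\Delta_\zeta^{-k}\varepsilon_{\zeta,t_0^-,t+k}=0$ if $t+k>t_0$. (iv) If $\infty\in\sigma$,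 the projected equation takes the form $x_{\infty,t}=R_{\infty,0}\varepsilon_{\infty,t}-G_\infty x_{\infty,t-1}$ with $G_\infty=R_{\infty,0}A_1$. Each $c_{\infty,t_0,-\infty}\in\mathcal C_{G_\infty}(X_\infty)$ is a compatible boundary value in the far distant past, $c_{\infty,t_0,-\infty}=\lim_{r\to\infty}(-1)^{r+t_0}G_\infty^{r+t_0}x_{\infty,-r}$ (that is, there is a solution $x_\infty\in X_\infty^{\mathbb Z}$ of $( * )$ with this boundary value), and it defines a unique forward flow for $t\ge t_0$ with $$x_{\infty,t}=\sum_{\ell\in\mathbb N-1}R_{\infty,\ell}\,\varepsilon_{\infty,t-\ell}+(-1)^{t-t_0}G_\infty^{\,t-t_0}c_{\infty,t_0,-\infty}\in X_\infty.\qquad(\dagger)$$ If the restriction $G_\infty|_{\mathcal C_{G_\infty}(X_\infty)}$ is injective, then $x_{\infty,t}$ is uniquely determined by $(\dagger)$ for all $t\in\mathbb Z$ (for $t<t_0$ the negative powers are those of the bijection $G_\infty|_{\mathcal C_{G_\infty}(X_\infty)}$), and the flow is subexponential if and only if $c_{\infty,t_0,-\infty}=0$. If $G_\infty|_{\mathcal C_{G_\infty}(X_\infty)}$ is not injective, then the flow with the given boundary value is no longer uniquely defined for $t<t_0$: a valid solution for $t<t_0$ must be constructed by replacing the second term of $(\dagger)$ by a compatible upstream flow $x_{c,\infty,t}=(-1)^{t-t_0}u_{t_0-t}$, $t<t_0$, obtained by setting $u_0=c_{\infty,t_0,-\infty}$ and choosing $\{u_p\}_{p\in\mathbb N}\subset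 X_\infty$ with $u_{p-1}=G_\infty u_p$ for all $p\in\mathbb N$. The operator $G_\infty$ is quasinilpotent and hence is not invertible. (v) If $0\in\sigma$, the projected equation takes the form $x_{0,t}=R_{0,-1}\varepsilon_{0,t+1}-G_0x_{0,t+1}$ with $G_0=R_{0,-1}A_0$. Each $c_{0,t_0,\infty}\in\mathcal C_{G_0}(X_0)$ is a compatible boundary value in the far distant future, $c_{0,t_0,\infty}=\lim_{r\to\infty}(-1)^{r-t_0}G_0^{r-t_0}x_{0,r}$ (that is, there is a solution $x_0\in X_0^{\mathbb Z}$ of $( * )$ with this boundary value), and it defines a unique backward flow for $t\le t_0$ with $$x_{0,t}=\sum_{k\in\mathbb N}R_{0,-k}\,\varepsilon_{0,t+k}+(-1)^{t_0-t}G_0^{\,t_0-t}c_{0,t_0,\infty}\in X_0.\qquad(\ddagger)$$ If the restriction $G_0|_{\mathcal C_{G_0}(X_0)}$ is injective, then $x_{0,t}$ is uniquely determined by $(\ddagger)$ for all $t\in\mathbb Z$ (for $t>t_0$ the negative powers are those of the bijection $G_0|_{\mathcal C_{G_0}(X_0)}$), and the flow is subexponential if and only if $c_{0,t_0,\infty}=0$. If $G_0|_{\mathcal C_{G_0}(X_0)}$ is not injective, then the flow with the given boundary value is no longer uniquely defined for $t>t_0$: a valid solution for $t>t_0$ must be constructed by replacing the second term of $(\ddagger)$ by a compatible upstream flow $x_{c,0,t}=(-1)^{t-t_0}u_{t-t_0}$, $t>t_0$, obtained by setting $u_0=c_{0,t_0,\infty}$ and choosing $\{u_p\}_{p\in\mathbb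 N}\subset X_0$ with $u_{p-1}=G_0u_p$ for all $p\in\mathbb N$. The operator $G_0$ is quasinilpotent and hence is not invertible.
   Context: Notation: $\mathbb N=\{1,2,3,\dots\}$, $\mathbb N-1=\{0,1,2,\dots\}$, $\mathbb C_\infty=\mathbb C\cup\{\infty\}$. Spectral set: $\sigma\subset\mathbb C_\infty$ consists of those $\zeta\in\mathbb C$ for which $A(\zeta)$ has no bounded inverse in $\mathcal B(Y,X)$, together with $\infty$ if $A_1$ has no bounded inverse in $\mathcal B(Y,X)$. Standing assumptions: $\sigma\ne\emptyset$ consists of finitely many isolated points; the resolvent $R(z)=A(z)^{-1}\in\mathcal B(Y,X)$ is analytic on $\mathbb C_\infty\setminus\sigma$; $R$ has a Laurent series in a deleted neighbourhood of each spectral point (poles and isolated essential singularities are both allowed). Subexponential: a series $\varepsilon=\{\varepsilon_t\}_{t\in\mathbb Z}$ in a Banach space is subexponential if $\sum_{t\in\mathbb Z}\|\varepsilon_t\|r^{|t|}<\infty$ for all $r\in(0,1)$, equivalently $\limsup_{|t|\to\infty}\|\varepsilon_t\|^{1/|t|}\le1$. Laurent coefficients: for $\zeta\in\sigma\cap\mathbb C$ put $A_{\zeta,0}=A_0+\zeta A_1$ and write $R(z)=\sum_{j\in\mathbb Z}(z-\zeta)^jR_{\zeta,j}$, $R_{\zeta,j}\in\mathcal B(Y,X)$, for $0<|z-\zeta|<r$ with $r$ small enough. If $\infty\in\sigma$, write $R(z)=\sum_{j\in\mathbb Z}z^jR_{\infty,j}$ for $|z|>r$, where $r>0$ is such that $|\zeta|<r$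 for all $\zeta\in\sigma\cap\mathbb C$. Spectral projections: $P_\zeta=R_{\zeta,-1}A_1\in\mathcal B(X)$ and $Q_\zeta=A_1R_{\zeta,-1}\in\mathcal B(Y)$ for $\zeta\in\sigma\cap\mathbb C$; $P_\infty=R_{\infty,0}A_0$ and $Q_\infty=A_0R_{\infty,0}$ if $\infty\in\sigma$. Set $X_\zeta=P_\zeta(X)$, $Y_\zeta=Q_\zeta(Y)$. Operators: $H_\zeta=\zeta I_X-R_{\zeta,-1}A_{\zeta,0}\in\mathcal B(X)$ for $\zeta\in\sigma$, $\zeta\neq0,\infty$ (it is invertible); $G_0=R_{0,-1}A_0\in\mathcal B(X)$ if $0\in\sigma$; $G_\infty=R_{\infty,0}A_1\in\mathcal B(X)$ if $\infty\in\sigma$. Weighted differences ($\zeta\ne0,\infty$): $\Delta_\zeta\varepsilon_{\zeta,t}=\zeta\varepsilon_{\zeta,t+1}-\varepsilon_{\zeta,t}$ and $\nabla_\zeta\varepsilon_{\zeta,t}=\zeta\varepsilon_{\zeta,t}-\varepsilon_{\zeta,t-1}$. Their negative powers ($k\in\mathbb N$) are $$\nabla_\zeta^{-k}\varepsilon_{\zeta,t}=\sum_{\ell\in\mathbb N-1}\binom{k-1+\ell}{\ell}\zeta^{-k-\ell}\varepsilon_{\zeta,t-\ell}\quad(|\zeta|>1),$$ $$\Delta_\zeta^{-k}\varepsilon_{\zeta,t+k}=(-1)^k\sum_{r\in\mathbb N-1}\binom{k-1+r}{r}\zeta^r\varepsilon_{\zeta,t+k+r}\quad(0<|\zeta|<1).$$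 When $|\zeta|=1$ the same formulas are used with the truncated series $\varepsilon_{\zeta,t_0^+}$ (in $\nabla_\zeta^{-k}$) and $\varepsilon_{\zeta,t_0^-}$ (in $\Delta_\zeta^{-k}$) in place of $\varepsilon_\zeta$, where the sums are finite. Here $\varepsilon_{\zeta,t_0^+,t}=0$ for $t\le t_0$ and $\varepsilon_{\zeta,t_0^+,t}=\varepsilon_{\zeta,t}$ for $t>t_0$, while $\varepsilon_{\zeta,t_0^-,t}=\varepsilon_{\zeta,t}$ for $t\le t_0$ and $\varepsilon_{\zeta,t_0^-,t}=0$ for $t>t_0$. Algebraic core: for a Banach space $U$ and $G\in\mathcal B(U)$, $\mathcal C_G(U)=\{u_0\in U\mid\exists\{u_p\}_{p\in\mathbb N}\subset U\text{ with }u_{p-1}=Gu_p\text{ for all }p\in\mathbb N\}$. In $\mathcal C_{G_\infty}(X_\infty)$ and $\mathcal C_{G_0}(X_0)$ the operators are restricted to the invariant subspaces $X_\infty$, $X_0$. $G$ is injective on the core implies that $G$ restricts to a bijection of the core onto itself. An operator $G$ is quasinilpotent if $\|G^p\|^{1/p}\to0$ as $p\to\infty$. *)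

theory Defs
  imports "HOL-Analysis.Analysis"
begin

section \<open>Complex Banach spaces\<close>

text \<open>
  The library only has real Banach spaces.  A complex Banach space is a real one with a
  compatible multiplication by complex scalars for which the norm is homogeneous.
\<close>

class complex_normed_vector = real_normed_vector +
  fixes scaleC :: "complex \<Rightarrow> 'a \<Rightarrow> 'a"  (infixr "*\<^sub>C" 75)
  assumes scaleC_add_right: "c *\<^sub>C (x + y) = c *\<^sub>C x + c *\<^sub>C y"
    and scaleC_add_left: "(c + d) *\<^sub>C x = c *\<^sub>C x + d *\<^sub>C x"
    and scaleC_scaleC: "c *\<^sub>C (d *\<^sub>C x) = (c * d) *\<^sub>C x"
    and scaleC_of_real: "complex_of_real r *\<^sub>C x = r *\<^sub>R x"
    and norm_scaleC: "norm (c *\<^sub>C x) = cmod c * norm x"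

class complex_banach = complex_normed_vector + banach

instantiation complex :: complex_banach
begin

definition scaleC_complex :: "complex \<Rightarrow> complex \<Rightarrow> complex" where
  "scaleC_complex c x = c * x"

instance
  by standard (simp_all add: scaleC_complex_def algebra_simps norm_mult scaleR_conv_of_real)

end

lemma scaleC_one: "1 *\<^sub>C x = (x :: 'a :: complex_normed_vector)"
  using scaleC_of_real[of 1 x] by simp

lemma scaleC_zero_left: "0 *\<^sub>C x = (0 :: 'a :: complex_normed_vector)"
  using scaleC_of_real[of 0 x] by simp

lemma bounded_linear_scaleC_right:
  "bounded_linear (\<lambda>x :: 'a :: complex_normed_vector. c *\<^sub>C x)"
proof (rule bounded_linear_intro[where K = "cmod c"])
  fix x y :: 'a and r :: real
  show "c *\<^sub>C (x + y) = c *\<^sub>C x + c *\<^sub>C y" by (rule scaleC_add_right)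
  show "c *\<^sub>C (r *\<^sub>R x) = r *\<^sub>R (c *\<^sub>C x)"
    by (simp add: scaleC_of_real[symmetric] scaleC_scaleC mult.commute)
  show "norm (c *\<^sub>C x) \<le> norm x * cmod c" by (simp add: norm_scaleC mult.commute)
qed

text \<open>Bounded linear maps into a complex normed space inherit complex scalars pointwise.\<close>

instantiation blinfun :: (real_normed_vector, complex_normed_vector) complex_normed_vector
begin

definition scaleC_blinfun :: "complex \<Rightarrow> ('a \<Rightarrow>\<^sub>L 'b) \<Rightarrow> ('a \<Rightarrow>\<^sub>L 'b)" where
  "scaleC_blinfun c f = Blinfun (\<lambda>x. c *\<^sub>C blinfun_apply f x)"

lemma blinfun_apply_scaleC_aux:
  "blinfun_apply (c *\<^sub>C f) x = c *\<^sub>C blinfun_apply f x" for f :: "'a \<Rightarrow>\<^sub>L 'b"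
  unfolding scaleC_blinfun_def
  by (subst bounded_linear_Blinfun_apply)
    (auto intro: bounded_linear_compose[OF bounded_linear_scaleC_right] blinfun.bounded_linear_right)

lemma norm_scaleC_blinfun_le: "norm (c *\<^sub>C f) \<le> cmod c * norm f" for f :: "'a \<Rightarrow>\<^sub>L 'b"
  by (rule norm_blinfun_bound)
    (auto simp: blinfun_apply_scaleC_aux norm_scaleC mult.assoc intro: mult_left_mono norm_blinfun)

instance
proof
  fix c d :: complex and r :: real and f g :: "'a \<Rightarrow>\<^sub>L 'b"
  show "c *\<^sub>C (f + g) = c *\<^sub>C f + c *\<^sub>C g"
    by (rule blinfun_eqI) (simp add: blinfun_apply_scaleC_aux blinfun.add_left scaleC_add_right)
  show "(c + d) *\<^sub>C f = c *\<^sub>C f + d *\<^sub>C f"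
    by (rule blinfun_eqI) (simp add: blinfun_apply_scaleC_aux blinfun.add_left scaleC_add_left)
  show eq: "c *\<^sub>C (d *\<^sub>C f) = (c * d) *\<^sub>C f" for c d
    by (rule blinfun_eqI) (simp add: blinfun_apply_scaleC_aux scaleC_scaleC)
  show "complex_of_real r *\<^sub>C f = r *\<^sub>R f"
    by (rule blinfun_eqI) (simp add: blinfun_apply_scaleC_aux scaleC_of_real blinfun.scaleR_left)
  show "norm (c *\<^sub>C f) = cmod c * norm f"
  proof (cases "c = 0")
    case True
    then show ?thesis using norm_scaleC_blinfun_le[of c f] by simp
  next
    case False
    have "f = inverse c *\<^sub>C (c *\<^sub>C f)"
      using False by (intro blinfun_eqI) (simp add: eq blinfun_apply_scaleC_aux scaleC_one)
    then have "norm f \<le> cmod (inverse c) * norm (c *\<^sub>C f)"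
      using norm_scaleC_blinfun_le[of "inverse c" "c *\<^sub>C f"] by simp
    then have "cmod c * norm f \<le> norm (c *\<^sub>C f)"
      using False
      by (simp add: norm_inverse pos_le_divide_eq mult.commute flip: divide_inverse_commute)
    then show ?thesis using norm_scaleC_blinfun_le[of c f] by linarith
  qed
qed

end

instance blinfun :: (real_normed_vector, complex_banach) complex_banach ..


section \<open>Bounded complex-linear operators\<close>

text \<open>
  The space \<open>B(U,V)\<close> of bounded complex-linear operators is the set of those elements of
  \<open>U \<Rightarrow>\<^sub>L V\<close> that satisfy \<open>clinear_op\<close>; the operator norm is the same.
\<close>

definition clinear_op ::
  "('a::complex_normed_vector \<Rightarrow>\<^sub>L 'b::complex_normed_vector) \<Rightarrow> bool" where
  "clinear_op T \<longleftrightarrow>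
    (\<forall>c x. blinfun_apply T (c *\<^sub>C x) = c *\<^sub>C blinfun_apply T x)"

definition bounded_inverse ::
  "('a::complex_normed_vector \<Rightarrow>\<^sub>L 'b::complex_normed_vector) \<Rightarrow> ('b \<Rightarrow>\<^sub>L 'a) \<Rightarrow> bool" where
  "bounded_inverse T S \<longleftrightarrow>
    clinear_op S \<and> S o\<^sub>L T = id_blinfun \<and> T o\<^sub>L S = id_blinfun"

definition has_bounded_inverse ::
  "('a::complex_normed_vector \<Rightarrow>\<^sub>L 'b::complex_normed_vector) \<Rightarrow> bool" where
  "has_bounded_inverse T \<longleftrightarrow> (\<exists>S. bounded_inverse T S)"

definition op_inv ::
  "('a::complex_normed_vector \<Rightarrow>\<^sub>L 'b::complex_normed_vector) \<Rightarrow> ('b \<Rightarrow>\<^sub>L 'a)" where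
  "op_inv T = (THE S. bounded_inverse T S)"

primrec op_pow ::
  "('a::complex_normed_vector \<Rightarrow>\<^sub>L 'a) \<Rightarrow> nat \<Rightarrow> ('a \<Rightarrow>\<^sub>L 'a)" where
  "op_pow T 0 = id_blinfun"
| "op_pow T (Suc n) = T o\<^sub>L op_pow T n"

definition op_powi ::
  "('a::complex_normed_vector \<Rightarrow>\<^sub>L 'a) \<Rightarrow> int \<Rightarrow> ('a \<Rightarrow>\<^sub>L 'a)" where
  "op_powi T n = (if n \<ge> 0 then op_pow T (nat n) else op_pow (op_inv T) (nat (- n)))"

definition quasinilpotent :: "('a::complex_normed_vector \<Rightarrow>\<^sub>L 'a) \<Rightarrow> bool" where
  "quasinilpotent T \<longleftrightarrow> (\<lambda>p. root p (norm (op_pow T p))) \<longlonglongrightarrow> 0"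

text \<open>
  The algebraic core of the restriction of \<open>G\<close> to a subspace \<open>U\<close>: the starting points of
  infinite backward \<open>G\<close>-orbits inside \<open>U\<close>.
\<close>

definition backward_orbit ::
  "('a::complex_normed_vector \<Rightarrow>\<^sub>L 'a) \<Rightarrow> 'a set \<Rightarrow> 'a \<Rightarrow> (nat \<Rightarrow> 'a) \<Rightarrow> bool" where
  "backward_orbit G U c u \<longleftrightarrow>
    u 0 = c \<and> (\<forall>p. u p \<in> U) \<and> (\<forall>p\<ge>1. u (p - 1) = blinfun_apply G (u p))"

definition algebraic_core ::
  "('a::complex_normed_vector \<Rightarrow>\<^sub>L 'a) \<Rightarrow> 'a set \<Rightarrow> 'a set" where
  "algebraic_core G U = {c. \<exists>u. backward_orbit G U c u}"

text \<open>
  Integer powers of the restriction of \<open>G\<close> to its core; negative powers are meaningful when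
  this restriction is a bijection of the core onto itself.
\<close>

definition core_powi ::
  "('a::complex_normed_vector \<Rightarrow>\<^sub>L 'a) \<Rightarrow> 'a set \<Rightarrow> int \<Rightarrow> 'a \<Rightarrow> 'a" where
  "core_powi G U n c =
    (if n \<ge> 0 then (blinfun_apply G ^^ nat n) c
     else (inv_into (algebraic_core G U) (blinfun_apply G) ^^ nat (- n)) c)"


section \<open>Pencil, spectral set, resolvent and Laurent coefficients\<close>

text \<open>The extended plane is \<open>complex option\<close>, with \<open>None\<close> as the point at infinity.\<close>

definition pencil ::
  "('x::complex_banach \<Rightarrow>\<^sub>L 'y::complex_banach) \<Rightarrow> ('x \<Rightarrow>\<^sub>L 'y) \<Rightarrow> complex \<Rightarrow> ('x \<Rightarrow>\<^sub>L 'y)" where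
  "pencil A0 A1 z = A0 + z *\<^sub>C A1"

definition spectral_set ::
  "('x::complex_banach \<Rightarrow>\<^sub>L 'y::complex_banach) \<Rightarrow> ('x \<Rightarrow>\<^sub>L 'y) \<Rightarrow> complex option set" where
  "spectral_set A0 A1 =
    Some ` {\<zeta>. \<not> has_bounded_inverse (pencil A0 A1 \<zeta>)} \<union>
    {\<zeta>. \<zeta> = None \<and> \<not> has_bounded_inverse A1}"

definition resolvent ::
  "('x::complex_banach \<Rightarrow>\<^sub>L 'y::complex_banach) \<Rightarrow> ('x \<Rightarrow>\<^sub>L 'y) \<Rightarrow> complex \<Rightarrow> ('y \<Rightarrow>\<^sub>L 'x)" where
  "resolvent A0 A1 z = op_inv (pencil A0 A1 z)"

text \<open>
  Analyticity of a vector-valued function at a point of the extended plane, in the sense of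
  local power series expansions (the library notion is for complex-valued functions only).
\<close>

fun vector_analytic_at ::
  "(complex \<Rightarrow> 'a::complex_banach) \<Rightarrow> complex option \<Rightarrow> bool" where
  "vector_analytic_at f (Some \<zeta>) \<longleftrightarrow>
    (\<exists>a :: nat \<Rightarrow> 'a. \<forall>\<^sub>F z in nhds \<zeta>. ((\<lambda>n. (z - \<zeta>) ^ n *\<^sub>C a n) has_sum f z) UNIV)"
| "vector_analytic_at f None \<longleftrightarrow>
    (\<exists>a :: nat \<Rightarrow> 'a. \<forall>\<^sub>F z in at_infinity. ((\<lambda>n. (1 / z) ^ n *\<^sub>C a n) has_sum f z) UNIV)"

fun laurent_series_at ::
  "(complex \<Rightarrow> 'a::complex_banach) \<Rightarrow> complex option \<Rightarrow> (int \<Rightarrow> 'a) \<Rightarrow> bool" where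
  "laurent_series_at f (Some \<zeta>) a \<longleftrightarrow>
    (\<forall>\<^sub>F z in at \<zeta>. ((\<lambda>j. ((z - \<zeta>) powi j) *\<^sub>C a j) has_sum f z) UNIV)"
| "laurent_series_at f None a \<longleftrightarrow>
    (\<forall>\<^sub>F z in at_infinity. ((\<lambda>j. (z powi j) *\<^sub>C a j) has_sum f z) UNIV)"

text \<open>
  Below, \<open>R \<zeta> j\<close> is the Laurent coefficient of index \<open>j\<close> of the resolvent at the spectral
  point \<open>\<zeta>\<close>.
\<close>

fun projX ::
  "('x::complex_banach \<Rightarrow>\<^sub>L 'y::complex_banach) \<Rightarrow> ('x \<Rightarrow>\<^sub>L 'y) \<Rightarrow>
    (complex option \<Rightarrow> int \<Rightarrow> ('y \<Rightarrow>\<^sub>L 'x)) \<Rightarrow> complex option \<Rightarrow> ('x \<Rightarrow>\<^sub>L 'x)" where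
  "projX A0 A1 R (Some \<zeta>) = R (Some \<zeta>) (-1) o\<^sub>L A1"
| "projX A0 A1 R None = R None 0 o\<^sub>L A0"

fun projY ::
  "('x::complex_banach \<Rightarrow>\<^sub>L 'y::complex_banach) \<Rightarrow> ('x \<Rightarrow>\<^sub>L 'y) \<Rightarrow>
    (complex option \<Rightarrow> int \<Rightarrow> ('y \<Rightarrow>\<^sub>L 'x)) \<Rightarrow> complex option \<Rightarrow> ('y \<Rightarrow>\<^sub>L 'y)" where
  "projY A0 A1 R (Some \<zeta>) = A1 o\<^sub>L R (Some \<zeta>) (-1)"
| "projY A0 A1 R None = A0 o\<^sub>L R None 0"

definition spaceX ::
  "('x::complex_banach \<Rightarrow>\<^sub>L 'y::complex_banach) \<Rightarrow> ('x \<Rightarrow>\<^sub>L 'y) \<Rightarrow>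
    (complex option \<Rightarrow> int \<Rightarrow> ('y \<Rightarrow>\<^sub>L 'x)) \<Rightarrow> complex option \<Rightarrow> 'x set" where
  "spaceX A0 A1 R \<zeta> = range (blinfun_apply (projX A0 A1 R \<zeta>))"

definition opH ::
  "('x::complex_banach \<Rightarrow>\<^sub>L 'y::complex_banach) \<Rightarrow> ('x \<Rightarrow>\<^sub>L 'y) \<Rightarrow>
    (complex option \<Rightarrow> int \<Rightarrow> ('y \<Rightarrow>\<^sub>L 'x)) \<Rightarrow> complex \<Rightarrow> ('x \<Rightarrow>\<^sub>L 'x)" where
  "opH A0 A1 R \<zeta> = \<zeta> *\<^sub>C id_blinfun - (R (Some \<zeta>) (-1) o\<^sub>L pencil A0 A1 \<zeta>)"

definition opG0 ::
  "('x::complex_banach \<Rightarrow>\<^sub>L 'y::complex_banach) \<Rightarrow>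
    (complex option \<Rightarrow> int \<Rightarrow> ('y \<Rightarrow>\<^sub>L 'x)) \<Rightarrow> ('x \<Rightarrow>\<^sub>L 'x)" where
  "opG0 A0 R = R (Some 0) (-1) o\<^sub>L A0"

definition opGinf ::
  "('x::complex_banach \<Rightarrow>\<^sub>L 'y::complex_banach) \<Rightarrow>
    (complex option \<Rightarrow> int \<Rightarrow> ('y \<Rightarrow>\<^sub>L 'x)) \<Rightarrow> ('x \<Rightarrow>\<^sub>L 'x)" where
  "opGinf A1 R = R None 0 o\<^sub>L A1"


section \<open>Two-sided sequences and the projected equation of motion\<close>

definition subexponential :: "(int \<Rightarrow> 'a::complex_banach) \<Rightarrow> bool" where
  "subexponential e \<longleftrightarrow>
    (\<forall>r. 0 < r \<and> r < 1 \<longrightarrow> (\<lambda>t. norm (e t) * r ^ nat \<bar>t\<bar>) summable_on UNIV)"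

definition proj_noise ::
  "('x::complex_banach \<Rightarrow>\<^sub>L 'y::complex_banach) \<Rightarrow> ('x \<Rightarrow>\<^sub>L 'y) \<Rightarrow>
    (complex option \<Rightarrow> int \<Rightarrow> ('y \<Rightarrow>\<^sub>L 'x)) \<Rightarrow> (int \<Rightarrow> 'y) \<Rightarrow> complex option \<Rightarrow> int \<Rightarrow> 'y" where
  "proj_noise A0 A1 R \<epsilon> \<zeta> t = blinfun_apply (projY A0 A1 R \<zeta>) (\<epsilon> t)"

definition proj_solution ::
  "('x::complex_banach \<Rightarrow>\<^sub>L 'y::complex_banach) \<Rightarrow> ('x \<Rightarrow>\<^sub>L 'y) \<Rightarrow>
    (complex option \<Rightarrow> int \<Rightarrow> ('y \<Rightarrow>\<^sub>L 'x)) \<Rightarrow> (int \<Rightarrow> 'y) \<Rightarrow> complex option \<Rightarrow>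
    (int \<Rightarrow> 'x) \<Rightarrow> bool" where
  "proj_solution A0 A1 R \<epsilon> \<zeta> x \<longleftrightarrow>
    (\<forall>t. x t \<in> spaceX A0 A1 R \<zeta>) \<and>
    (\<forall>t. blinfun_apply A0 (x t) + blinfun_apply A1 (x (t - 1)) = proj_noise A0 A1 R \<epsilon> \<zeta> t)"

definition trunc_plus :: "int \<Rightarrow> (int \<Rightarrow> 'a::zero) \<Rightarrow> int \<Rightarrow> 'a" where
  "trunc_plus t0 e t = (if t \<le> t0 then 0 else e t)"

definition trunc_minus :: "int \<Rightarrow> (int \<Rightarrow> 'a::zero) \<Rightarrow> int \<Rightarrow> 'a" where
  "trunc_minus t0 e t = (if t \<le> t0 then e t else 0)"

text \<open>
  The negative powers of the weighted differences \<open>\<nabla>\<^sub>\<zeta>\<close> and \<open>\<Delta>\<^sub>\<zeta>\<close>, for exponents \<open>k \<ge> 1\<close>;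
  \<open>nabla_npow \<zeta> k e t\<close> is the value of \<open>\<nabla>\<^sub>\<zeta>\<close> to the power \<open>-k\<close> applied to \<open>e\<close> at time \<open>t\<close>.
\<close>

definition nabla_term ::
  "complex \<Rightarrow> nat \<Rightarrow> (int \<Rightarrow> 'a::complex_banach) \<Rightarrow> int \<Rightarrow> nat \<Rightarrow> 'a" where
  "nabla_term \<zeta> k e t l =
    (of_nat ((k - 1 + l) choose l) * \<zeta> powi (- int k - int l)) *\<^sub>C e (t - int l)"

definition nabla_npow ::
  "complex \<Rightarrow> nat \<Rightarrow> (int \<Rightarrow> 'a::complex_banach) \<Rightarrow> int \<Rightarrow> 'a" where
  "nabla_npow \<zeta> k e t = (\<Sum>\<^sub>\<infinity>l. nabla_term \<zeta> k e t l)"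

definition delta_term ::
  "complex \<Rightarrow> nat \<Rightarrow> (int \<Rightarrow> 'a::complex_banach) \<Rightarrow> int \<Rightarrow> nat \<Rightarrow> 'a" where
  "delta_term \<zeta> k e t r =
    (of_nat ((k - 1 + r) choose r) * \<zeta> ^ r) *\<^sub>C e (t + int r)"

definition delta_npow ::
  "complex \<Rightarrow> nat \<Rightarrow> (int \<Rightarrow> 'a::complex_banach) \<Rightarrow> int \<Rightarrow> 'a" where
  "delta_npow \<zeta> k e t = (-1) ^ k *\<^sub>R (\<Sum>\<^sub>\<infinity>r. delta_term \<zeta> k e t r)"

text \<open>Terms (indexed by \<open>k \<ge> 1\<close>) of the series in the forward and backward flows.\<close>

definition forward_term ::
  "(complex option \<Rightarrow> int \<Rightarrow> ('y::complex_banach \<Rightarrow>\<^sub>L 'x::complex_banach)) \<Rightarrow> complex \<Rightarrow>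
    (int \<Rightarrow> 'y) \<Rightarrow> int \<Rightarrow> nat \<Rightarrow> 'x" where
  "forward_term R \<zeta> e t k =
    (-1) ^ k *\<^sub>R blinfun_apply (R (Some \<zeta>) (- int k)) (nabla_npow \<zeta> k e t)"

definition backward_term ::
  "(complex option \<Rightarrow> int \<Rightarrow> ('y::complex_banach \<Rightarrow>\<^sub>L 'x::complex_banach)) \<Rightarrow> complex \<Rightarrow>
    (int \<Rightarrow> 'y) \<Rightarrow> int \<Rightarrow> nat \<Rightarrow> 'x" where
  "backward_term R \<zeta> e t k =
    (-1) ^ k *\<^sub>R blinfun_apply (R (Some \<zeta>) (- int k)) (delta_npow \<zeta> k e (t + int k))"

text \<open>
  Boundary values.  In the last two, \<open>nat\<close> truncates the exponent only for finitely many \<open>r\<close>,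
  which does not affect the limit.
\<close>

definition past_value ::
  "('a::complex_banach \<Rightarrow>\<^sub>L 'a) \<Rightarrow> int \<Rightarrow> (int \<Rightarrow> 'a) \<Rightarrow> 'a \<Rightarrow> bool" where
  "past_value H t0 x c \<longleftrightarrow>
    (\<lambda>r::nat. blinfun_apply (op_powi H (- int r - t0)) (x (- int r))) \<longlonglongrightarrow> c"

definition future_value ::
  "('a::complex_banach \<Rightarrow>\<^sub>L 'a) \<Rightarrow> int \<Rightarrow> (int \<Rightarrow> 'a) \<Rightarrow> 'a \<Rightarrow> bool" where
  "future_value H t0 x c \<longleftrightarrow>
    (\<lambda>r::nat. blinfun_apply (op_powi H (int r - t0)) (x (int r))) \<longlonglongrightarrow> c"

definition past_value_inf ::
  "('a::complex_banach \<Rightarrow>\<^sub>L 'a) \<Rightarrow> int \<Rightarrow> (int \<Rightarrow> 'a) \<Rightarrow> 'a \<Rightarrow> bool" where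
  "past_value_inf G t0 x c \<longleftrightarrow>
    (\<lambda>r::nat. ((-1) powi (int r + t0)) *\<^sub>R
       blinfun_apply (op_pow G (nat (int r + t0))) (x (- int r))) \<longlonglongrightarrow> c"

definition future_value_zero ::
  "('a::complex_banach \<Rightarrow>\<^sub>L 'a) \<Rightarrow> int \<Rightarrow> (int \<Rightarrow> 'a) \<Rightarrow> 'a \<Rightarrow> bool" where
  "future_value_zero G t0 x c \<longleftrightarrow>
    (\<lambda>r::nat. ((-1) powi (int r - t0)) *\<^sub>R
       blinfun_apply (op_pow G (nat (int r - t0))) (x (int r))) \<longlonglongrightarrow> c"

end

theory Submission
  imports Defs
begin

text \<open>
  Uniqueness of Laurent coefficients turns \<open>R(z) A(z) = I\<close> and \<open>A(z) R(z) = I\<close> into the product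
  rule \<open>R\<^sub>j A\<^sub>1 R\<^sub>k = ([k < 0] - [j \<ge> 0]) R\<^sub>j\<^sub>+\<^sub>k\<^sub>+\<^sub>1\<close>. On \<open>X\<^sub>\<zeta>\<close> it reduces the projected equation to a
  first-order recursion \<open>x\<^sub>t = F x\<^sub>t\<^sub>-\<^sub>1 + f\<^sub>t\<close>, after reversing time if \<open>|\<zeta>| < 1\<close>: \<open>F\<close> is the inverse of
  \<open>H\<^sub>\<zeta>\<close> for \<open>|\<zeta>| > 1\<close>, \<open>H\<^sub>\<zeta>\<close> for \<open>0 < |\<zeta>| < 1\<close>, and minus \<open>G\<^sub>\<zeta>\<close> for \<open>\<zeta> = \<infinity>, 0\<close>. In these cases the powers of
  \<open>F\<close> decay geometrically on \<open>X\<^sub>\<zeta>\<close>, so \<open>\<Sum>\<^sub>l F\<^sup>l f\<^sub>t\<^sub>-\<^sub>l\<close> is a subexponential solution with boundary value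
  \<open>0\<close>, and every other solution differs from it by a free flow \<open>y\<^sub>t = F y\<^sub>t\<^sub>-\<^sub>1\<close>, whose boundary value is
  \<open>y\<^sub>t\<^sub>0\<close> and which grows exponentially backwards in time unless \<open>y\<^sub>t\<^sub>0 = 0\<close>. Expanding \<open>F\<^sup>l\<close> in the
  quasinilpotent operator \<open>R\<^sub>-\<^sub>1 A\<^sub>\<zeta>\<^sub>,\<^sub>0\<close> and interchanging the two sums gives the series of the
  statement. For \<open>|\<zeta>| = 1\<close> the same computation is applied to the truncated noise, where the sums
  over \<open>l\<close> are finite.
\<close>

section \<open>Complex scalars, sums and growth of sequences\<close>

text \<open>The singularities may be essential, so the operator R_(-1) A_(zeta,0) is quasinilpotent
  but need not be nilpotent, and the expansions need not terminate. What makes them converge is a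
  trade: the binomial coefficients grow in l at a rate as close to 1 as desired, provided that they
  may grow at some large rate \<open>E\<close> in k; the coefficients R_(-1-k) decay faster than
  every geometric sequence and absorb \<open>E ^ k\<close>. No contour integral and no functional
  calculus enters. Averaging over roots of unity takes the place of the Cauchy integral, boundedness
  of the terms of a summable family that of the Cauchy estimates. The powers of \<open>H\<close> and
  of its inverse on the spectral subspace are introduced through their series, and Pascal's rule
  shows that \<open>H\<close> shifts these series by one index. At 0 and at infinity the recursion
  operator may fail to be injective on its core, so solutions are parametrised by backward orbits
  rather than by negative powers.\<close>

lemma bounded_bilinear_scaleC:
  "bounded_bilinear (\<lambda>c (x :: 'a::complex_normed_vector). c *\<^sub>C x)"
proof (standard, goal_cases)
  case (3 r a b)
  show ?case
    by (metis scaleC_of_real scaleC_scaleC scaleR_conv_of_real)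
next
  case (4 a r b)
  show ?case by (simp add: bounded_linear_scaleC_right linear_simps)
next
  case 5
  show ?case by (intro exI[of _ 1]) (simp add: norm_scaleC)
qed (simp_all add: scaleC_add_left scaleC_add_right)

interpretation scaleC: bounded_bilinear
  "\<lambda>c (x :: 'a::complex_normed_vector). c *\<^sub>C x"
  by (rule bounded_bilinear_scaleC)

lemma clinear_op_apply: "clinear_op T \<Longrightarrow> blinfun_apply T (c *\<^sub>C x) = c *\<^sub>C blinfun_apply T x"
  by (simp add: clinear_op_def)

lemma compose_scaleC_left: "(c *\<^sub>C S) o\<^sub>L T = c *\<^sub>C (S o\<^sub>L T)"
  by (rule blinfun_eqI) (simp add: blinfun_apply_scaleC_aux)

lemma compose_scaleC_right: "clinear_op S \<Longrightarrow> S o\<^sub>L (c *\<^sub>C T) = c *\<^sub>C (S o\<^sub>L T)"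
  by (rule blinfun_eqI) (simp add: blinfun_apply_scaleC_aux clinear_op_apply)

lemma has_sum_blinfun_apply:
  "(f has_sum S) A \<Longrightarrow> ((\<lambda>n. blinfun_apply T (f n)) has_sum blinfun_apply T S) A"
  by (rule has_sum_bounded_linear[OF blinfun.bounded_linear_right])

lemma has_sum_scaleC: "(f has_sum S) A \<Longrightarrow> ((\<lambda>n. c *\<^sub>C f n) has_sum c *\<^sub>C S) A"
  by (rule has_sum_bounded_linear[OF bounded_linear_scaleC_right])

lemma has_sum_compose_left: "(f has_sum S) A \<Longrightarrow> ((\<lambda>n. T o\<^sub>L f n) has_sum (T o\<^sub>L S)) A"
  by (rule has_sum_bounded_linear[OF
        bounded_bilinear.bounded_linear_right[OF bounded_bilinear_blinfun_compose]])

lemma has_sum_compose_right: "(f has_sum S) A \<Longrightarrow> ((\<lambda>n. f n o\<^sub>L T) has_sum (S o\<^sub>L T)) A"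
  by (rule has_sum_bounded_linear[OF
        bounded_bilinear.bounded_linear_left[OF bounded_bilinear_blinfun_compose]])

lemma has_sum_apply: "(f has_sum S) A \<Longrightarrow> ((\<lambda>n. blinfun_apply (f n) x) has_sum blinfun_apply S x) A"
  by (rule has_sum_bounded_linear[OF blinfun.bounded_linear_left])

lemma has_sum_sum:
  fixes f :: "'b \<Rightarrow> 'c \<Rightarrow> 'a::topological_comm_monoid_add"
  assumes "\<And>k. k \<in> K \<Longrightarrow> (f k has_sum S k) A"
  shows "((\<lambda>j. \<Sum>k\<in>K. f k j) has_sum (\<Sum>k\<in>K. S k)) A"
  using assms by (induction K rule: infinite_finite_induct) (auto intro!: has_sum_add)

lemma has_sum_diff:
  fixes f g :: "'b \<Rightarrow> 'a::topological_ab_group_add"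
  assumes "(f has_sum a) A" "(g has_sum b) A"
  shows "((\<lambda>x. f x - g x) has_sum (a - b)) A"
  using has_sum_add[of f A a "\<lambda>x. - g x" "- b"] assms by (simp add: has_sum_uminus)

lemma abs_summable_on_comparison_mult:
  fixes f :: "'b \<Rightarrow> 'a::banach"
  assumes "g summable_on A" "\<And>x. x \<in> A \<Longrightarrow> norm (f x) \<le> M * g x"
  shows "f abs_summable_on A"
  using assms summable_on_cmult_right[of g A M]
  by (intro Infinite_Sum.abs_summable_on_comparison_test'[where g = "\<lambda>x. M * g x"]) auto

lemma summable_on_geometric_nat:
  fixes q :: real
  assumes "0 \<le> q" "q < 1"
  shows "(\<lambda>n::nat. q ^ n) summable_on UNIV"
  using assms by (auto simp: summable_on_UNIV_nonneg_real_iff)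

lemma summable_on_geometric_int:
  fixes q :: real
  assumes "0 \<le> q" "q < 1"
  shows "(\<lambda>t::int. q ^ nat \<bar>t\<bar>) summable_on UNIV"
proof -
  have "(\<lambda>t::int. q ^ nat \<bar>t\<bar>) summable_on range int"
    using summable_on_geometric_nat[OF assms] by (subst summable_on_reindex) (auto simp: o_def)
  moreover have "(\<lambda>t::int. q ^ nat \<bar>t\<bar>) summable_on range (\<lambda>n. - int n)"
    using summable_on_geometric_nat[OF assms]
    by (subst summable_on_reindex) (auto simp: o_def inj_on_def)
  ultimately have "(\<lambda>t::int. q ^ nat \<bar>t\<bar>) summable_on (range int \<union> range (\<lambda>n. - int n))"
    by (rule summable_on_union)
  moreover have "range int \<union> range (\<lambda>n. - int n) = UNIV"
    by (auto intro: int_cases2)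
  ultimately show ?thesis by simp
qed

text \<open>The norms need not be summable here, so the Cauchy property has to do: beyond some
  finite set, one further index moves a partial sum by less than 2.\<close>

lemma summable_on_imp_bounded:
  fixes f :: "'b \<Rightarrow> 'a::real_normed_vector"
  assumes "f summable_on A"
  shows "\<exists>M. \<forall>x\<in>A. norm (f x) \<le> M"
proof -
  obtain s where "(sum f \<longlongrightarrow> s) (finite_subsets_at_top A)"
    using assms by (auto simp: summable_on_def has_sum_def)
  then have "\<forall>\<^sub>F F in finite_subsets_at_top A. dist (sum f F) s < 1"
    by (rule tendstoD) simp
  then obtain F0 where F0: "finite F0" "F0 \<subseteq> A"
    and near: "\<And>F. finite F \<Longrightarrow> F0 \<subseteq> F \<Longrightarrow> F \<subseteq> A \<Longrightarrow> dist (sum f F) s < 1"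
    by (auto simp: eventually_finite_subsets_at_top)
  have "norm (f x) \<le> 2 + (\<Sum>y\<in>F0. norm (f y))" if "x \<in> A" for x
  proof (cases "x \<in> F0")
    case True
    then have "norm (f x) \<le> (\<Sum>y\<in>F0. norm (f y))"
      using F0 by (intro member_le_sum) auto
    then show ?thesis by simp
  next
    case False
    have "dist (sum f (insert x F0)) s < 1" "dist (sum f F0) s < 1"
      using that F0 by (auto intro!: near)
    then have "dist (sum f (insert x F0)) (sum f F0) < 2"
      using dist_triangle2[of "sum f (insert x F0)" "sum f F0" s] by simp
    then have "norm (f x) < 2" using False F0 by (simp add: dist_norm)
    moreover have "0 \<le> (\<Sum>y\<in>F0. norm (f y))" by (simp add: sum_nonneg)
    ultimately show ?thesis by simp
  qed
  then show ?thesis by blast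
qed

section \<open>Subexponential growth as domination by every rate above 1\<close>

lemma subexponential_iff:
  "subexponential e \<longleftrightarrow> (\<forall>s>1. \<exists>M. \<forall>t. norm (e t) \<le> M * s ^ nat \<bar>t\<bar>)"
proof (intro iffI allI impI)
  fix s :: real
  assume e: "subexponential e" and s: "s > 1"
  then have "(\<lambda>t. norm (e t) * (1 / s) ^ nat \<bar>t\<bar>) summable_on UNIV"
    by (auto simp: subexponential_def)
  from summable_on_imp_bounded[OF this]
  obtain M where "\<And>t. norm (norm (e t) * (1 / s) ^ nat \<bar>t\<bar>) \<le> M" by auto
  then have "norm (e t) \<le> M * s ^ nat \<bar>t\<bar>" for t
    using s by (simp add: power_divide pos_divide_le_eq)
  then show "\<exists>M. \<forall>t. norm (e t) \<le> M * s ^ nat \<bar>t\<bar>" by blast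
next
  assume bound: "\<forall>s>1. \<exists>M. \<forall>t. norm (e t) \<le> M * s ^ nat \<bar>t\<bar>"
  show "subexponential e"
    unfolding subexponential_def
  proof (intro allI impI)
    fix r :: real
    assume r: "0 < r \<and> r < 1"
    \<comment> \<open>Half of the decay of r pays for the growth of \<open>e\<close>: the product s
      r = sqrt r is still below 1.\<close>
    define s where "s = 1 / sqrt r"
    have s: "s > 1" and sr: "s * r = sqrt r"
      using r by (auto simp: s_def field_simps)
    obtain M where M: "\<And>t. norm (e t) \<le> M * s ^ nat \<bar>t\<bar>" using bound s by blast
    have "norm (norm (e t) * r ^ nat \<bar>t\<bar>) \<le> M * sqrt r ^ nat \<bar>t\<bar>" for t
      using mult_right_mono[OF M[of t], of "r ^ nat \<bar>t\<bar>"] r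
      by (simp flip: sr add: power_mult_distrib mult_ac)
    moreover have "(\<lambda>t::int. sqrt r ^ nat \<bar>t\<bar>) summable_on UNIV"
      using r by (intro summable_on_geometric_int) auto
    ultimately show "(\<lambda>t. norm (e t) * r ^ nat \<bar>t\<bar>) summable_on UNIV"
      by (metis (mono_tags, lifting) UNIV_I abs_summable_summable abs_summable_on_comparison_mult)
  qed
qed

lemma subexponential_bound:
  assumes "subexponential e" "s > 1"
  obtains M where "M \<ge> 0" "\<And>t. norm (e t) \<le> M * s ^ nat \<bar>t\<bar>"
proof -
  obtain M where M: "\<And>t. norm (e t) \<le> M * s ^ nat \<bar>t\<bar>"
    using assms by (auto simp: subexponential_iff)
  show thesis
  proof (rule that)
    show "M \<ge> 0" using order_trans[OF norm_ge_zero M[of 0]] by simp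
    show "norm (e t) \<le> M * s ^ nat \<bar>t\<bar>" for t by (rule M)
  qed
qed

lemma subexponential_blinfun_apply:
  assumes "subexponential e"
  shows "subexponential (\<lambda>t. blinfun_apply T (e t))"
  unfolding subexponential_iff
proof (intro allI impI)
  fix s :: real
  assume "s > 1"
  with assms obtain M where M: "\<And>t. norm (e t) \<le> M * s ^ nat \<bar>t\<bar>"
    by (auto simp: subexponential_iff)
  have "norm (blinfun_apply T (e t)) \<le> (norm T * M) * s ^ nat \<bar>t\<bar>" for t
    using order_trans[OF norm_blinfun mult_left_mono[OF M[of t], of "norm T"]]
    by (simp add: mult_ac)
  then show "\<exists>M. \<forall>t. norm (blinfun_apply T (e t)) \<le> M * s ^ nat \<bar>t\<bar>" by blast
qed

lemma subexponential_diff: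
  assumes "subexponential e" "subexponential f"
  shows "subexponential (\<lambda>t. e t - f t)"
  unfolding subexponential_iff
proof (intro allI impI)
  fix s :: real
  assume "s > 1"
  with assms obtain M M' where "\<And>t. norm (e t) \<le> M * s ^ nat \<bar>t\<bar>" "\<And>t. norm (f t) \<le> M' * s ^ nat \<bar>t\<bar>"
    by (metis subexponential_iff)
  then have "norm (e t - f t) \<le> (M + M') * s ^ nat \<bar>t\<bar>" for t
    using norm_triangle_ineq4[of "e t" "f t"] by (smt (verit) distrib_right)
  then show "\<exists>M. \<forall>t. norm (e t - f t) \<le> M * s ^ nat \<bar>t\<bar>" by blast
qed

text \<open>Reflection is an involution, so one direction suffices. Growth statements are carried to
  reversed time in this way.\<close>

lemma subexponential_reflect: "subexponential (\<lambda>t. e (a - t)) \<longleftrightarrow> subexponential e"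
proof -
  have *: "subexponential (\<lambda>t. e (a - t))" if "subexponential e" for a and e :: "int \<Rightarrow> 'a"
    unfolding subexponential_iff
  proof (intro allI impI)
    fix s :: real
    assume s: "s > 1"
    with that obtain M where M0: "M \<ge> 0" and M: "\<And>t. norm (e t) \<le> M * s ^ nat \<bar>t\<bar>"
      by (rule subexponential_bound) blast
    have "norm (e (a - t)) \<le> (M * s ^ nat \<bar>a\<bar>) * s ^ nat \<bar>t\<bar>" for t
    proof -
      have "s ^ nat \<bar>a - t\<bar> \<le> s ^ (nat \<bar>a\<bar> + nat \<bar>t\<bar>)"
        using s by (intro power_increasing) auto
      then show ?thesis
        using M[of "a - t"] M0 by (smt (verit) mult.assoc mult_left_mono power_add)
    qed
    then show "\<exists>M. \<forall>t. norm (e (a - t)) \<le> M * s ^ nat \<bar>t\<bar>" by blast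
  qed
  show ?thesis using *[of e a] *[of "\<lambda>t. e (a - t)" a] by auto
qed

section \<open>Laurent coefficients\<close>

text \<open>Stands in for Cauchy's estimate: the terms of a summable family are bounded, and their
  norms involve only the modulus of w.\<close>

lemma laurent_terms_bounded:
  fixes a :: "int \<Rightarrow> 'a::complex_banach"
  assumes "(\<lambda>j. (w powi j) *\<^sub>C a j) summable_on UNIV"
  obtains M where "M \<ge> 0" "\<And>j. cmod w powi j * norm (a j) \<le> M"
proof -
  obtain M where M: "\<And>j. norm ((w powi j) *\<^sub>C a j) \<le> M"
    using summable_on_imp_bounded[OF assms] by blast
  show thesis
  proof (rule that)
    show "M \<ge> 0" using order_trans[OF norm_ge_zero M[of 0]] .
    show "cmod w powi j * norm (a j) \<le> M" for j
      using M[of j] by (simp add: norm_scaleC norm_power_int)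
  qed
qed

text \<open>The filter that extracts one residue class of exponents modulo N from a Laurent
  series.\<close>

lemma sum_roots_of_unity_power_int:
  fixes d :: int
  assumes "N > 0"
  shows "(\<Sum>k<N. (cis (2 * pi / N) ^ k) powi d) = (if int N dvd d then of_nat N else 0)"
proof -
  define \<omega> where "\<omega> = cis (2 * pi / N)"
  define z where "z = \<omega> powi d"
  have nz: "\<omega> \<noteq> 0" by (simp add: \<omega>_def)
  have "\<omega> ^ N = 1" using assms by (simp add: \<omega>_def Complex.DeMoivre)
  then have zN: "z ^ N = 1"
    by (metis (no_types) mult.commute power_int_1_left power_int_mult power_int_of_nat z_def)
  have z: "z = cis (2 * pi * of_int d / N)"
    by (simp add: z_def \<omega>_def cis_power_int mult_ac)
  have "(\<omega> ^ k) powi d = z ^ k" for k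
    by (metis mult.commute power_int_mult power_int_of_nat z_def)
  then have sum: "(\<Sum>k<N. (\<omega> ^ k) powi d) = (\<Sum>k<N. z ^ k)" by simp
  show ?thesis
  proof (cases "int N dvd d")
    case True
    then obtain m where "d = int N * m" by blast
    then have "z = 1"
      using \<open>\<omega> ^ N = 1\<close> by (simp add: z_def power_int_mult)
    then show ?thesis using sum True by (simp add: \<omega>_def)
  next
    case False
    have "z \<noteq> 1"
    proof
      assume "z = 1"
      then have "cos (2 * pi * of_int d / N) = 1"
        unfolding z by (metis cis.sel(1) one_complex.sel(1))
      then obtain n :: int where "2 * pi * of_int d / N = of_int n * 2 * pi"
        by (auto simp: cos_one_2pi_int)
      then have "real_of_int d = of_int (n * int N)" using assms by (simp add: field_simps)
      then have "d = n * int N" by (simp only: of_int_eq_iff)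
      then show False using False by simp
    qed
    then show ?thesis using sum zN False by (simp add: \<omega>_def geometric_sum)
  qed
qed

text \<open>A discrete Cauchy integral: averaging over N-th roots of unity keeps only the indices
  congruent to m modulo N. For large N all of these except m itself lie outside a given finite set,
  hence in a small tail.\<close>

lemma laurent_coefficients_unique:
  fixes a :: "int \<Rightarrow> 'a::complex_banach"
  assumes r: "0 \<le> r1" "r1 < r2"
    and a: "\<And>w. r1 < cmod w \<Longrightarrow> cmod w < r2 \<Longrightarrow> ((\<lambda>j. (w powi j) *\<^sub>C a j) has_sum 0) UNIV"
  shows "a m = 0"
proof -
  \<comment> \<open>The terms are bounded at \<rho>1 and at \<rho>2; at the radius between them this
    gives geometric decay in both directions, hence absolute convergence.\<close>
  define \<rho>1 \<rho> \<rho>2 where "\<rho>1 = (3 * r1 + r2) / 4" and "\<rho> = (r1 + r2) / 2" and "\<rho>2 = (r1 + 3 * r2) / 4"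
  have \<rho>: "r1 < \<rho>1" "0 < \<rho>1" "\<rho>1 < \<rho>" "\<rho> < \<rho>2" "\<rho>2 < r2"
    using r by (auto simp: \<rho>1_def \<rho>_def \<rho>2_def)
  define q where "q = max (\<rho>1 / \<rho>) (\<rho> / \<rho>2)"
  have q: "0 \<le> q" "q < 1" using \<rho> by (auto simp: q_def le_max_iff_disj)
  obtain M1 where M1: "M1 \<ge> 0" "\<And>j. \<rho>1 powi j * norm (a j) \<le> M1"
    using laurent_terms_bounded[OF has_sum_imp_summable[OF a[of "of_real \<rho>1"]]] \<rho> by auto
  obtain M2 where M2: "M2 \<ge> 0" "\<And>j. \<rho>2 powi j * norm (a j) \<le> M2"
    using laurent_terms_bounded[OF has_sum_imp_summable[OF a[of "of_real \<rho>2"]]] \<rho> by auto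
  define b where "b j = (of_real \<rho> powi j :: complex) *\<^sub>C a j" for j
  have normb: "norm (b j) = \<rho> powi j * norm (a j)" for j
    using \<rho> by (simp add: b_def norm_scaleC norm_power_int)
  have b_bound: "norm (b j) \<le> (M1 + M2) * q ^ nat \<bar>j\<bar>" for j
  proof (cases "j \<ge> 0")
    case True
    have "norm (b j) = (\<rho>2 powi j * norm (a j)) * (\<rho> / \<rho>2) ^ nat \<bar>j\<bar>"
      using True \<rho> by (simp add: normb power_int_def power_divide)
    also have "\<dots> \<le> M2 * q ^ nat \<bar>j\<bar>"
      using M2 \<rho> by (intro mult_mono power_mono) (auto simp: q_def)
    also have "\<dots> \<le> (M1 + M2) * q ^ nat \<bar>j\<bar>" using M1(1) q by (intro mult_right_mono) auto
    finally show ?thesis .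
  next
    case False
    have "norm (b j) = (\<rho>1 powi j * norm (a j)) * (\<rho>1 / \<rho>) ^ nat \<bar>j\<bar>"
      using False \<rho> by (simp add: normb power_int_def power_divide field_simps)
    also have "\<dots> \<le> M1 * q ^ nat \<bar>j\<bar>"
      using M1 \<rho> by (intro mult_mono power_mono) (auto simp: q_def)
    also have "\<dots> \<le> (M1 + M2) * q ^ nat \<bar>j\<bar>" using M2(1) q by (intro mult_right_mono) auto
    finally show ?thesis .
  qed
  have abs_b: "b abs_summable_on UNIV"
    using summable_on_geometric_int[OF q] b_bound by (rule abs_summable_on_comparison_mult)
  have "norm (b m) \<le> \<epsilon>" if "\<epsilon> > 0" for \<epsilon>
  proof -
    obtain F where F: "finite F" "dist (\<Sum>j\<in>F. norm (b j)) (\<Sum>\<^sub>\<infinity>j. norm (b j)) \<le> \<epsilon>"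
      using infsum_finite_approximation[OF abs_b \<open>\<epsilon> > 0\<close>] by auto
    have tail: "(\<Sum>\<^sub>\<infinity>j\<in>- F. norm (b j)) \<le> \<epsilon>"
      using F infsum_Diff[OF abs_b, of F] by (simp add: Compl_eq_Diff_UNIV dist_real_def)
    \<comment> \<open>N exceeds |j - m| for every j in F, so no index of F other than m is congruent
      to m.\<close>
    define N where "N = Suc (\<Sum>j\<in>F. nat \<bar>j - m\<bar>)"
    have N: "N > 0" by (simp add: N_def)
    define \<omega> where "\<omega> = cis (2 * pi / N)"
    have \<omega>: "cmod \<omega> = 1" "\<omega> \<noteq> 0" by (auto simp: \<omega>_def)
    have "((\<lambda>j. ((\<omega> ^ k) powi (j - m)) *\<^sub>C b j) has_sum 0) UNIV" for k
    proof -
      have "((\<lambda>j. ((of_real \<rho> * \<omega> ^ k) powi j) *\<^sub>C a j) has_sum 0) UNIV"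
        using \<rho> \<omega> by (intro a) (auto simp: norm_mult norm_power)
      from has_sum_scaleC[OF this, of "(\<omega> ^ k) powi (- m)"]
      have "((\<lambda>j. ((\<omega> ^ k) powi (- m) * (of_real \<rho> * \<omega> ^ k) powi j) *\<^sub>C a j) has_sum 0) UNIV"
        by (simp add: scaleC_scaleC scaleC.zero_right)
      moreover have "(\<omega> ^ k) powi (- m) * (of_real \<rho> * \<omega> ^ k) powi j
          = (\<omega> ^ k) powi (j - m) * of_real \<rho> powi j" for j
        using \<omega>(2) by (simp add: power_int_mult_distrib power_int_diff power_int_minus divide_inverse)
      ultimately show ?thesis by (simp add: b_def scaleC_scaleC)
    qed
    then have "((\<lambda>j. \<Sum>k<N. ((\<omega> ^ k) powi (j - m)) *\<^sub>C b j) has_sum (\<Sum>k<N. 0)) UNIV"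
      by (intro has_sum_sum) auto
    moreover have "(\<Sum>k<N. ((\<omega> ^ k) powi (j - m)) *\<^sub>C b j)
        = (if int N dvd (j - m) then of_nat N else 0) *\<^sub>C b j" for j
      unfolding \<omega>_def sum_roots_of_unity_power_int[OF N, symmetric] by (simp add: scaleC.sum_left)
    ultimately have "((\<lambda>j. (if int N dvd (j - m) then of_nat N else 0) *\<^sub>C b j) has_sum 0) UNIV"
      by simp
    from has_sum_scaleC[OF this, of "1 / of_nat N"]
    have "((\<lambda>j. (1 / of_nat N) *\<^sub>C (if int N dvd (j - m) then of_nat N else 0) *\<^sub>C b j) has_sum 0) UNIV"
      by (simp only: scaleC.zero_right)
    moreover define c where "c = (\<lambda>j. if int N dvd (j - m) then b j else 0)"
    moreover have "(1 / of_nat N) *\<^sub>C (if int N dvd (j - m) then of_nat N else 0) *\<^sub>C b j = c j" for j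
      using N by (simp add: scaleC_scaleC scaleC_one scaleC.zero_left c_def)
    ultimately have sum0: "(c has_sum 0) UNIV" by (simp only:)
    have cF: "c j = 0" if "j \<in> F" "j \<noteq> m" for j
    proof -
      have "nat \<bar>j - m\<bar> < N"
        unfolding N_def using that F(1) by (intro le_imp_less_Suc member_le_sum) auto
      then have "\<not> int N dvd (j - m)" using that dvd_imp_le_int[of "j - m" "int N"] by auto
      then show ?thesis by (simp add: c_def)
    qed
    have "sum c (insert m F) = c m"
      using F(1) cF by (intro sum.remove[THEN trans, of _ m]) (auto intro!: sum.neutral)
    then have "(c has_sum b m) (insert m F)"
      using F(1) by (intro has_sum_finiteI) (auto simp: c_def)
    with sum0 have "(c has_sum (0 - b m)) (UNIV - insert m F)"
      by (rule has_sum_Diff) auto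
    then have bm: "infsum c (UNIV - insert m F) = - b m" by (simp add: infsumI)
    have abs_b': "b abs_summable_on A" for A
      using summable_on_subset_banach[OF abs_b] by blast
    have abs_c: "c abs_summable_on A" for A
      by (rule Infinite_Sum.abs_summable_on_comparison_test[OF abs_b']) (auto simp: c_def)
    have "norm (b m) \<le> (\<Sum>\<^sub>\<infinity>j\<in>UNIV - insert m F. norm (c j))"
      using norm_infsum_bound[OF abs_c, of "UNIV - insert m F"] bm by simp
    also have "\<dots> \<le> (\<Sum>\<^sub>\<infinity>j\<in>- F. norm (b j))"
      using abs_c abs_b' by (intro infsum_mono_neutral) (auto simp: c_def)
    finally show ?thesis using tail by simp
  qed
  then have "norm (b m) \<le> 0" by (rule field_le_epsilon) simp
  then have "norm (b m) = 0" by simp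
  then show ?thesis using \<rho> by (simp add: normb)
qed

section \<open>The resolvent equations for the Laurent coefficients\<close>

text \<open>One format for both kinds of spectral points. At a finite \<zeta>, \<open>B\<close> is
  A_0 + \<zeta> A_1, w is z - \<zeta> and r1 is 0; at infinity \<open>B\<close> is A_0 and the
  annulus lies outside all finite spectral points.\<close>

locale laurent_pencil =
  fixes B A1 :: "'x::complex_banach \<Rightarrow>\<^sub>L 'y::complex_banach" and R :: "int \<Rightarrow> 'y \<Rightarrow>\<^sub>L 'x"
  assumes clinear: "clinear_op B" "clinear_op A1" "clinear_op (R j)"
    and annulus: "\<exists>r1 r2. 0 \<le> r1 \<and> r1 < r2 \<and> (\<forall>w. r1 < cmod w \<and> cmod w < r2 \<longrightarrow>
      (\<exists>S. bounded_inverse (B + w *\<^sub>C A1) S \<and> ((\<lambda>j. (w powi j) *\<^sub>C R j) has_sum S) UNIV))"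
begin

lemma annulusE:
  obtains r1 r2 where "0 \<le> r1" "r1 < r2"
    "\<And>w. r1 < cmod w \<Longrightarrow> cmod w < r2 \<Longrightarrow>
      \<exists>S. S o\<^sub>L (B + w *\<^sub>C A1) = id_blinfun \<and> (B + w *\<^sub>C A1) o\<^sub>L S = id_blinfun \<and>
        ((\<lambda>j. (w powi j) *\<^sub>C R j) has_sum S) UNIV"
  using annulus that unfolding bounded_inverse_def by (elim exE conjE) blast

lemma left_resolvent: "(R j o\<^sub>L B) + (R (j - 1) o\<^sub>L A1) = (if j = 0 then id_blinfun else 0)"
proof -
  obtain r1 r2 where r: "0 \<le> r1" "r1 < r2" and
    ann: "\<And>w. r1 < cmod w \<Longrightarrow> cmod w < r2 \<Longrightarrow>
      \<exists>S. S o\<^sub>L (B + w *\<^sub>C A1) = id_blinfun \<and> (B + w *\<^sub>C A1) o\<^sub>L S = id_blinfun \<and>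
        ((\<lambda>j. (w powi j) *\<^sub>C R j) has_sum S) UNIV"
    by (rule annulusE) blast
  have "(R j o\<^sub>L B) + (R (j - 1) o\<^sub>L A1) - (if j = 0 then id_blinfun else 0) = 0"
  proof (rule laurent_coefficients_unique[OF r, where m = j and
        a = "\<lambda>j. (R j o\<^sub>L B) + (R (j - 1) o\<^sub>L A1) - (if j = 0 then id_blinfun else 0)"])
    fix w :: complex
    assume w: "r1 < cmod w" "cmod w < r2"
    then have nz: "w \<noteq> 0" using r by auto
    obtain S where S: "S o\<^sub>L (B + w *\<^sub>C A1) = id_blinfun"
      and sum: "((\<lambda>j. (w powi j) *\<^sub>C R j) has_sum S) UNIV"
      using ann[OF w] by blast
    have "((\<lambda>j. (w powi j) *\<^sub>C (R j o\<^sub>L B)) has_sum (S o\<^sub>L B)) UNIV"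
      using has_sum_compose_right[OF sum, of B] by (simp add: compose_scaleC_left)
    moreover have "((\<lambda>j. (w powi j) *\<^sub>C (R (j - 1) o\<^sub>L A1)) has_sum (w *\<^sub>C (S o\<^sub>L A1))) UNIV"
    proof -
      have "bij (\<lambda>j::int. j - 1)" by (rule bij_betwI[of _ _ _ "\<lambda>j. j + 1"]) auto
      then have "((\<lambda>j. (w powi (j - 1)) *\<^sub>C R (j - 1)) has_sum S) UNIV"
        using sum has_sum_reindex_bij_betw[of "\<lambda>j::int. j - 1" UNIV UNIV "\<lambda>j. (w powi j) *\<^sub>C R j"]
        by blast
      from has_sum_scaleC[OF has_sum_compose_right[OF this, of A1], of w] show ?thesis
        using nz by (simp add: compose_scaleC_left scaleC_scaleC power_int_diff)
    qed
    moreover have "((\<lambda>j. (w powi j) *\<^sub>C (if j = 0 then id_blinfun else 0)) has_sum id_blinfun) UNIV"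
      by (rule has_sum_finite_neutralI[of "{0}"]) (auto simp: scaleC_one scaleC.zero_right)
    ultimately have "((\<lambda>j. (w powi j) *\<^sub>C (R j o\<^sub>L B) + (w powi j) *\<^sub>C (R (j - 1) o\<^sub>L A1)
        - ((w powi j) *\<^sub>C (if j = 0 then id_blinfun else 0)))
        has_sum ((S o\<^sub>L B) + w *\<^sub>C (S o\<^sub>L A1) - id_blinfun)) UNIV"
      by (intro has_sum_add has_sum_diff)
    moreover have "(S o\<^sub>L B) + w *\<^sub>C (S o\<^sub>L A1) - id_blinfun = 0"
    proof -
      \<comment> \<open>Pulling w out of the composition of S with w A_1 needs complex linearity of
        S, which it inherits from the coefficients through the series.\<close>
      have "clinear_op S"
        unfolding clinear_op_def
      proof (intro allI)
        fix c x
        have "((\<lambda>j. (w powi j) *\<^sub>C R j (c *\<^sub>C x)) has_sum S (c *\<^sub>C x)) UNIV"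
          using has_sum_apply[OF sum] by (simp add: blinfun_apply_scaleC_aux)
        moreover have "((\<lambda>j. (w powi j) *\<^sub>C R j (c *\<^sub>C x)) has_sum c *\<^sub>C S x) UNIV"
          using has_sum_scaleC[OF has_sum_apply[OF sum, of x], of c] clinear
          by (simp add: blinfun_apply_scaleC_aux clinear_op_apply scaleC_scaleC mult.commute)
        ultimately show "S (c *\<^sub>C x) = c *\<^sub>C S x" by (rule has_sum_unique)
      qed
      then have "S o\<^sub>L (B + w *\<^sub>C A1) = (S o\<^sub>L B) + w *\<^sub>C (S o\<^sub>L A1)"
        by (intro blinfun_eqI)
          (simp add: blinfun.add_left blinfun.add_right blinfun_apply_scaleC_aux clinear_op_apply)
      with S show ?thesis by simp
    qed
    ultimately show "((\<lambda>j. (w powi j) *\<^sub>C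
        ((R j o\<^sub>L B) + (R (j - 1) o\<^sub>L A1) - (if j = 0 then id_blinfun else 0))) has_sum 0) UNIV"
      by (simp add: scaleC.diff_right scaleC.add_right)
  qed
  then show ?thesis by simp
qed

lemma right_resolvent: "(B o\<^sub>L R j) + (A1 o\<^sub>L R (j - 1)) = (if j = 0 then id_blinfun else 0)"
proof -
  obtain r1 r2 where r: "0 \<le> r1" "r1 < r2" and
    ann: "\<And>w. r1 < cmod w \<Longrightarrow> cmod w < r2 \<Longrightarrow>
      \<exists>S. S o\<^sub>L (B + w *\<^sub>C A1) = id_blinfun \<and> (B + w *\<^sub>C A1) o\<^sub>L S = id_blinfun \<and>
        ((\<lambda>j. (w powi j) *\<^sub>C R j) has_sum S) UNIV"
    by (rule annulusE) blast
  have "(B o\<^sub>L R j) + (A1 o\<^sub>L R (j - 1)) - (if j = 0 then id_blinfun else 0) = 0"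
  proof (rule laurent_coefficients_unique[OF r, where m = j and
        a = "\<lambda>j. (B o\<^sub>L R j) + (A1 o\<^sub>L R (j - 1)) - (if j = 0 then id_blinfun else 0)"])
    fix w :: complex
    assume w: "r1 < cmod w" "cmod w < r2"
    then have nz: "w \<noteq> 0" using r by auto
    obtain S where S: "(B + w *\<^sub>C A1) o\<^sub>L S = id_blinfun"
      and sum: "((\<lambda>j. (w powi j) *\<^sub>C R j) has_sum S) UNIV"
      using ann[OF w] by blast
    have "((\<lambda>j. (w powi j) *\<^sub>C (B o\<^sub>L R j)) has_sum (B o\<^sub>L S)) UNIV"
      using has_sum_compose_left[OF sum, of B] by (simp add: compose_scaleC_right clinear)
    moreover have "((\<lambda>j. (w powi j) *\<^sub>C (A1 o\<^sub>L R (j - 1))) has_sum (w *\<^sub>C (A1 o\<^sub>L S))) UNIV"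
    proof -
      have "bij (\<lambda>j::int. j - 1)" by (rule bij_betwI[of _ _ _ "\<lambda>j. j + 1"]) auto
      then have "((\<lambda>j. (w powi (j - 1)) *\<^sub>C R (j - 1)) has_sum S) UNIV"
        using sum has_sum_reindex_bij_betw[of "\<lambda>j::int. j - 1" UNIV UNIV "\<lambda>j. (w powi j) *\<^sub>C R j"]
        by blast
      from has_sum_scaleC[OF has_sum_compose_left[OF this, of A1], of w] show ?thesis
        using nz by (simp add: compose_scaleC_right clinear scaleC_scaleC power_int_diff)
    qed
    moreover have "((\<lambda>j. (w powi j) *\<^sub>C (if j = 0 then id_blinfun else 0)) has_sum id_blinfun) UNIV"
      by (rule has_sum_finite_neutralI[of "{0}"]) (auto simp: scaleC_one scaleC.zero_right)
    ultimately have "((\<lambda>j. (w powi j) *\<^sub>C (B o\<^sub>L R j) + (w powi j) *\<^sub>C (A1 o\<^sub>L R (j - 1))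
        - ((w powi j) *\<^sub>C (if j = 0 then id_blinfun else 0)))
        has_sum ((B o\<^sub>L S) + w *\<^sub>C (A1 o\<^sub>L S) - id_blinfun)) UNIV"
      by (intro has_sum_add has_sum_diff)
    moreover have "(B o\<^sub>L S) + w *\<^sub>C (A1 o\<^sub>L S) - id_blinfun = 0"
      using S by (simp add: bounded_bilinear.add_left[OF bounded_bilinear_blinfun_compose] compose_scaleC_left)
    ultimately show "((\<lambda>j. (w powi j) *\<^sub>C
        ((B o\<^sub>L R j) + (A1 o\<^sub>L R (j - 1)) - (if j = 0 then id_blinfun else 0))) has_sum 0) UNIV"
      by (simp add: scaleC.diff_right scaleC.add_right)
  qed
  then show ?thesis by simp
qed

lemma left_resolvent_apply: "R j (B x) + R (j - 1) (A1 x) = (if j = 0 then x else 0)"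
  using arg_cong[OF left_resolvent[of j], of "\<lambda>T. blinfun_apply T x"]
  by (simp add: blinfun.add_left split: if_splits)

lemma right_resolvent_apply: "B (R j y) + A1 (R (j - 1) y) = (if j = 0 then y else 0)"
  using arg_cong[OF right_resolvent[of j], of "\<lambda>T. blinfun_apply T y"]
  by (simp add: blinfun.add_left split: if_splits)

text \<open>
  The two resolvent equations determine \<open>R j A1 R k\<close> along each diagonal \<open>j + k = s\<close> up to a
  constant, and the constant is zero because the Cauchy bounds for two different radii make the
  product decay geometrically along the diagonal.
\<close>

lemma product_A1: "R j (A1 (R k y)) = ((if k < 0 then 1 else 0) - (if 0 \<le> j then 1 else 0)) *\<^sub>R R (j + k + 1) y"
proof -
  define s where "s = j + k"
  define f where "f i = R i (A1 (R (s - i) y))" for i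
  \<comment> \<open>The error of the claimed formula along the diagonal of index sum s. The two
    indicators jump exactly at i = 0 and i = s + 1, where the right sides of the resolvent equations
    are nonzero.\<close>
  define g where "g i = f i - ((if s - i < 0 then 1 else 0) - (if 0 \<le> i then 1 else 0)) *\<^sub>R R (s + 1) y" for i
  have diff_eq: "a + b = c \<Longrightarrow> a + b' = d \<Longrightarrow> b - b' = c - d" for a b b' c d :: 'x
    by (metis add_diff_cancel_left)
  have step: "g i = g (i - 1)" for i
  proof -
    have "R i (B (R (s - i + 1) y)) + f i = (if s - i + 1 = 0 then R i y else 0)"
      unfolding f_def using arg_cong[OF right_resolvent_apply[of "s - i + 1" y], of "R i"]
      by (simp add: blinfun.add_right split: if_splits)
    moreover have "s - (i - 1) = s - i + 1" by simp
    then have "R i (B (R (s - i + 1) y)) + f (i - 1) = (if i = 0 then R (s - i + 1) y else 0)"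
      unfolding f_def using left_resolvent_apply[of i "R (s - i + 1) y"] by (simp only:)
    ultimately have "f i - f (i - 1)
        = (if s - i + 1 = 0 then R i y else 0) - (if i = 0 then R (s - i + 1) y else 0)"
      by (rule diff_eq)
    then show ?thesis
      unfolding g_def by (cases "s - i + 1 = 0"; cases "i = 0") (auto simp: algebra_simps)
  qed
  have g_const: "g i = g j" for i
  proof -
    have up: "g (j + int n) = g j" for n
      by (induction n) (simp, metis step add_diff_cancel add.assoc of_nat_Suc add.commute)
    have down: "g (j - int n) = g j" for n
      by (induction n) (simp, metis step diff_diff_eq of_nat_Suc add.commute)
    show ?thesis
      using up[of "nat (i - j)"] down[of "nat (j - i)"] by (cases "i \<ge> j") auto
  qed
  obtain r1 r2 where r: "0 \<le> r1" "r1 < r2" and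
    ann: "\<And>w. r1 < cmod w \<Longrightarrow> cmod w < r2 \<Longrightarrow>
      \<exists>S. S o\<^sub>L (B + w *\<^sub>C A1) = id_blinfun \<and> (B + w *\<^sub>C A1) o\<^sub>L S = id_blinfun \<and>
        ((\<lambda>j. (w powi j) *\<^sub>C R j) has_sum S) UNIV"
    by (rule annulusE) blast
  \<comment> \<open>Going up the diagonal, \<open>R n\<close> is at most a multiple of \<rho>2^(-n)
    and \<open>R (s - n)\<close> at most a multiple of \<rho>1^n, which yields the ratio \<rho>1 /
    \<rho>2 below 1.\<close>
  define \<rho>1 \<rho>2 where "\<rho>1 = (2 * r1 + r2) / 3" and "\<rho>2 = (r1 + 2 * r2) / 3"
  have \<rho>: "r1 < \<rho>1" "0 < \<rho>1" "\<rho>1 < \<rho>2" "\<rho>2 < r2" "0 < \<rho>2"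
    using r by (auto simp: \<rho>1_def \<rho>2_def)
  have "\<exists>M\<ge>0. \<forall>j. \<rho> powi j * norm (R j) \<le> M" if "r1 < \<rho>" "\<rho> < r2" "0 < \<rho>" for \<rho>
  proof -
    obtain S where "((\<lambda>j. (of_real \<rho> powi j) *\<^sub>C R j) has_sum S) UNIV"
      using ann[of "of_real \<rho>"] \<open>r1 < \<rho>\<close> \<open>\<rho> < r2\<close> \<open>0 < \<rho>\<close> by auto
    from laurent_terms_bounded[OF has_sum_imp_summable[OF this]] show ?thesis
      using \<open>0 < \<rho>\<close> by (metis abs_of_pos norm_of_real)
  qed
  then obtain M1 M2 where M1: "M1 \<ge> 0" "\<And>j. \<rho>1 powi j * norm (R j) \<le> M1"
    and M2: "M2 \<ge> 0" "\<And>j. \<rho>2 powi j * norm (R j) \<le> M2"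
    using \<rho> by (metis less_trans)
  define K where "K = norm A1 * norm y * (M1 * M2) / \<rho>1 powi s"
  have K: "norm (f (int n)) \<le> K * (\<rho>1 / \<rho>2) ^ n" for n
  proof -
    have "norm (f (int n)) \<le> norm (R (int n)) * (norm A1 * (norm (R (s - int n)) * norm y))"
      unfolding f_def
      by (intro order_trans[OF norm_blinfun] mult_left_mono order_trans[OF norm_blinfun] norm_blinfun) auto
    also have "\<dots> = norm A1 * norm y * ((\<rho>2 powi int n * norm (R (int n)))
        * (\<rho>1 powi (s - int n) * norm (R (s - int n)))) / (\<rho>2 powi int n * \<rho>1 powi (s - int n))"
      using \<rho> by (simp add: field_simps)
    also have "\<dots> \<le> norm A1 * norm y * (M2 * M1) / (\<rho>2 powi int n * \<rho>1 powi (s - int n))"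
      using M1 M2(1) M2(2)[of "int n"] \<rho> by (intro divide_right_mono mult_left_mono mult_mono) auto
    also have "\<dots> = K * (\<rho>1 / \<rho>2) ^ n"
      using \<rho> by (simp add: K_def power_int_diff power_divide field_simps)
    finally show ?thesis .
  qed
  have "(\<lambda>n. norm (f (int n))) \<longlonglongrightarrow> 0"
  proof (rule tendsto_sandwich[OF _ _ tendsto_const])
    show "(\<lambda>n. K * (\<rho>1 / \<rho>2) ^ n) \<longlonglongrightarrow> 0"
      using \<rho> by (intro tendsto_mult_right_zero LIMSEQ_power_zero) auto
  qed (use K in auto)
  moreover have "\<forall>\<^sub>F n in sequentially. norm (f (int n)) = norm (g j)"
  proof (rule eventually_sequentiallyI)
    \<comment> \<open>For n beyond s both indicators are 1 and cancel, so the error is the product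
      itself.\<close>
    fix n assume "n \<ge> nat (s + 1)"
    then have "s < int n" by linarith
    then have "g (int n) = f (int n)" by (simp add: g_def)
    then show "norm (f (int n)) = norm (g j)" using g_const by metis
  qed
  ultimately have "(\<lambda>n::nat. norm (g j)) \<longlonglongrightarrow> 0"
    using tendsto_cong by fastforce
  then have "g j = 0" by (simp add: LIMSEQ_const_iff)
  then show ?thesis by (simp add: g_def f_def s_def)
qed

text \<open>The left resolvent equation trades \<open>R j B\<close> for
  \<open>- R (j - 1) A1\<close>, up to the identity at j = 0.\<close>

lemma product_B: "R j (B (R k y)) = ((if 0 \<le> j then 1 else 0) - (if k < 0 then 1 else 0)) *\<^sub>R R (j + k) y"
  using left_resolvent_apply[of j "R k y"] product_A1[of "j - 1" k y]
  by (cases "j = 0") (auto simp: eq_neg_iff_add_eq_0 split: if_splits)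

end

section \<open>First-order recursions on a closed subspace\<close>

definition flow_sum :: "('x::complex_banach \<Rightarrow>\<^sub>L 'x) \<Rightarrow> (int \<Rightarrow> 'x) \<Rightarrow> int \<Rightarrow> 'x" where
  "flow_sum F f t = (\<Sum>\<^sub>\<infinity>l::nat. (blinfun_apply F ^^ l) (f (t - int l)))"

context
  fixes F :: "'x::real_normed_vector \<Rightarrow>\<^sub>L 'x"
begin

lemma blinfun_pow_add: "(blinfun_apply F ^^ n) (x + y) = (blinfun_apply F ^^ n) x + (blinfun_apply F ^^ n) y"
  by (induction n) (auto simp: blinfun.add_right)

lemma blinfun_pow_diff: "(blinfun_apply F ^^ n) (x - y) = (blinfun_apply F ^^ n) x - (blinfun_apply F ^^ n) y"
  by (induction n) (auto simp: blinfun.diff_right)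

lemma blinfun_pow_zero [simp]: "(blinfun_apply F ^^ n) 0 = 0"
  by (induction n) auto

lemma blinfun_pow_uminus: "(blinfun_apply (- F) ^^ n) x = (- 1) ^ n *\<^sub>R (blinfun_apply F ^^ n) x"
  by (induction n) (auto simp: blinfun.minus_left blinfun.scaleR_right)

end

lemma op_pow_apply: "blinfun_apply (op_pow T n) = (blinfun_apply T ^^ n)"
  by (induction n) (auto simp: fun_eq_iff)

lemma has_sum_Suc:
  fixes g :: "nat \<Rightarrow> 'a::topological_ab_group_add"
  assumes "((\<lambda>n. g (Suc n)) has_sum S) UNIV"
  shows "(g has_sum (g 0 + S)) UNIV"
proof -
  have "(g has_sum S) (range Suc)"
    using assms by (subst has_sum_reindex) (auto simp: o_def)
  then have "(g has_sum (g 0 + S)) (insert 0 (range Suc))"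
    by (subst has_sum_insert) auto
  then show ?thesis by (simp add: UNIV_nat_eq[symmetric])
qed

lemma flow_sum_rec:
  assumes "(\<lambda>l. (blinfun_apply F ^^ l) (f (t - 1 - int l))) summable_on UNIV"
  shows "flow_sum F f t = f t + F (flow_sum F f (t - 1))"
proof -
  have "((\<lambda>l. (blinfun_apply F ^^ l) (f (t - 1 - int l))) has_sum flow_sum F f (t - 1)) UNIV"
    unfolding flow_sum_def using assms by (rule has_sum_infsum)
  from has_sum_blinfun_apply[OF this, of F]
  have "((\<lambda>l. (blinfun_apply F ^^ Suc l) (f (t - int (Suc l)))) has_sum F (flow_sum F f (t - 1))) UNIV"
    by (simp add: diff_diff_eq)
  from has_sum_Suc[where g = "\<lambda>l. (blinfun_apply F ^^ l) (f (t - int l))", OF this]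
  show ?thesis by (simp add: flow_sum_def infsumI)
qed

lemma flow_sum_bound:
  assumes r: "0 \<le> r" "r < 1"
    and le: "\<And>l. norm ((blinfun_apply F ^^ l) (f (t - int l))) \<le> K * r ^ l"
  shows "(\<lambda>l. (blinfun_apply F ^^ l) (f (t - int l))) summable_on UNIV"
    and "norm (flow_sum F f t) \<le> K / (1 - r)"
proof -
  have abs: "(\<lambda>l. (blinfun_apply F ^^ l) (f (t - int l))) abs_summable_on UNIV"
    using summable_on_geometric_nat[OF r] le by (rule abs_summable_on_comparison_mult)
  then show "(\<lambda>l. (blinfun_apply F ^^ l) (f (t - int l))) summable_on UNIV"
    by (rule abs_summable_summable)
  have geo: "((\<lambda>l. K * r ^ l) has_sum (K * (1 / (1 - r)))) UNIV"
    using r by (intro has_sum_cmult_right sums_nonneg_imp_has_sum geometric_sums) auto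
  have "norm (flow_sum F f t) \<le> (\<Sum>\<^sub>\<infinity>l. norm ((blinfun_apply F ^^ l) (f (t - int l))))"
    unfolding flow_sum_def by (rule norm_infsum_bound[OF abs])
  also have "\<dots> \<le> K * (1 / (1 - r))"
    by (rule has_sum_mono[OF has_sum_infsum[OF abs] geo]) (rule le)
  finally show "norm (flow_sum F f t) \<le> K / (1 - r)" by simp
qed

lemma has_sum_in_closed_subspace:
  assumes "(f has_sum S) A" "closed U" "subspace U" "\<And>x. x \<in> A \<Longrightarrow> f x \<in> U"
  shows "S \<in> U"
proof (rule Lim_in_closed_set[OF \<open>closed U\<close>])
  show "(sum f \<longlongrightarrow> S) (finite_subsets_at_top A)" using assms(1) by (simp add: has_sum_def)
  show "\<forall>\<^sub>F F in finite_subsets_at_top A. sum f F \<in> U"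
    using assms(3,4) by (intro eventually_finite_subsets_at_top_weakI subspace_sum) auto
qed auto

lemma infsum_in_closed_subspace:
  assumes "closed U" "subspace U" "\<And>x. x \<in> A \<Longrightarrow> f x \<in> U"
  shows "infsum f A \<in> U"
proof (cases "f summable_on A")
  case True
  then show ?thesis using has_sum_in_closed_subspace assms has_sum_infsum by blast
next
  case False
  then show ?thesis using assms by (simp add: infsum_not_exists subspace_0)
qed

lemma free_flow_pow:
  assumes "\<And>t. y t = blinfun_apply F (y (t - 1))"
  shows "(blinfun_apply F ^^ n) (y (t - int n)) = y t"
proof (induction n arbitrary: t)
  case (Suc n)
  have "(blinfun_apply F ^^ Suc n) (y (t - int (Suc n))) = F ((blinfun_apply F ^^ n) (y ((t - 1) - int n)))"
    by (simp add: algebra_simps)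
  then show ?case using Suc assms by metis
qed simp

locale flow_space =
  fixes F :: "'x::complex_banach \<Rightarrow>\<^sub>L 'x" and U :: "'x set" and f :: "int \<Rightarrow> 'x"
  assumes closed: "closed U" and subspace: "subspace U"
    and F_mem: "x \<in> U \<Longrightarrow> F x \<in> U" and f_mem: "f t \<in> U"
    and f_subexponential: "subexponential f"
begin

lemma pow_mem: "x \<in> U \<Longrightarrow> (blinfun_apply F ^^ n) x \<in> U"
  by (induction n) (auto simp: F_mem)

lemma flow_sum_mem: "flow_sum F f t \<in> U"
  unfolding flow_sum_def
  by (intro infsum_in_closed_subspace closed subspace pow_mem f_mem)

end

section \<open>Contracting recursions and boundary values in the far past\<close>

locale contracting_flow = flow_space +
  fixes q C :: real
  assumes q: "0 \<le> q" "q < 1" and C: "C \<ge> 0"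
    and pow_bound: "x \<in> U \<Longrightarrow> norm ((blinfun_apply F ^^ n) x) \<le> C * q ^ n * norm x"
begin

text \<open>Because |t - l| <= |t| + l, looking l steps back costs at most the factor s^l, which
  turns the rate q into q s.\<close>

lemma pow_term_bound:
  assumes z: "\<And>t. z t \<in> U" "\<And>t. norm (z t) \<le> M * s ^ nat \<bar>t\<bar>" and s: "s \<ge> 1" and M: "M \<ge> 0"
  shows "norm ((blinfun_apply F ^^ l) (z (t - int l))) \<le> (C * M * s ^ nat \<bar>t\<bar>) * (q * s) ^ l"
proof -
  have "s ^ nat \<bar>t - int l\<bar> \<le> s ^ (nat \<bar>t\<bar> + l)"
    using s by (intro power_increasing) auto
  then have "norm (z (t - int l)) \<le> M * s ^ (nat \<bar>t\<bar> + l)"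
    using z(2)[of "t - int l"] M by (meson mult_left_mono order_trans)
  then have "C * q ^ l * norm (z (t - int l)) \<le> C * q ^ l * (M * s ^ (nat \<bar>t\<bar> + l))"
    using C q by (intro mult_left_mono) auto
  with pow_bound[OF z(1), of l "t - int l"] show ?thesis
    by (simp add: power_mult_distrib power_add mult_ac)
qed

text \<open>A growth rate above 1 that the contraction still beats: 2 q < 1 + q < 2 gives q s0 < 1 <
  s0.\<close>

definition s0 :: real where "s0 = 2 / (1 + q)"

lemma s0: "s0 > 1" "q * s < 1" if "s \<le> s0" for s
proof -
  show "s0 > 1" using q by (simp add: s0_def field_simps)
  have "q * s \<le> q * s0" using that q by (intro mult_left_mono) auto
  also have "\<dots> < 1" using q by (simp add: s0_def field_simps)
  finally show "q * s < 1" .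
qed

lemma flow_sum_summable: "(\<lambda>l. (blinfun_apply F ^^ l) (f (t - int l))) summable_on UNIV"
proof -
  obtain M where M: "M \<ge> 0" "\<And>t. norm (f t) \<le> M * s0 ^ nat \<bar>t\<bar>"
    using f_subexponential s0(1)[OF order_refl] by (rule subexponential_bound) blast
  show ?thesis
    using s0[OF order_refl] M q
    by (intro flow_sum_bound(1)[where r = "q * s0" and K = "C * M * s0 ^ nat \<bar>t\<bar>"]
        pow_term_bound f_mem) auto
qed

lemma flow_sum_step: "flow_sum F f t = f t + F (flow_sum F f (t - 1))"
  by (rule flow_sum_rec[OF flow_sum_summable])

lemma flow_sum_subexponential: "subexponential (flow_sum F f)"
  unfolding subexponential_iff
proof (intro allI impI)
  fix s' :: real
  assume "s' > 1"
  \<comment> \<open>Large rates are capped at \<open>s0\<close> to keep q s < 1; the estimate at the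
    smaller rate implies the one at s'.\<close>
  define s where "s = min s' s0"
  have s: "s > 1" "s \<le> s0" "s \<le> s'" using \<open>s' > 1\<close> s0 by (auto simp: s_def)
  obtain M where M: "M \<ge> 0" "\<And>t. norm (f t) \<le> M * s ^ nat \<bar>t\<bar>"
    using f_subexponential s(1) by (rule subexponential_bound) blast
  have "norm (flow_sum F f t) \<le> C * M * s ^ nat \<bar>t\<bar> / (1 - q * s)" for t
    using s s0(2)[OF s(2)] M q
    by (intro flow_sum_bound(2) pow_term_bound f_mem) auto
  also have "C * M * s ^ nat \<bar>t\<bar> / (1 - q * s) \<le> C * M / (1 - q * s) * s' ^ nat \<bar>t\<bar>" for t
    using s s0(2)[OF s(2)] M C
    by (simp add: divide_right_mono mult_left_mono power_mono)
  finally show "\<exists>M. \<forall>t. norm (flow_sum F f t) \<le> M * s' ^ nat \<bar>t\<bar>" by blast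
qed

lemma pow_past_tendsto_zero:
  assumes z: "\<And>t. z t \<in> U" "subexponential z"
  shows "(\<lambda>r. (blinfun_apply F ^^ nat (int r + t0)) (z (- int r))) \<longlonglongrightarrow> 0"
proof -
  obtain M where M: "M \<ge> 0" "\<And>t. norm (z t) \<le> M * s0 ^ nat \<bar>t\<bar>"
    using z(2) s0(1)[OF order_refl] by (rule subexponential_bound) blast
  have "norm ((blinfun_apply F ^^ nat (int r + t0)) (z (- int r)))
      \<le> (C * M * s0 ^ nat \<bar>t0\<bar>) * (q * s0) ^ nat (int r + t0)" if "r \<ge> nat \<bar>t0\<bar>" for r
  proof -
    \<comment> \<open>With n = r + t0 the time -r equals t0 - n, so the bound applies at the fixed
      time t0. The early r, for which \<open>nat\<close> could truncate, are excluded.\<close>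
    have "t0 - int (nat (int r + t0)) = - int r" using that by linarith
    then show ?thesis
      using pow_term_bound[of z M s0 "nat (int r + t0)" t0] z(1) M s0[OF order_refl] by auto
  qed
  then have ev: "\<forall>\<^sub>F r in sequentially. norm ((blinfun_apply F ^^ nat (int r + t0)) (z (- int r)))
      \<le> (C * M * s0 ^ nat \<bar>t0\<bar>) * (q * s0) ^ nat (int r + t0)"
    by (rule eventually_sequentiallyI)
  have "filterlim (\<lambda>r::nat. nat (int r + t0)) sequentially sequentially"
    unfolding filterlim_at_top
  proof
    fix n
    show "\<forall>\<^sub>F r in sequentially. n \<le> nat (int r + t0)"
      by (rule eventually_sequentiallyI[of "n + nat \<bar>t0\<bar>"]) auto
  qed
  moreover have "(\<lambda>n. (C * M * s0 ^ nat \<bar>t0\<bar>) * (q * s0) ^ n) \<longlonglongrightarrow> 0"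
    using s0[OF order_refl] q by (intro tendsto_mult_right_zero LIMSEQ_power_zero) auto
  ultimately have "(\<lambda>r. (C * M * s0 ^ nat \<bar>t0\<bar>) * (q * s0) ^ nat (int r + t0)) \<longlonglongrightarrow> 0"
    by (rule filterlim_compose[rotated])
  with ev show ?thesis by (rule Lim_null_comparison)
qed

lemma free_flow_past:
  assumes "\<And>t. y t = blinfun_apply F (y (t - 1))"
  shows "(\<lambda>r. (blinfun_apply F ^^ nat (int r + t0)) (y (- int r))) \<longlonglongrightarrow> y t0"
proof (rule tendsto_eventually, rule eventually_sequentiallyI)
  fix r assume "r \<ge> nat \<bar>t0\<bar>"
  then have "- int r = t0 - int (nat (int r + t0))" by auto
  then show "(blinfun_apply F ^^ nat (int r + t0)) (y (- int r)) = y t0"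
    using free_flow_pow[of y F, OF assms] by metis
qed

text \<open>\<open>F\<close> need not be injective, so the free part stays an unknown two-sided flow
  \<open>y\<close> instead of being written with negative powers of \<open>F\<close>.\<close>

lemma flow_solution_iff:
  "(\<forall>t. x t \<in> U) \<and> (\<forall>t. x t = f t + F (x (t - 1))) \<and>
     (\<lambda>r. (blinfun_apply F ^^ nat (int r + t0)) (x (- int r))) \<longlonglongrightarrow> c \<longleftrightarrow>
   (\<exists>y. (\<forall>t. y t \<in> U) \<and> (\<forall>t. y t = F (y (t - 1))) \<and> y t0 = c \<and> (\<forall>t. x t = flow_sum F f t + y t))"
  (is "?L \<longleftrightarrow> (\<exists>y. ?R y)")
proof
  assume L: ?L
  define y where "y t = x t - flow_sum F f t" for t
  have U: "y t \<in> U" for t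
    unfolding y_def using L flow_sum_mem by (blast intro: subspace_diff[OF subspace])
  have y: "y t = (f t + F (x (t - 1))) - (f t + F (flow_sum F f (t - 1)))" for t
    unfolding y_def using L flow_sum_step[of t] by (intro arg_cong2[of _ _ _ _ minus]) blast+
  have rec: "y t = F (y (t - 1))" for t
    unfolding y[of t] by (simp add: y_def blinfun.diff_right)
  have "(\<lambda>r. (blinfun_apply F ^^ nat (int r + t0)) (x (- int r))
      - (blinfun_apply F ^^ nat (int r + t0)) (flow_sum F f (- int r))) \<longlonglongrightarrow> c - 0"
    using L by (intro tendsto_diff pow_past_tendsto_zero flow_sum_mem flow_sum_subexponential) blast
  then have "(\<lambda>r. (blinfun_apply F ^^ nat (int r + t0)) (y (- int r))) \<longlonglongrightarrow> c"
    by (simp add: y_def blinfun_pow_diff)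
  then have "y t0 = c"
    using free_flow_past[of y, OF rec] LIMSEQ_unique by blast
  show "\<exists>y. ?R y"
    by (intro exI[of _ y] conjI allI, rule U, rule rec, rule \<open>y t0 = c\<close>, simp add: y_def)
next
  assume "\<exists>y. ?R y"
  then obtain y where R: "?R y" by (rule exE)
  note y = R[THEN conjunct1, rule_format] R[THEN conjunct2, THEN conjunct1, rule_format]
      R[THEN conjunct2, THEN conjunct2, THEN conjunct1]
    and x = R[THEN conjunct2, THEN conjunct2, THEN conjunct2, rule_format]
  have "x t \<in> U" for t
    using subspace_add[OF subspace flow_sum_mem[of t] y(1)[of t]] by (simp only: x)
  moreover have "x t = f t + F (x (t - 1))" for t
  proof -
    have "flow_sum F f t + y t = (f t + F (flow_sum F f (t - 1))) + F (y (t - 1))"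
      using flow_sum_step[of t] y(2)[of t] by (rule arg_cong2)
    then show ?thesis by (simp only: x blinfun.add_right add.assoc)
  qed
  moreover have "(\<lambda>r. (blinfun_apply F ^^ nat (int r + t0)) (flow_sum F f (- int r))
      + (blinfun_apply F ^^ nat (int r + t0)) (y (- int r))) \<longlonglongrightarrow> 0 + c"
    unfolding y(3)[symmetric]
    by (intro tendsto_add pow_past_tendsto_zero flow_sum_mem flow_sum_subexponential
        free_flow_past y(2))
  then have "(\<lambda>r. (blinfun_apply F ^^ nat (int r + t0)) (x (- int r))) \<longlonglongrightarrow> c"
    by (simp add: x blinfun_pow_add)
  ultimately show ?L by blast
qed

text \<open>The free part is then subexponential as well, so its boundary value in the past is both
  0 and \<open>y t0\<close>.\<close>

lemma subexponential_free_flow_zero: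
  assumes y: "\<And>t. y t \<in> U" "\<And>t. y t = F (y (t - 1))"
    and "subexponential (\<lambda>t. flow_sum F f t + y t)"
  shows "y t0 = 0"
proof -
  have "subexponential y"
    using subexponential_diff[OF assms(3) flow_sum_subexponential] by simp
  with y(1) have "(\<lambda>r. (blinfun_apply F ^^ nat (int r + t0)) (y (- int r))) \<longlonglongrightarrow> 0"
    by (rule pow_past_tendsto_zero)
  then show ?thesis
    using free_flow_past[of y, OF y(2)] LIMSEQ_unique by blast
qed

end

section \<open>Recursions with subexponential powers and noise that starts after
  \<open>t0\<close>\<close>

locale truncated_flow = flow_space +
  fixes t0 :: int
  assumes f_zero: "t \<le> t0 \<Longrightarrow> f t = 0"
    and pow_bound: "s > 1 \<Longrightarrow> \<exists>C\<ge>0. \<forall>n. \<forall>x\<in>U. norm ((blinfun_apply F ^^ n) x) \<le> C * s ^ n * norm x"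
begin

lemma flow_sum_summable: "(\<lambda>l. (blinfun_apply F ^^ l) (f (t - int l))) summable_on UNIV"
proof (rule finite_nonzero_values_imp_summable_on, rule finite_subset)
  show "{l \<in> UNIV. (blinfun_apply F ^^ l) (f (t - int l)) \<noteq> 0} \<subseteq> {..nat (t - t0)}"
  proof
    fix l assume "l \<in> {l \<in> UNIV. (blinfun_apply F ^^ l) (f (t - int l)) \<noteq> 0}"
    then have "\<not> t - int l \<le> t0" using f_zero by force
    then show "l \<in> {..nat (t - t0)}" by auto
  qed
qed simp

lemma flow_sum_zero: "t \<le> t0 \<Longrightarrow> flow_sum F f t = 0"
  unfolding flow_sum_def by (rule infsum_0) (simp add: f_zero)

text \<open>The flow sum vanishes at t0, so both descriptions start from \<open>x t0\<close> and
  follow the same recursion.\<close>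

lemma initial_value_iff:
  "(\<forall>t>t0. x t = f t + F (x (t - 1))) \<longleftrightarrow>
   (\<forall>t>t0. x t = flow_sum F f t + (blinfun_apply F ^^ nat (t - t0)) (x t0))"
proof -
  define y where "y t = flow_sum F f t + (blinfun_apply F ^^ nat (t - t0)) (x t0)" for t
  have y0: "y t0 = x t0" by (simp add: y_def flow_sum_zero)
  have y_rec: "y t = f t + F (y (t - 1))" if "t > t0" for t
  proof -
    have "nat (t - t0) = Suc (nat (t - 1 - t0))" using that by auto
    then show ?thesis
      using flow_sum_rec[OF flow_sum_summable, of t] by (simp add: y_def blinfun.add_right)
  qed
  have "(\<forall>t>t0. x t = f t + F (x (t - 1))) \<longleftrightarrow> (\<forall>t>t0. x t = y t)"
  proof (intro iffI)
    assume x: "\<forall>t>t0. x t = f t + F (x (t - 1))"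
    have "x (t0 + int n) = y (t0 + int n)" for n
    proof (induction n)
      case (Suc n)
      then show ?case
        using x[rule_format, of "t0 + int (Suc n)"] y_rec[of "t0 + int (Suc n)"] by (simp add: algebra_simps)
    qed (simp add: y0)
    then have "x t = y t" if "t > t0" for t
      using that by (metis add.commute diff_add_cancel int_nat_eq le_iff_diff_le_0 less_imp_le diff_ge_0_iff_ge)
    then show "\<forall>t>t0. x t = y t" by blast
  next
    assume x: "\<forall>t>t0. x t = y t"
    have "x t = y t" if "t \<ge> t0" for t using x y0 that by (cases "t = t0") auto
    then show "\<forall>t>t0. x t = f t + F (x (t - 1))" using y_rec by auto
  qed
  then show ?thesis by (simp add: y_def)
qed

lemma initial_value_subexponential:
  assumes c: "c \<in> U"
  shows "subexponential (\<lambda>t. flow_sum F f t + (blinfun_apply F ^^ nat (t - t0)) c)"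
  unfolding subexponential_iff
proof (intro allI impI)
  fix s :: real
  assume s: "s > 1"
  \<comment> \<open>The powers grow at most at the rate s1 while the result is measured against s;
    this leaves the summable ratio s1 / s.\<close>
  define s1 where "s1 = (1 + s) / 2"
  have s1: "1 < s1" "s1 < s" using s by (auto simp: s1_def)
  obtain C where C: "C \<ge> 0" "\<And>n x. x \<in> U \<Longrightarrow> norm ((blinfun_apply F ^^ n) x) \<le> C * s1 ^ n * norm x"
    using pow_bound[OF s1(1)] by blast
  obtain M where M: "M \<ge> 0" "\<And>t. norm (f t) \<le> M * s ^ nat \<bar>t\<bar>"
    using f_subexponential s by (rule subexponential_bound) blast
  define K where "K t = C * M * s ^ (2 * nat \<bar>t0\<bar>) * s ^ nat \<bar>t\<bar>" for t :: int
  have "norm ((blinfun_apply F ^^ l) (f (t - int l))) \<le> K t * (s1 / s) ^ l" for t l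
  proof (cases "t - int l \<le> t0")
    case True
    then show ?thesis using C(1) M(1) s s1 by (simp add: f_zero K_def)
  next
    case False
    \<comment> \<open>Only l < t - t0 contributes, and for such l the exponents of noise and power
      together exceed |t| by at most a constant.\<close>
    then have le: "nat \<bar>t - int l\<bar> + l \<le> 2 * nat \<bar>t0\<bar> + nat \<bar>t\<bar>" by auto
    have "norm ((blinfun_apply F ^^ l) (f (t - int l))) \<le> C * s1 ^ l * (M * s ^ nat \<bar>t - int l\<bar>)"
      using C(1) s1 by (intro order_trans[OF C(2)[OF f_mem]] mult_left_mono M(2)) auto
    also have "\<dots> = C * M * (s1 / s) ^ l * s ^ (nat \<bar>t - int l\<bar> + l)"
      using s by (simp add: power_add power_divide)
    also have "\<dots> \<le> C * M * (s1 / s) ^ l * s ^ (2 * nat \<bar>t0\<bar> + nat \<bar>t\<bar>)"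
      using le s s1 C(1) M(1) by (intro mult_left_mono power_increasing) auto
    finally show ?thesis by (simp add: K_def power_add mult_ac)
  qed
  then have 1: "norm (flow_sum F f t) \<le> K t / (1 - s1 / s)" for t
    using s s1 by (intro flow_sum_bound(2)) auto
  have 2: "norm ((blinfun_apply F ^^ nat (t - t0)) c) \<le> C * norm c * s ^ nat \<bar>t0\<bar> * s ^ nat \<bar>t\<bar>" for t
  proof -
    have "s1 ^ nat (t - t0) \<le> s ^ nat (t - t0)" using s1 by (intro power_mono) auto
    also have "\<dots> \<le> s ^ (nat \<bar>t0\<bar> + nat \<bar>t\<bar>)" using s by (intro power_increasing) auto
    finally have "C * s1 ^ nat (t - t0) * norm c \<le> C * s ^ (nat \<bar>t0\<bar> + nat \<bar>t\<bar>) * norm c"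
      using C(1) by (intro mult_right_mono mult_left_mono) auto
    with C(2)[OF c, of "nat (t - t0)"] show ?thesis by (simp add: power_add mult_ac)
  qed
  have "norm (flow_sum F f t + (blinfun_apply F ^^ nat (t - t0)) c)
      \<le> (C * M * s ^ (2 * nat \<bar>t0\<bar>) / (1 - s1 / s) + C * norm c * s ^ nat \<bar>t0\<bar>) * s ^ nat \<bar>t\<bar>" for t
    using order_trans[OF norm_triangle_ineq add_mono[OF 1 2], of t t]
    by (simp add: K_def algebra_simps)
  then show "\<exists>M. \<forall>t. norm (flow_sum F f t + (blinfun_apply F ^^ nat (t - t0)) c) \<le> M * s ^ nat \<bar>t\<bar>"
    by blast
qed

end

section \<open>Finite spectral points\<close>

text \<open>A single term of the binomial expansion of (1 + \<eta>)^(k + l). The rate in l tends to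
  1 as \<eta> tends to 0, at the expense of the rate in k.\<close>

lemma binomial_le_geometric:
  fixes \<eta> :: real
  assumes "\<eta> > 0"
  shows "real ((k + l) choose l) \<le> ((1 + \<eta>) / \<eta>) ^ k * (1 + \<eta>) ^ l"
proof -
  have "real ((k + l) choose l) * 1 ^ l * \<eta> ^ (k + l - l)
      \<le> (\<Sum>i\<le>k + l. real ((k + l) choose i) * 1 ^ i * \<eta> ^ (k + l - i))"
    using assms by (intro member_le_sum) auto
  also have "\<dots> = (1 + \<eta>) ^ (k + l)" by (rule binomial_ring[symmetric])
  finally show ?thesis using assms by (simp add: field_simps power_add)
qed

text \<open>The rate \<open>E\<close> in k may be large and may depend on q. Only the rate in l is
  critical, since the coefficients to be summed over k decay faster than every geometric
  sequence.\<close>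

definition geometric_weight :: "(nat \<Rightarrow> nat \<Rightarrow> complex) \<Rightarrow> real \<Rightarrow> bool" where
  "geometric_weight v q0 \<longleftrightarrow> q0 \<ge> 0 \<and>
    (\<forall>q>q0. \<exists>D\<ge>0. \<exists>E>0. \<forall>k l. cmod (v k l) \<le> D * E ^ k * q ^ l)"

text \<open>
  The coefficients of \<open>R\<^sub>-\<^sub>1\<^sub>-\<^sub>k\<close> in the expansions of \<open>- H\<^sup>-\<^sup>1\<^sup>-\<^sup>l R\<^sub>-\<^sub>1\<close> and \<open>H\<^sup>m R\<^sub>-\<^sub>1\<close>. The truncated
  exponent \<open>m - k\<close> is harmless, since the binomial coefficient vanishes for \<open>k > m\<close>.
\<close>

definition forward_weight :: "complex \<Rightarrow> nat \<Rightarrow> nat \<Rightarrow> complex" where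
  "forward_weight \<zeta> k l = (- 1) ^ Suc k * (of_nat ((k + l) choose l) * \<zeta> powi (- int (Suc k) - int l))"

definition backward_weight :: "complex \<Rightarrow> nat \<Rightarrow> nat \<Rightarrow> complex" where
  "backward_weight \<zeta> k m = of_nat (m choose k) * \<zeta> ^ (m - k)"

lemma geometric_forward_weight:
  assumes "\<zeta> \<noteq> 0"
  shows "geometric_weight (forward_weight \<zeta>) (1 / cmod \<zeta>)"
  unfolding geometric_weight_def
proof (intro conjI allI impI)
  fix q :: real
  assume q: "q > 1 / cmod \<zeta>"
  \<comment> \<open>Chosen so that (1 + \<eta>) / |\<zeta>| is exactly the wanted rate q.\<close>
  define \<eta> where "\<eta> = q * cmod \<zeta> - 1"
  have \<eta>: "\<eta> > 0" "1 + \<eta> = q * cmod \<zeta>" using q assms by (auto simp: \<eta>_def field_simps)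
  have "cmod (forward_weight \<zeta> k l) \<le> 1 / cmod \<zeta> * (q / \<eta>) ^ k * q ^ l" for k l
  proof -
    have "- int (Suc k) - int l = - int (Suc k + l)" by simp
    then have "cmod (forward_weight \<zeta> k l) = real ((k + l) choose l) / cmod \<zeta> ^ (Suc k + l)"
      unfolding forward_weight_def
      by (simp only: norm_mult norm_power norm_of_nat norm_power_int power_int_minus power_int_of_nat)
         (simp add: field_simps norm_divide norm_mult norm_power)
    also have "\<dots> \<le> (((1 + \<eta>) / \<eta>) ^ k * (1 + \<eta>) ^ l) / cmod \<zeta> ^ (Suc k + l)"
      by (intro divide_right_mono binomial_le_geometric \<eta>) auto
    also have "\<dots> = 1 / cmod \<zeta> * (q / \<eta>) ^ k * q ^ l"
      unfolding \<eta>(2) using assms by (simp add: power_mult_distrib power_divide power_add)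
    finally show ?thesis .
  qed
  moreover have "q / \<eta> > 0" using \<eta>(1) q by (smt (verit) divide_nonneg_nonneg divide_pos_pos norm_ge_zero)
  ultimately show "\<exists>D\<ge>0. \<exists>E>0. \<forall>k l. cmod (forward_weight \<zeta> k l) \<le> D * E ^ k * q ^ l"
    by (intro exI[of _ "1 / cmod \<zeta>"] exI[of _ "q / \<eta>"] conjI allI) auto
qed simp

lemma geometric_backward_weight:
  assumes "\<zeta> \<noteq> 0"
  shows "geometric_weight (backward_weight \<zeta>) (cmod \<zeta>)"
  unfolding geometric_weight_def
proof (intro conjI allI impI)
  fix q :: real
  assume q: "q > cmod \<zeta>"
  \<comment> \<open>Here the power is \<zeta>^(m - k), so (1 + \<eta>) |\<zeta>| has to be q.
    Writing q^(m - k) as q^m / q^k puts another factor 1 / q into the rate in k.\<close>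
  define \<eta> where "\<eta> = q / cmod \<zeta> - 1"
  have \<eta>: "\<eta> > 0" "(1 + \<eta>) * cmod \<zeta> = q" and q0: "q > 0"
    using q assms by (auto simp: \<eta>_def field_simps intro: le_less_trans[OF norm_ge_zero])
  have "cmod (backward_weight \<zeta> k m) \<le> 1 * ((1 + \<eta>) / (\<eta> * q)) ^ k * q ^ m" for k m
  proof (cases "k \<le> m")
    case True
    then obtain r where m: "m = k + r" using le_Suc_ex by blast
    have "(k + r) choose k = (k + r) choose r" using binomial_symmetric[of r "k + r"] by simp
    then have "cmod (backward_weight \<zeta> k m) = real ((k + r) choose r) * cmod \<zeta> ^ r"
      by (simp add: backward_weight_def m norm_mult norm_power)
    also have "\<dots> \<le> (((1 + \<eta>) / \<eta>) ^ k * (1 + \<eta>) ^ r) * cmod \<zeta> ^ r"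
      by (intro mult_right_mono binomial_le_geometric \<eta>) auto
    also have "\<dots> = ((1 + \<eta>) / \<eta>) ^ k * q ^ r"
      by (simp only: \<eta>(2)[symmetric] power_mult_distrib mult_ac)
    also have "\<dots> = 1 * ((1 + \<eta>) / (\<eta> * q)) ^ k * q ^ m"
      using q0 \<eta>(1) by (simp add: m power_add field_simps)
    finally show ?thesis .
  next
    case False
    then show ?thesis using \<eta> q0 by (simp add: backward_weight_def binomial_eq_0)
  qed
  moreover have "(1 + \<eta>) / (\<eta> * q) > 0" using \<eta>(1) q0 by simp
  ultimately show "\<exists>D\<ge>0. \<exists>E>0. \<forall>k l. cmod (backward_weight \<zeta> k l) \<le> D * E ^ k * q ^ l"
    by (intro exI[of _ 1] exI[of _ "(1 + \<eta>) / (\<eta> * q)"] conjI allI) auto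
qed simp

text \<open>Pascal's rule. As \<open>H\<close> sends \<open>S k y\<close> to \<zeta> times itself
  plus \<open>S (Suc k) y\<close>, this is the coefficient form of the fact that \<open>H\<close>
  takes the series of index \<open>Suc l\<close> to the one of index l.\<close>

lemma forward_weight_Suc:
  assumes "\<zeta> \<noteq> 0"
  shows "\<zeta> * forward_weight \<zeta> k (Suc l) + (if k = 0 then 0 else forward_weight \<zeta> (k - 1) (Suc l))
    = forward_weight \<zeta> k l"
proof (cases k)
  case 0
  have "\<zeta> * \<zeta> powi (- int (Suc 0) - int (Suc l)) = \<zeta> powi (- int (Suc 0) - int l)"
    using assms power_int_add_1[of \<zeta> "- int (Suc 0) - int (Suc l)"] by (simp add: mult.commute)
  then show ?thesis by (simp add: 0 forward_weight_def)
next
  case (Suc k')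
  define p where "p = \<zeta> powi (- int (Suc (Suc k')) - int l)"
  have 1: "\<zeta> * \<zeta> powi (- int (Suc (Suc k')) - int (Suc l)) = p"
  proof -
    have "- int (Suc (Suc k')) - int l = (- int (Suc (Suc k')) - int (Suc l)) + 1" by simp
    then show ?thesis by (simp only: p_def power_int_add_1[OF disjI1[OF assms]] mult.commute[of \<zeta>])
  qed
  have 2: "- int (Suc k') - int (Suc l) = - int (Suc (Suc k')) - int l" by simp
  have "(Suc k' + Suc l) choose Suc l = ((k' + Suc l) choose Suc l) + ((Suc k' + l) choose l)"
    by simp
  then have 3: "of_nat ((Suc k' + Suc l) choose Suc l)
      = (of_nat ((k' + Suc l) choose Suc l) + of_nat ((Suc k' + l) choose l) :: complex)"
    by (metis of_nat_add)
  have "\<zeta> * forward_weight \<zeta> k (Suc l) + forward_weight \<zeta> k' (Suc l)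
      = (- 1) ^ Suc (Suc k') * (of_nat ((Suc k' + Suc l) choose Suc l) * (\<zeta> * \<zeta> powi (- int (Suc (Suc k')) - int (Suc l))))
        - (- 1) ^ Suc (Suc k') * (of_nat ((k' + Suc l) choose Suc l) * \<zeta> powi (- int (Suc k') - int (Suc l)))"
    unfolding forward_weight_def Suc by (simp only: power_Suc) (simp add: algebra_simps)
  also have "\<dots> = (- 1) ^ Suc (Suc k') * (of_nat ((Suc k' + l) choose l) * p)"
    unfolding 1 2 p_def[symmetric] 3 by (simp add: algebra_simps)
  finally show ?thesis by (simp add: Suc forward_weight_def p_def)
qed

text \<open>The start of the same recursion: \<open>H\<close> takes the series of index 0 to minus
  \<open>R (- 1)\<close>.\<close>

lemma forward_weight_0:
  assumes "\<zeta> \<noteq> 0"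
  shows "\<zeta> * forward_weight \<zeta> k 0 + (if k = 0 then 0 else forward_weight \<zeta> (k - 1) 0)
    = (if k = 0 then - 1 else 0)"
proof (cases k)
  case 0
  then show ?thesis using assms by (simp add: forward_weight_def power_int_minus)
next
  case (Suc k')
  have "\<zeta> * \<zeta> powi (- int (Suc (Suc k'))) = \<zeta> powi (- int (Suc k'))"
    using assms power_int_add_1[of \<zeta> "- int (Suc (Suc k'))"] by (simp add: mult.commute)
  then show ?thesis
    unfolding forward_weight_def Suc by (simp add: mult.left_commute[of \<zeta>])
qed

text \<open>Pascal's rule again; for these weights \<open>H\<close> raises the index.\<close>

lemma backward_weight_Suc:
  "\<zeta> * backward_weight \<zeta> k m + (if k = 0 then 0 else backward_weight \<zeta> (k - 1) m)
    = backward_weight \<zeta> k (Suc m)"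
proof (cases k)
  case 0
  then show ?thesis by (simp add: backward_weight_def)
next
  case (Suc k')
  show ?thesis
  proof (cases "k' < m")
    case True
    then have "\<zeta> * \<zeta> ^ (m - Suc k') = \<zeta> ^ (m - k')" by (metis Suc_diff_Suc power_Suc)
    then show ?thesis by (simp add: backward_weight_def Suc algebra_simps)
  next
    case False
    then show ?thesis by (simp add: backward_weight_def Suc binomial_eq_0)
  qed
qed

text \<open>\<open>decay\<close> is the form in which the isolation of \<zeta> is used: the
  principal part converges at every distance from \<zeta>, however small.\<close>

locale finite_spectral_point = laurent_pencil B A1 R
  for B A1 :: "'x::complex_banach \<Rightarrow>\<^sub>L 'y::complex_banach" and R :: "int \<Rightarrow> 'y \<Rightarrow>\<^sub>L 'x" +
  fixes \<zeta> :: complex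
  assumes decay: "\<delta> > 0 \<Longrightarrow> \<exists>M\<ge>0. \<forall>k::nat. norm (R (- int k)) \<le> M * \<delta> ^ k"
begin

text \<open>Shifted so that \<open>S 0\<close> is \<open>R (- 1)\<close>. By \<open>N_S\<close>
  below, \<open>S k\<close> is (-N)^k R_(-1) with N = R_(-1) B.\<close>

abbreviation S :: "nat \<Rightarrow> 'y \<Rightarrow>\<^sub>L 'x" where "S k \<equiv> R (- 1 - int k)"

definition U :: "'x set" where "U = range (blinfun_apply (R (- 1) o\<^sub>L A1))"

definition H :: "'x \<Rightarrow>\<^sub>L 'x" where "H = \<zeta> *\<^sub>C id_blinfun - (R (- 1) o\<^sub>L B)"

lemma H_apply: "H x = \<zeta> *\<^sub>C x - R (- 1) (B x)"
  by (simp add: H_def blinfun.diff_left blinfun_apply_scaleC_aux)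

lemma P_S: "R (- 1) (A1 (S k y)) = S k y"
  by (simp add: product_A1)

lemma N_S: "R (- 1) (B (S k y)) = - S (Suc k) y"
  using product_B[of "- 1" "- 1 - int k" y] by simp

lemma S_N: "S k (B (R (- 1) y)) = - S (Suc k) y"
  using product_B[of "- 1 - int k" "- 1" y] by simp

lemma S_norm: "\<delta> > 0 \<Longrightarrow> \<exists>M\<ge>0. \<forall>k. norm (S k) \<le> M * \<delta> ^ k"
proof -
  assume \<delta>: "\<delta> > 0"
  then obtain M where M: "M \<ge> 0" "\<And>k::nat. norm (R (- int k)) \<le> M * \<delta> ^ k" using decay by blast
  have "norm (S k) \<le> (M * \<delta>) * \<delta> ^ k" for k
  proof -
    have "- 1 - int k = - int (Suc k)" by simp
    then show ?thesis using M(2)[of "Suc k"] by (simp only: power_Suc mult.assoc)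
  qed
  then show ?thesis using M(1) \<delta> by (intro exI[of _ "M * \<delta>"]) auto
qed

lemma U_iff: "x \<in> U \<longleftrightarrow> R (- 1) (A1 x) = x"
proof
  assume "x \<in> U"
  then obtain z where "x = R (- 1) (A1 z)" by (auto simp: U_def)
  then show "R (- 1) (A1 x) = x" using P_S[of 0 "A1 z"] by simp
next
  assume "R (- 1) (A1 x) = x"
  then have "x = (R (- 1) o\<^sub>L A1) x" by simp
  then show "x \<in> U" unfolding U_def by blast
qed

lemma S_mem: "S k y \<in> U"
  by (simp add: U_iff P_S)

lemma R_mem: "R (- 1) y \<in> U"
  using S_mem[of 0] by simp

lemma closed_U: "closed U"
proof -
  have "closed {x. R (- 1) (A1 x) = x}"
    by (intro closed_Collect_eq continuous_intros)
  then show ?thesis by (simp add: U_iff[symmetric])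
qed

lemma subspace_U: "subspace U"
  unfolding subspace_def by (auto simp: U_iff blinfun.add_right blinfun.scaleR_right)

lemma scaleC_mem: "x \<in> U \<Longrightarrow> c *\<^sub>C x \<in> U"
  by (simp add: U_iff clinear_op_apply clinear)

lemma H_mem: "x \<in> U \<Longrightarrow> H x \<in> U"
  unfolding H_apply by (intro subspace_diff subspace_U scaleC_mem R_mem)

lemma clinear_H: "H (c *\<^sub>C x) = c *\<^sub>C H x"
  by (simp add: H_apply clinear_op_apply clinear scaleC_scaleC mult.commute scaleC.diff_right)

lemma H_S: "H (S k y) = \<zeta> *\<^sub>C S k y + S (Suc k) y"
  by (simp add: H_apply N_S)

text \<open>Both sides come out as \<zeta> S_k B x + S_(k+1) B x. This commutation is what makes the
  inverse of \<open>H\<close> constructed later two-sided.\<close>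

lemma S_B_H: "S k (B (H x)) = H (S k (B x))"
  by (simp add: H_S) (simp add: H_apply blinfun.diff_right clinear_op_apply clinear S_N)

lemma projected_equation_iff:
  assumes "x \<in> U" "x' \<in> U"
  shows "(B x - \<zeta> *\<^sub>C A1 x) + A1 x' = A1 (R (- 1) y) \<longleftrightarrow> x' = H x + R (- 1) y"
proof
  assume eq: "(B x - \<zeta> *\<^sub>C A1 x) + A1 x' = A1 (R (- 1) y)"
  have "R (- 1) (B x) - \<zeta> *\<^sub>C x + x' = R (- 1) y"
    using arg_cong[OF eq, of "R (- 1)"] assms P_S[of 0 y]
    by (simp add: blinfun.add_right blinfun.diff_right clinear_op_apply clinear U_iff)
  then show "x' = H x + R (- 1) y" by (simp add: H_apply algebra_simps)
next
  assume eq: "x' = H x + R (- 1) y"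
  \<comment> \<open>For x in \<open>U\<close> the vector B x lies in the range of A_1 R_(-1), so A_1
    undoes R_(-1) on it; hence the reduced equation gives back the original one.\<close>
  have "A1 (R (- 1) (B (R (- 1) (A1 x)))) = - A1 (R (- 2) (A1 x))"
    using N_S[of 0 "A1 x"] by (simp add: blinfun.minus_right)
  also have "\<dots> = B (R (- 1) (A1 x))"
    using right_resolvent_apply[of "- 1" "A1 x"] by (simp add: neg_eq_iff_add_eq_0 add.commute)
  finally have "A1 (R (- 1) (B x)) = B x" using assms by (simp add: U_iff)
  then show "(B x - \<zeta> *\<^sub>C A1 x) + A1 x' = A1 (R (- 1) y)"
    by (simp add: eq H_apply blinfun.add_right blinfun.diff_right clinear_op_apply clinear)
qed

section \<open>Operators summed from the principal part with geometric weights\<close>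

definition kernel :: "(nat \<Rightarrow> nat \<Rightarrow> complex) \<Rightarrow> nat \<Rightarrow> 'y \<Rightarrow>\<^sub>L 'x" where
  "kernel v l = (\<Sum>\<^sub>\<infinity>k. v k l *\<^sub>C S k)"

context
  fixes v :: "nat \<Rightarrow> nat \<Rightarrow> complex" and q0 :: real
  assumes weight: "geometric_weight v q0"
begin

lemma weight_terms:
  assumes q: "q > q0"
  shows "\<exists>D\<ge>0. \<exists>K\<ge>0. \<exists>E>0. \<forall>k l. cmod (v k l) \<le> D * E ^ k * q ^ l \<and> norm (S k) \<le> K * (1 / (2 * E)) ^ k"
proof -
  obtain D E where D: "D \<ge> 0" "E > 0" "\<And>k l. cmod (v k l) \<le> D * E ^ k * q ^ l"
    using weight q unfolding geometric_weight_def by blast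
  \<comment> \<open>The decay rate of \<open>S k\<close> is free; 1 / (2 E) leaves the factor 2^(-k)
    after multiplication by E^k.\<close>
  moreover obtain K where "K \<ge> 0" "\<And>k. norm (S k) \<le> K * (1 / (2 * E)) ^ k"
    using S_norm[of "1 / (2 * E)"] D by auto
  ultimately show ?thesis by blast
qed

lemma kernel_terms:
  assumes q: "q > q0"
  shows "\<exists>K\<ge>0. \<forall>k l. norm (v k l *\<^sub>C S k) \<le> (K * q ^ l) * (1 / 2) ^ k"
proof -
  have q0: "q > 0" using q weight by (simp add: geometric_weight_def)
  obtain D K E where *: "D \<ge> 0" "K \<ge> 0" "E > 0"
    "\<And>k l. cmod (v k l) \<le> D * E ^ k * q ^ l" "\<And>k. norm (S k) \<le> K * (1 / (2 * E)) ^ k"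
    using weight_terms[OF q] by blast
  have "norm (v k l *\<^sub>C S k) \<le> (D * E ^ k * q ^ l) * (K * (1 / (2 * E)) ^ k)" for k l
    unfolding norm_scaleC using * q0 by (intro mult_mono) auto
  also have "(D * E ^ k * q ^ l) * (K * (1 / (2 * E)) ^ k) = (D * K * q ^ l) * (1 / 2) ^ k" for k l
    using *(3) by (simp add: power_divide power_mult_distrib)
  finally show ?thesis using * by (intro exI[of _ "D * K"]) auto
qed

lemma q0_nonneg: "q0 \<ge> 0"
  using weight by (simp add: geometric_weight_def)

lemma kernel_abs_summable: "(\<lambda>k. v k l *\<^sub>C S k) abs_summable_on UNIV"
proof -
  obtain K where "\<And>k. norm (v k l *\<^sub>C S k) \<le> (K * (q0 + 1) ^ l) * (1 / 2) ^ k"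
    using kernel_terms[of "q0 + 1"] by auto
  then show ?thesis
    using summable_on_geometric_nat[of "1 / 2"] by (intro abs_summable_on_comparison_mult) auto
qed

lemma kernel_norm:
  assumes q: "q > q0"
  shows "\<exists>K\<ge>0. \<forall>l. norm (kernel v l) \<le> K * q ^ l"
proof -
  obtain K where K: "K \<ge> 0" "\<And>k l. norm (v k l *\<^sub>C S k) \<le> (K * q ^ l) * (1 / 2) ^ k"
    using kernel_terms[OF q] by blast
  have "norm (kernel v l) \<le> (2 * K) * q ^ l" for l
  proof -
    have "norm (kernel v l) \<le> (\<Sum>\<^sub>\<infinity>k. norm (v k l *\<^sub>C S k))"
      unfolding kernel_def by (rule norm_infsum_bound[OF kernel_abs_summable])
    also have "((\<lambda>k. (K * q ^ l) * (1 / 2) ^ k) has_sum ((K * q ^ l) * (1 / (1 - 1 / 2)))) UNIV"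
      by (intro has_sum_cmult_right sums_nonneg_imp_has_sum geometric_sums) auto
    then have "(\<Sum>\<^sub>\<infinity>k. norm (v k l *\<^sub>C S k)) \<le> (K * q ^ l) * (1 / (1 - 1 / 2))"
      using kernel_abs_summable K by (intro has_sum_mono[OF has_sum_infsum]) auto
    finally show ?thesis by simp
  qed
  then show ?thesis using K by (intro exI[of _ "2 * K"]) auto
qed

lemma kernel_has_sum: "((\<lambda>k. v k l *\<^sub>C S k y) has_sum kernel v l y) UNIV"
  using has_sum_apply[OF has_sum_infsum[OF abs_summable_summable[OF kernel_abs_summable]], of l y]
  by (simp add: kernel_def blinfun_apply_scaleC_aux)

lemma kernel_mem: "kernel v l y \<in> U"
  using kernel_has_sum by (rule has_sum_in_closed_subspace)
    (auto intro: closed_U subspace_U scaleC_mem S_mem)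

text \<open>\<open>H\<close> is applied termwise, and the index is shifted in the part that carries
  \<open>S (Suc k)\<close>; at k = 0 this part contributes nothing.\<close>

lemma kernel_H_has_sum:
  "((\<lambda>k. (\<zeta> * v k l + (if k = 0 then 0 else v (k - 1) l)) *\<^sub>C S k y) has_sum H (kernel v l y)) UNIV"
proof -
  have sum: "((\<lambda>k. v k l *\<^sub>C (\<zeta> *\<^sub>C S k y + S (Suc k) y)) has_sum H (kernel v l y)) UNIV"
    using has_sum_blinfun_apply[OF kernel_has_sum, of H l y] by (simp add: clinear_H H_S)
  have 1: "((\<lambda>k. (\<zeta> * v k l) *\<^sub>C S k y) has_sum \<zeta> *\<^sub>C kernel v l y) UNIV"
    using has_sum_scaleC[OF kernel_has_sum, of \<zeta>] by (simp add: scaleC_scaleC)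
  from has_sum_diff[OF sum this]
  have "((\<lambda>k. v k l *\<^sub>C S (Suc k) y) has_sum (H (kernel v l y) - \<zeta> *\<^sub>C kernel v l y)) UNIV"
    by (simp add: scaleC.add_right scaleC_scaleC mult.commute)
  then have "((\<lambda>k. (if k = 0 then 0 else v (k - 1) l) *\<^sub>C S k y)
      has_sum (0 + (H (kernel v l y) - \<zeta> *\<^sub>C kernel v l y))) UNIV"
    using has_sum_Suc[of "\<lambda>k. (if k = 0 then 0 else v (k - 1) l) *\<^sub>C S k y"]
    by (simp add: scaleC.zero_left)
  from has_sum_add[OF 1 this] show ?thesis by (simp add: scaleC.add_left)
qed

lemma kernel_B_H: "kernel v l (B (H x)) = H (kernel v l (B x))"
proof -
  have "((\<lambda>k. v k l *\<^sub>C S k (B (H x))) has_sum H (kernel v l (B x))) UNIV"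
    using has_sum_blinfun_apply[OF kernel_has_sum, of H l "B x"] by (simp add: clinear_H S_B_H)
  then show ?thesis using kernel_has_sum has_sum_unique by blast
qed

text \<open>The geometric weights make the double series absolutely convergent.\<close>

lemma
  fixes e :: "nat \<Rightarrow> 'y"
  assumes q: "q > q0" "q * s < 1" and s: "s \<ge> 0" and e: "\<And>l. norm (e l) \<le> M * s ^ l"
  shows weighted_summable: "(\<lambda>l. v k l *\<^sub>C e l) summable_on UNIV"
    and iterated_summable: "(\<lambda>k. S k (\<Sum>\<^sub>\<infinity>l. v k l *\<^sub>C e l)) summable_on UNIV"
    and iterated_infsum: "(\<Sum>\<^sub>\<infinity>k. S k (\<Sum>\<^sub>\<infinity>l. v k l *\<^sub>C e l)) = (\<Sum>\<^sub>\<infinity>l. kernel v l (e l))"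
proof -
  have q': "q > 0" using q q0_nonneg by simp
  have M: "M \<ge> 0" using order_trans[OF norm_ge_zero e[of 0]] by simp
  obtain D K E where *: "D \<ge> 0" "K \<ge> 0" "E > 0"
    "\<And>k l. cmod (v k l) \<le> D * E ^ k * q ^ l" "\<And>k. norm (S k) \<le> K * (1 / (2 * E)) ^ k"
    using weight_terms[OF q(1)] by blast
  have qs: "0 \<le> q * s" using q' s by simp
  have le: "norm (v k l *\<^sub>C e l) \<le> (D * E ^ k * M) * (q * s) ^ l" for k l
  proof -
    have "norm (v k l *\<^sub>C e l) \<le> (D * E ^ k * q ^ l) * (M * s ^ l)"
      unfolding norm_scaleC using * q' by (intro mult_mono e) auto
    then show ?thesis by (simp add: power_mult_distrib mult_ac)
  qed
  have "(\<lambda>l. v k l *\<^sub>C e l) abs_summable_on UNIV" for k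
    using summable_on_geometric_nat[OF qs q(2)] le by (rule abs_summable_on_comparison_mult)
  then show sum1: "(\<lambda>l. v k l *\<^sub>C e l) summable_on UNIV" for k
    by (rule abs_summable_summable)
  \<comment> \<open>The double family behind both iterated sums. The Laurent coefficients contribute
    2^(-k) and the noise (q s)^l, so a product of two geometric series dominates it.\<close>
  define g where "g = (\<lambda>k l. v k l *\<^sub>C S k (e l))"
  have g_le: "norm (g k l) \<le> (D * K * M) * ((1 / 2) ^ k * (q * s) ^ l)" for k l
  proof -
    have "norm (g k l) = norm (S k (v k l *\<^sub>C e l))"
      by (simp add: g_def clinear_op_apply clinear)
    also have "\<dots> \<le> (K * (1 / (2 * E)) ^ k) * ((D * E ^ k * M) * (q * s) ^ l)"
      using * by (intro order_trans[OF norm_blinfun] mult_mono le) auto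
    also have "\<dots> = (D * K * M) * ((1 / 2) ^ k * (q * s) ^ l)"
      using *(3) by (simp add: power_divide power_mult_distrib)
    finally show ?thesis .
  qed
  define h :: "nat \<times> nat \<Rightarrow> real" where "h = (\<lambda>(k, l). (1 / 2) ^ k * (q * s) ^ l)"
  have "h summable_on UNIV \<times> UNIV"
  proof (rule summable_on_SigmaI)
    show "((\<lambda>l. h (k, l)) has_sum ((1 / 2) ^ k * (1 / (1 - q * s)))) UNIV" for k
      unfolding h_def prod.case
      using qs q(2) by (intro has_sum_cmult_right sums_nonneg_imp_has_sum geometric_sums) auto
    show "(\<lambda>k::nat. (1 / 2) ^ k * (1 / (1 - q * s))) summable_on UNIV"
      by (intro summable_on_cmult_left summable_on_geometric_nat) auto
  qed (use qs in \<open>auto simp: h_def\<close>)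
  then have "(\<lambda>(k, l). g k l) abs_summable_on UNIV \<times> UNIV"
    by (rule abs_summable_on_comparison_mult[where M = "D * K * M"]) (use g_le in \<open>auto simp: h_def\<close>)
  then have sum2: "(\<lambda>(k, l). g k l) summable_on UNIV \<times> UNIV"
    by (rule abs_summable_summable)
  have inner: "S k (\<Sum>\<^sub>\<infinity>l. v k l *\<^sub>C e l) = (\<Sum>\<^sub>\<infinity>l. g k l)" for k
    using has_sum_blinfun_apply[OF has_sum_infsum[OF sum1], of "S k" k]
    by (simp add: g_def clinear_op_apply clinear infsumI)
  show "(\<lambda>k. S k (\<Sum>\<^sub>\<infinity>l. v k l *\<^sub>C e l)) summable_on UNIV"
    unfolding inner using sum2 by (rule summable_on_Sigma_banach)
  have "(\<Sum>\<^sub>\<infinity>k. S k (\<Sum>\<^sub>\<infinity>l. v k l *\<^sub>C e l)) = (\<Sum>\<^sub>\<infinity>l. \<Sum>\<^sub>\<infinity>k. g k l)"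
    unfolding inner using sum2 by (rule infsum_swap_banach)
  also have "\<dots> = (\<Sum>\<^sub>\<infinity>l. kernel v l (e l))"
    by (simp add: g_def infsumI[OF kernel_has_sum])
  finally show "(\<Sum>\<^sub>\<infinity>k. S k (\<Sum>\<^sub>\<infinity>l. v k l *\<^sub>C e l)) = (\<Sum>\<^sub>\<infinity>l. kernel v l (e l))" .
qed

end

end

lemma free_flow_invertible_iff:
  assumes inv: "\<And>x. blinfun_apply K (blinfun_apply L x) = x" "\<And>x. blinfun_apply L (blinfun_apply K x) = x"
  shows "(\<forall>t. y t = K (y (t - 1))) \<and> y t0 = c \<longleftrightarrow>
    (\<forall>t. y t = (if t \<ge> t0 then (blinfun_apply K ^^ nat (t - t0)) c else (blinfun_apply L ^^ nat (t0 - t)) c))"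
    (is "?L \<longleftrightarrow> (\<forall>t. y t = ?z t)")
proof
  have LK: "(blinfun_apply L ^^ n) ((blinfun_apply K ^^ n) x) = x" for n x
    by (induction n arbitrary: x) (auto simp: inv funpow_swap1)
  assume L: ?L
  show "\<forall>t. y t = ?z t"
  proof
    fix t
    have pow: "(blinfun_apply K ^^ n) (y (t - int n)) = y t" for n t
      by (rule free_flow_pow) (use L in blast)
    show "y t = ?z t"
    proof (cases "t \<ge> t0")
      case True
      then show ?thesis using conjunct2[OF L] pow[of "nat (t - t0)" t] by auto
    next
      case False
      then have "(blinfun_apply K ^^ nat (t0 - t)) (y t) = c"
        using conjunct2[OF L] pow[of "nat (t0 - t)" t0] by auto
      then show ?thesis using False LK[of "nat (t0 - t)" "y t"] by auto
    qed
  qed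
next
  assume y: "\<forall>t. y t = ?z t"
  have "?z t = K (?z (t - 1))" for t
  proof (cases "t > t0")
    case True
    then have "nat (t - t0) = Suc (nat (t - 1 - t0))" by auto
    then show ?thesis using True by simp
  next
    case False
    then have "nat (t0 - (t - 1)) = Suc (nat (t0 - t))" by auto
    then show ?thesis using False by (cases "t = t0") (simp_all add: inv)
  qed
  then show ?L unfolding y[rule_format] by auto
qed

text \<open>Supplies the noise bound that the series need when |\<zeta>| = 1: truncated noise
  satisfies it for every positive s, even below 1.\<close>

lemma finite_support_geometric_bound:
  fixes e :: "nat \<Rightarrow> 'a::real_normed_vector"
  assumes "\<And>l. l \<ge> n \<Longrightarrow> e l = 0" "s > 0"
  shows "\<exists>M. \<forall>l. norm (e l) \<le> M * s ^ l"
proof (intro exI allI)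
  fix l
  show "norm (e l) \<le> (\<Sum>i<n. norm (e i) / s ^ i) * s ^ l"
  proof (cases "l < n")
    case True
    have "norm (e l) / s ^ l \<le> (\<Sum>i<n. norm (e i) / s ^ i)"
      using True assms(2) by (intro member_le_sum) auto
    then show ?thesis using assms(2) by (simp add: pos_divide_le_eq)
  next
    case False
    then show ?thesis using assms by (simp add: sum_nonneg)
  qed
qed

lemma bij_betw_Suc_atLeast: "bij_betw Suc UNIV {1..}"
  by (rule bij_betwI[of _ _ _ "\<lambda>k. k - 1"]) auto

lemma op_inv_eq:
  assumes "bounded_inverse T S"
  shows "op_inv T = S"
  unfolding op_inv_def
proof (rule the_equality, rule assms)
  fix S' assume S': "bounded_inverse T S'"
  show "S' = S"
  proof (rule blinfun_eqI)
    fix y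
    have "S' (T (S y)) = S y" using S' by (metis bounded_inverse_def blinfun_apply_blinfun_compose blinfun_apply_id_blinfun id_apply)
    moreover have "T (S y) = y" using assms by (metis bounded_inverse_def blinfun_apply_blinfun_compose blinfun_apply_id_blinfun id_apply)
    ultimately show "S' y = S y" by simp
  qed
qed

section \<open>The inverse and the powers of \<open>H\<close> for \<zeta> different from 0\<close>

context finite_spectral_point
begin

context
  assumes nz: "\<zeta> \<noteq> 0"
begin

abbreviation Tf :: "nat \<Rightarrow> 'y \<Rightarrow>\<^sub>L 'x" where "Tf \<equiv> kernel (forward_weight \<zeta>)"
abbreviation Tb :: "nat \<Rightarrow> 'y \<Rightarrow>\<^sub>L 'x" where "Tb \<equiv> kernel (backward_weight \<zeta>)"

lemmas fw = geometric_forward_weight[OF nz] and bw = geometric_backward_weight[OF nz]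

lemma H_Tf_Suc: "H (Tf (Suc l) y) = Tf l y"
  using kernel_H_has_sum[OF fw, of "Suc l" y] kernel_has_sum[OF fw, of l y] has_sum_unique
  unfolding forward_weight_Suc[OF nz] by blast

lemma H_Tf_0: "H (Tf 0 y) = - R (- 1) y"
proof -
  have "((\<lambda>k. (if k = 0 then - 1 else 0) *\<^sub>C S k y) has_sum (- R (- 1) y)) UNIV"
    by (rule has_sum_finite_neutralI[of "{0}"]) (auto simp: scaleC.zero_left scaleC.minus_left scaleC_one)
  with kernel_H_has_sum[OF fw, of 0 y] show ?thesis
    unfolding forward_weight_0[OF nz] by (rule has_sum_unique)
qed

lemma H_Tb: "H (Tb m y) = Tb (Suc m) y"
  using kernel_H_has_sum[OF bw, of m y] kernel_has_sum[OF bw, of "Suc m" y] has_sum_unique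
  unfolding backward_weight_Suc by blast

lemma Tb_0: "Tb 0 y = R (- 1) y"
proof -
  have "((\<lambda>k. backward_weight \<zeta> k 0 *\<^sub>C S k y) has_sum R (- 1) y) UNIV"
    by (rule has_sum_finite_neutralI[of "{0}"])
      (auto simp: backward_weight_def scaleC.zero_left scaleC_one binomial_eq_0)
  with kernel_has_sum[OF bw, of 0 y] show ?thesis by (rule has_sum_unique)
qed

text \<open>On the range of the projection \<open>R\<^sub>-\<^sub>1 A\<^sub>1\<close> the inverse is \<open>- Tf 0 A1\<close>; on its kernel \<open>H\<close> is \<open>\<zeta>\<close>.\<close>

lemma bounded_inverse_H: "bounded_inverse H (inverse \<zeta> *\<^sub>C (id_blinfun - (Tf 0 o\<^sub>L B)))"
proof -
  \<comment> \<open>Since H Tf_0 B = - R_(-1) B = H - \<zeta>, the operator H (I - Tf_0 B) is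
    multiplication by \<zeta>.\<close>
  define K where "K = inverse \<zeta> *\<^sub>C (id_blinfun - (Tf 0 o\<^sub>L B))"
  have K: "K x = inverse \<zeta> *\<^sub>C (x - Tf 0 (B x))" for x
    by (simp add: K_def blinfun_apply_scaleC_aux blinfun.diff_left)
  have HK: "H (K x) = x" for x
  proof -
    have "H (K x) = inverse \<zeta> *\<^sub>C (H x - H (Tf 0 (B x)))"
      by (simp add: K clinear_H blinfun.diff_right)
    also have "H x - H (Tf 0 (B x)) = \<zeta> *\<^sub>C x"
      unfolding H_Tf_0 by (simp add: H_apply)
    finally show ?thesis using nz by (simp add: scaleC_scaleC scaleC_one)
  qed
  have KH: "K (H x) = x" for x
  proof -
    have "K (H x) = inverse \<zeta> *\<^sub>C (H x - H (Tf 0 (B x)))"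
      unfolding K kernel_B_H[OF fw] ..
    also have "H x - H (Tf 0 (B x)) = \<zeta> *\<^sub>C x"
      unfolding H_Tf_0 by (simp add: H_apply)
    finally show ?thesis using nz by (simp add: scaleC_scaleC scaleC_one)
  qed
  \<comment> \<open>Complex linearity of the inverse follows from that of \<open>H\<close>, so none
    has to be shown for \<open>Tf\<close>.\<close>
  have "K (c *\<^sub>C x) = c *\<^sub>C K x" for c x
    using KH[of "c *\<^sub>C K x"] by (simp add: clinear_H HK)
  then have "bounded_inverse H K"
    using HK KH by (simp add: bounded_inverse_def clinear_op_def blinfun_eqI)
  then show ?thesis by (simp add: K_def)
qed

abbreviation F :: "'x \<Rightarrow>\<^sub>L 'x" where "F \<equiv> op_inv H"

lemma F_H: "F (H x) = x" and H_F: "H (F x) = x"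
proof -
  have "bounded_inverse H F"
    using op_inv_eq[OF bounded_inverse_H] bounded_inverse_H by metis
  then have "F o\<^sub>L H = id_blinfun" "H o\<^sub>L F = id_blinfun"
    by (simp_all add: bounded_inverse_def)
  then show "F (H x) = x" "H (F x) = x"
    by (metis blinfun_apply_blinfun_compose blinfun_apply_id_blinfun id_apply)+
qed

lemma F_Tf: "F (Tf l y) = Tf (Suc l) y"
  using F_H H_Tf_Suc by metis

lemma F_R: "F (R (- 1) y) = - Tf 0 y"
  using F_H[of "Tf 0 y"] by (simp add: H_Tf_0 blinfun.minus_right minus_equation_iff)

lemma F_pow_Tf: "(blinfun_apply F ^^ l) (Tf m y) = Tf (m + l) y"
  by (induction l) (auto simp: F_Tf)

text \<open>The first power of \<open>F\<close> turns R_(-1) into minus \<open>Tf 0\<close>; only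
  the remaining l powers raise the index.\<close>

lemma F_pow_R: "(blinfun_apply F ^^ Suc l) (R (- 1) y) = - Tf l y"
proof -
  have "(blinfun_apply F ^^ Suc l) (R (- 1) y) = (blinfun_apply F ^^ l) (0 - Tf 0 y)"
    by (simp add: funpow_swap1 F_R)
  then show ?thesis by (simp only: blinfun_pow_diff F_pow_Tf) simp
qed

lemma H_pow_R: "(blinfun_apply H ^^ m) (R (- 1) y) = Tb m y"
  by (induction m) (auto simp: H_Tb Tb_0)

lemma F_mem: "x \<in> U \<Longrightarrow> F x \<in> U"
  using F_R[of "A1 x"] kernel_mem[OF fw, of 0 "A1 x"] subspace_neg[OF subspace_U] by (metis U_iff)

text \<open>Each x in \<open>U\<close> equals R_(-1) A_1 x, so the powers of \<open>H\<close> on x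
  are the kernels applied to A_1 x.\<close>

lemma H_pow_bound:
  assumes q: "q > cmod \<zeta>"
  shows "\<exists>C\<ge>0. \<forall>n. \<forall>x\<in>U. norm ((blinfun_apply H ^^ n) x) \<le> C * q ^ n * norm x"
proof -
  obtain K where K: "K \<ge> 0" "\<And>l. norm (Tb l) \<le> K * q ^ l"
    using kernel_norm[OF bw q] by blast
  have q0: "q > 0" using q by (rule le_less_trans[OF norm_ge_zero])
  have "norm ((blinfun_apply H ^^ n) x) \<le> (K * norm A1) * q ^ n * norm x" if "x \<in> U" for n x
  proof -
    have "(blinfun_apply H ^^ n) x = Tb n (A1 x)" using that H_pow_R[of n "A1 x"] by (simp add: U_iff)
    also have "norm (Tb n (A1 x)) \<le> (K * q ^ n) * (norm A1 * norm x)"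
      using K q0 by (intro order_trans[OF norm_blinfun] mult_mono norm_blinfun) auto
    finally show ?thesis by (simp add: mult_ac)
  qed
  then show ?thesis using K by (intro exI[of _ "K * norm A1"]) auto
qed

lemma F_pow_bound:
  assumes q: "q > 1 / cmod \<zeta>"
  shows "\<exists>C\<ge>0. \<forall>n. \<forall>x\<in>U. norm ((blinfun_apply F ^^ n) x) \<le> C * q ^ n * norm x"
proof -
  obtain K where K: "K \<ge> 0" "\<And>l. norm (Tf l) \<le> K * q ^ l"
    using kernel_norm[OF fw q] by blast
  have q0: "q > 0" using q by (rule le_less_trans[rotated]) simp
  \<comment> \<open>The summand 1 covers n = 0; the division by q pays for the index shift between
    F^(l + 1) and \<open>Tf l\<close>.\<close>
  define C where "C = 1 + K * norm A1 / q"
  have C: "C \<ge> 1" "C \<ge> K * norm A1 / q" using K q0 by (auto simp: C_def)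
  have "norm ((blinfun_apply F ^^ n) x) \<le> C * q ^ n * norm x" if "x \<in> U" for n x
  proof (cases n)
    case 0
    then show ?thesis using C mult_right_mono[of 1 C "norm x"] by simp
  next
    case (Suc l)
    have "(blinfun_apply F ^^ n) x = - Tf l (A1 x)" using that F_pow_R[of l "A1 x"] Suc by (simp add: U_iff)
    then have "norm ((blinfun_apply F ^^ n) x) = norm (Tf l (A1 x))" by simp
    also have "\<dots> \<le> (K * q ^ l) * (norm A1 * norm x)"
      using K q0 by (intro order_trans[OF norm_blinfun] mult_mono norm_blinfun) auto
    also have "\<dots> = (K * norm A1 / q) * (q ^ n * norm x)" using q0 by (simp add: Suc)
    also have "\<dots> \<le> C * (q ^ n * norm x)" using C(2) q0 by (intro mult_right_mono) auto
    finally show ?thesis by (simp add: mult_ac)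
  qed
  then show ?thesis using C by (intro exI[of _ C]) auto
qed

text \<open>The reduced equation solved for the later state; the source becomes - F R_(-1) y, which
  is \<open>Tf 0 y\<close>.\<close>

lemma forward_equation_iff:
  assumes "x \<in> U" "x' \<in> U" "A1 (R (- 1) y) = y"
  shows "(B x - \<zeta> *\<^sub>C A1 x) + A1 x' = y \<longleftrightarrow> x = Tf 0 y + F x'"
proof -
  have "(B x - \<zeta> *\<^sub>C A1 x) + A1 x' = y \<longleftrightarrow> x' = H x + R (- 1) y"
    using projected_equation_iff[OF assms(1,2), of y] assms(3) by simp
  also have "\<dots> \<longleftrightarrow> F x' = F (H x + R (- 1) y)" by (metis H_F)
  also have "\<dots> \<longleftrightarrow> x = Tf 0 y + F x'"
    by (auto simp: blinfun.add_right F_H F_R algebra_simps)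
  finally show ?thesis .
qed

lemma backward_equation_iff:
  assumes "x \<in> U" "x' \<in> U" "A1 (R (- 1) y) = y"
  shows "(B x - \<zeta> *\<^sub>C A1 x) + A1 x' = y \<longleftrightarrow> x' = R (- 1) y + H x"
  using projected_equation_iff[OF assms(1,2), of y] assms(3) by (simp add: add.commute)

section \<open>The difference series of the statement as flow sums\<close>

context
  fixes Rf :: "complex option \<Rightarrow> int \<Rightarrow> 'y \<Rightarrow>\<^sub>L 'x" and e :: "int \<Rightarrow> 'y"
  assumes Rf: "Rf (Some \<zeta>) = R"
begin

lemma
  assumes s: "s > 0" "s < cmod \<zeta>" and e: "\<And>l. norm (e (t - int l)) \<le> M * s ^ l"
  shows nabla_term_summable: "k \<ge> 1 \<Longrightarrow> nabla_term \<zeta> k e t summable_on UNIV"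
    and forward_term_summable: "forward_term Rf \<zeta> e t summable_on {1..}"
    and forward_term_infsum: "infsum (forward_term Rf \<zeta> e t) {1..} = flow_sum F (\<lambda>t. Tf 0 (e t)) t"
proof -
  \<comment> \<open>The midpoint of 1 / |\<zeta>| and 1 / s: above the rate of the weights, yet with
    q s < 1.\<close>
  define q where "q = (1 / cmod \<zeta> + 1 / s) / 2"
  have lt: "1 / cmod \<zeta> < 1 / s" using s mult_pos_pos[of s "cmod \<zeta>"] nz
    by (intro divide_strict_left_mono) (auto simp: mult.commute)
  then have q: "q > 1 / cmod \<zeta>" by (simp add: q_def)
  have "q * s < (1 / s) * s" using s lt by (intro mult_strict_right_mono) (auto simp: q_def)
  then have qs: "q * s < 1" using s by simp
  note series = weighted_summable[OF fw q qs less_imp_le[OF s(1)] e]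
    iterated_summable[OF fw q qs less_imp_le[OF s(1)] e]
    iterated_infsum[OF fw q qs less_imp_le[OF s(1)] e]
  \<comment> \<open>The sign of the weight is not part of the difference operator; it cancels
    against the sign in \<open>forward_term\<close>.\<close>
  have nabla: "nabla_term \<zeta> (Suc k) e t l = (- 1) ^ Suc k *\<^sub>C (forward_weight \<zeta> k l *\<^sub>C e (t - int l))" for k l
    by (simp add: nabla_term_def forward_weight_def scaleC_scaleC mult.assoc[symmetric] power_mult_distrib[symmetric])
  have sum: "(nabla_term \<zeta> (Suc k) e t has_sum
      (- 1) ^ Suc k *\<^sub>C (\<Sum>\<^sub>\<infinity>l. forward_weight \<zeta> k l *\<^sub>C e (t - int l))) UNIV" for k
    unfolding nabla[abs_def] by (intro has_sum_scaleC has_sum_infsum series(1))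
  show "nabla_term \<zeta> k e t summable_on UNIV" if "k \<ge> 1"
    using sum[of "k - 1"] that by (auto simp: has_sum_imp_summable)
  have "(- 1) ^ k *\<^sub>R ((- 1) ^ k *\<^sub>C z) = z" for k and z :: 'x
    by (simp add: scaleC_of_real[symmetric] scaleC_scaleC power_mult_distrib[symmetric] scaleC_one)
  then have summand: "forward_term Rf \<zeta> e t (Suc k) = S k (\<Sum>\<^sub>\<infinity>l. forward_weight \<zeta> k l *\<^sub>C e (t - int l))" for k
  proof -
    have "forward_term Rf \<zeta> e t (Suc k) = (- 1) ^ Suc k *\<^sub>R S k (nabla_npow \<zeta> (Suc k) e t)"
      by (simp add: forward_term_def Rf)
    also have "nabla_npow \<zeta> (Suc k) e t = (- 1) ^ Suc k *\<^sub>C (\<Sum>\<^sub>\<infinity>l. forward_weight \<zeta> k l *\<^sub>C e (t - int l))"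
      unfolding nabla_npow_def by (rule infsumI[OF sum])
    finally show ?thesis
      using \<open>\<And>k z. (- 1) ^ k *\<^sub>R ((- 1) ^ k *\<^sub>C z) = z\<close> by (simp only: clinear_op_apply[OF clinear(3)])
  qed
  show "forward_term Rf \<zeta> e t summable_on {1..}"
    using series(2) summable_on_reindex_bij_betw[OF bij_betw_Suc_atLeast, of "forward_term Rf \<zeta> e t"]
    by (simp only: summand)
  have "infsum (forward_term Rf \<zeta> e t) {1..} = (\<Sum>\<^sub>\<infinity>l. Tf l (e (t - int l)))"
    using series(3) infsum_reindex_bij_betw[OF bij_betw_Suc_atLeast, of "forward_term Rf \<zeta> e t"]
    by (simp only: summand)
  then show "infsum (forward_term Rf \<zeta> e t) {1..} = flow_sum F (\<lambda>t. Tf 0 (e t)) t"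
    by (simp add: flow_sum_def F_pow_Tf)
qed

text \<open>In reversed time z_s = x_(-s) the recursion reads z_s = H z_(s-1) + R_(-1) e_(1-s). The
  offset 1 arises because the equation at time t determines x_(t-1).\<close>

lemma
  assumes s: "s > 0" "s * cmod \<zeta> < 1" and e: "\<And>l. norm (e (t + 1 + int l)) \<le> M * s ^ l"
  shows delta_term_summable: "k \<ge> 1 \<Longrightarrow> delta_term \<zeta> k e (t + int k) summable_on UNIV"
    and backward_term_summable: "backward_term Rf \<zeta> e t summable_on {1..}"
    and backward_term_infsum:
      "infsum (backward_term Rf \<zeta> e t) {1..} = flow_sum H (\<lambda>t. R (- 1) (e (1 - t))) (- t)"
proof -
  define q where "q = (cmod \<zeta> + 1 / s) / 2"
  have lt: "cmod \<zeta> < 1 / s" using s by (simp add: field_simps)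
  then have q: "q > cmod \<zeta>" by (simp add: q_def)
  have "q * s < (1 / s) * s" using s lt by (intro mult_strict_right_mono) (auto simp: q_def)
  then have qs: "q * s < 1" using s by simp
  note series = weighted_summable[OF bw q qs less_imp_le[OF s(1)] e]
    iterated_summable[OF bw q qs less_imp_le[OF s(1)] e]
    iterated_infsum[OF bw q qs less_imp_le[OF s(1)] e]
  \<comment> \<open>With m = k + r the shift of time by k is absorbed into the index. Terms with m <
    k vanish with the binomial coefficient, so m may run over all natural numbers.\<close>
  have delta: "delta_term \<zeta> (Suc k) e (t + int (Suc k)) r
      = backward_weight \<zeta> k (k + r) *\<^sub>C e (t + 1 + int (k + r))" for k r
    using binomial_symmetric[of r "k + r"] by (simp add: delta_term_def backward_weight_def algebra_simps)
  have sum: "(delta_term \<zeta> (Suc k) e (t + int (Suc k)) has_sum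
      (\<Sum>\<^sub>\<infinity>m. backward_weight \<zeta> k m *\<^sub>C e (t + 1 + int m))) UNIV" for k
  proof -
    have "((\<lambda>m. backward_weight \<zeta> k m *\<^sub>C e (t + 1 + int m)) has_sum
      (\<Sum>\<^sub>\<infinity>m. backward_weight \<zeta> k m *\<^sub>C e (t + 1 + int m))) {k..}"
      by (rule has_sum_cong_neutral[THEN iffD1, OF _ _ _ has_sum_infsum[OF series(1)]])
        (auto simp: backward_weight_def binomial_eq_0 scaleC.zero_left)
    moreover have "bij_betw (\<lambda>r. k + r) UNIV {k..}"
      by (rule bij_betwI[of _ _ _ "\<lambda>m. m - k"]) auto
    ultimately show ?thesis
      unfolding delta[abs_def] using has_sum_reindex_bij_betw[of "\<lambda>r. k + r" UNIV "{k..}"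
          "\<lambda>m. backward_weight \<zeta> k m *\<^sub>C e (t + 1 + int m)"] by simp
  qed
  show "delta_term \<zeta> k e (t + int k) summable_on UNIV" if "k \<ge> 1"
    using sum[of "k - 1"] that by (auto simp: has_sum_imp_summable)
  have summand: "backward_term Rf \<zeta> e t (Suc k) = S k (\<Sum>\<^sub>\<infinity>m. backward_weight \<zeta> k m *\<^sub>C e (t + 1 + int m))" for k
  proof -
    have "delta_npow \<zeta> (Suc k) e (t + int (Suc k))
        = (- 1) ^ Suc k *\<^sub>R (\<Sum>\<^sub>\<infinity>m. backward_weight \<zeta> k m *\<^sub>C e (t + 1 + int m))"
      unfolding delta_npow_def infsumI[OF sum] ..
    then have "backward_term Rf \<zeta> e t (Suc k) = (- 1) ^ Suc k *\<^sub>R ((- 1) ^ Suc k *\<^sub>R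
        S k (\<Sum>\<^sub>\<infinity>m. backward_weight \<zeta> k m *\<^sub>C e (t + 1 + int m)))"
      unfolding backward_term_def Rf blinfun.scaleR_right[symmetric] by simp
    then show ?thesis by (simp add: power_mult_distrib[symmetric])
  qed
  show "backward_term Rf \<zeta> e t summable_on {1..}"
    using series(2) summable_on_reindex_bij_betw[OF bij_betw_Suc_atLeast, of "backward_term Rf \<zeta> e t"]
    by (simp only: summand)
  have "infsum (backward_term Rf \<zeta> e t) {1..} = (\<Sum>\<^sub>\<infinity>l. Tb l (e (t + 1 + int l)))"
    using series(3) infsum_reindex_bij_betw[OF bij_betw_Suc_atLeast, of "backward_term Rf \<zeta> e t"]
    by (simp only: summand)
  then show "infsum (backward_term Rf \<zeta> e t) {1..} = flow_sum H (\<lambda>t. R (- 1) (e (1 - t))) (- t)"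
    by (simp add: flow_sum_def H_pow_R algebra_simps)
qed

end

end

end

section \<open>Boundary values and flows of invertible recursions\<close>

lemma past_value_iff:
  "past_value H t0 x c \<longleftrightarrow> (\<lambda>r. (blinfun_apply (op_inv H) ^^ nat (int r + t0)) (x (- int r))) \<longlonglongrightarrow> c"
  unfolding past_value_def
proof (intro tendsto_cong eventually_sequentiallyI)
  fix r assume "nat \<bar>t0\<bar> \<le> r"
  then show "op_powi H (- int r - t0) (x (- int r)) = (blinfun_apply (op_inv H) ^^ nat (int r + t0)) (x (- int r))"
    by (cases "int r = - t0") (auto simp: op_powi_def op_pow_apply algebra_simps)
qed

lemma future_value_iff:
  "future_value H t0 x c \<longleftrightarrow> (\<lambda>r. (blinfun_apply H ^^ nat (int r + - t0)) (x (int r))) \<longlonglongrightarrow> c"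
  unfolding future_value_def
proof (intro tendsto_cong eventually_sequentiallyI)
  fix r assume "nat \<bar>t0\<bar> \<le> r"
  then show "op_powi H (int r - t0) (x (int r)) = (blinfun_apply H ^^ nat (int r + - t0)) (x (int r))"
    by (auto simp: op_powi_def op_pow_apply)
qed

lemma op_powi_flow:
  "op_powi H (- (t - t0)) c =
    (if t \<ge> t0 then (blinfun_apply (op_inv H) ^^ nat (t - t0)) c else (blinfun_apply H ^^ nat (t0 - t)) c)"
  by (auto simp: op_powi_def op_pow_apply)

lemma all_int_reflect: "(\<forall>t::int. P t) \<longleftrightarrow> (\<forall>t. P (a - t))"
  by (metis diff_diff_eq2 diff_add_cancel add_diff_cancel_left' add.commute)

text \<open>With an inverse that preserves \<open>U\<close>, the free flow is given by powers of
  both signs applied to c, so the boundary value fixes the solution.\<close>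

lemma (in contracting_flow) invertible_flow:
  fixes t0 :: int
  assumes inv: "\<And>x. F (blinfun_apply L x) = x" "\<And>x. L (blinfun_apply F x) = x"
    and L_mem: "\<And>x. x \<in> U \<Longrightarrow> L x \<in> U" and c: "c \<in> U"
  defines "sol \<equiv> (\<lambda>x. (\<forall>t. x t \<in> U) \<and> (\<forall>t. x t = f t + F (x (t - 1))) \<and>
     (\<lambda>r. (blinfun_apply F ^^ nat (int r + t0)) (x (- int r))) \<longlonglongrightarrow> c)"
  shows "sol x \<longleftrightarrow> (\<forall>t. x t = flow_sum F f t +
      (if t \<ge> t0 then (blinfun_apply F ^^ nat (t - t0)) c else (blinfun_apply L ^^ nat (t0 - t)) c))"
    (is "_ \<longleftrightarrow> (\<forall>t. x t = flow_sum F f t + ?z t)")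
    and "sol x \<Longrightarrow> subexponential x \<longleftrightarrow> c = 0"
proof -
  have L_pow_mem: "(blinfun_apply L ^^ n) c \<in> U" for n
    by (induction n) (auto simp: c L_mem)
  have z_mem: "?z t \<in> U" for t using L_pow_mem pow_mem[OF c] by auto
  have iff: "(\<forall>t. y t = F (y (t - 1))) \<and> y t0 = c \<longleftrightarrow> (\<forall>t. y t = ?z t)" for y
    using inv by (rule free_flow_invertible_iff)
  have "sol x \<longleftrightarrow> (\<exists>y. (\<forall>t. y t \<in> U) \<and> ((\<forall>t. y t = F (y (t - 1))) \<and> y t0 = c) \<and>
      (\<forall>t. x t = flow_sum F f t + y t))"
    unfolding sol_def flow_solution_iff by (simp only: conj_assoc)
  also have "\<dots> \<longleftrightarrow> (\<forall>t. x t = flow_sum F f t + ?z t)"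
    unfolding iff
  proof
    assume "\<exists>y. (\<forall>t. y t \<in> U) \<and> (\<forall>t. y t = ?z t) \<and> (\<forall>t. x t = flow_sum F f t + y t)"
    then obtain y where "\<forall>t. y t = ?z t" "\<forall>t. x t = flow_sum F f t + y t" by blast
    then show "\<forall>t. x t = flow_sum F f t + ?z t" by simp
  next
    assume "\<forall>t. x t = flow_sum F f t + ?z t"
    then show "\<exists>y. (\<forall>t. y t \<in> U) \<and> (\<forall>t. y t = ?z t) \<and> (\<forall>t. x t = flow_sum F f t + y t)"
      using z_mem by (intro exI[of _ ?z]) blast
  qed
  finally show eq: "sol x \<longleftrightarrow> (\<forall>t. x t = flow_sum F f t + ?z t)" .
  assume "sol x"
  then have x: "x = (\<lambda>t. flow_sum F f t + ?z t)" using eq by blast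
  have z_rec: "?z t = F (?z (t - 1))" for t
    using iff[of ?z] by blast
  show "subexponential x \<longleftrightarrow> c = 0"
  proof
    assume "subexponential x"
    then have "?z t0 = 0"
      unfolding x using z_mem z_rec subexponential_free_flow_zero[of ?z t0] by blast
    then show "c = 0" by simp
  next
    assume "c = 0"
    then have "?z t = 0" for t by simp
    then have "x = flow_sum F f" unfolding x by simp
    then show "subexponential x" using flow_sum_subexponential by simp
  qed
qed

section \<open>The three flows at a finite nonzero spectral point\<close>

context finite_spectral_point
begin

context
  fixes Rf :: "complex option \<Rightarrow> int \<Rightarrow> 'y \<Rightarrow>\<^sub>L 'x" and e :: "int \<Rightarrow> 'y"
  assumes Rf: "Rf (Some \<zeta>) = R" and e: "subexponential e" and Qe: "\<And>t. A1 (R (- 1) (e t)) = e t"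
begin

lemma forward_series_bound:
  assumes "1 < cmod \<zeta>"
  shows "\<exists>M. \<forall>l. norm (e (t - int l)) \<le> M * ((1 + cmod \<zeta>) / 2) ^ l"
proof -
  \<comment> \<open>The noise allows every rate above 1 and the forward weights every rate below
    |\<zeta>|; the midpoint is taken.\<close>
  define s where "s = (1 + cmod \<zeta>) / 2"
  have s: "s > 1" using assms by (simp add: s_def)
  obtain M where M: "M \<ge> 0" "\<And>t. norm (e t) \<le> M * s ^ nat \<bar>t\<bar>"
    using e s by (rule subexponential_bound) blast
  have "norm (e (t - int l)) \<le> (M * s ^ nat \<bar>t\<bar>) * s ^ l" for l
  proof -
    have "s ^ nat \<bar>t - int l\<bar> \<le> s ^ (nat \<bar>t\<bar> + l)" using s by (intro power_increasing) auto
    then show ?thesis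
      using M(2)[of "t - int l"] mult_left_mono[OF _ M(1)] by (fastforce simp: power_add mult.assoc)
  qed
  then show ?thesis by (auto simp: s_def)
qed

lemma backward_series_bound:
  assumes "s > 1"
  shows "\<exists>M. \<forall>l. norm (e (t + 1 + int l)) \<le> M * s ^ l"
proof -
  obtain M where M: "M \<ge> 0" "\<And>t. norm (e t) \<le> M * s ^ nat \<bar>t\<bar>"
    using e assms by (rule subexponential_bound) blast
  have "norm (e (t + 1 + int l)) \<le> (M * s ^ nat \<bar>t + 1\<bar>) * s ^ l" for l
  proof -
    have "s ^ nat \<bar>t + 1 + int l\<bar> \<le> s ^ (nat \<bar>t + 1\<bar> + l)" using assms by (intro power_increasing) auto
    then show ?thesis
      using M(2)[of "t + 1 + int l"] mult_left_mono[OF _ M(1)] by (fastforce simp: power_add mult.assoc)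
  qed
  then show ?thesis by auto
qed

lemma forward_flow:
  assumes \<zeta>: "1 < cmod \<zeta>"
  defines "sol \<equiv> (\<lambda>x. (\<forall>t. x t \<in> U) \<and> (\<forall>t. (B (x t) - \<zeta> *\<^sub>C A1 (x t)) + A1 (x (t - 1)) = e t))"
  shows "has_bounded_inverse H"
    and "k \<ge> 1 \<Longrightarrow> nabla_term \<zeta> k e t summable_on UNIV"
    and "forward_term Rf \<zeta> e t summable_on {1..}"
    and "c \<in> U \<Longrightarrow> sol x \<and> past_value H t0 x c \<longleftrightarrow>
      (\<forall>t. x t = (\<Sum>\<^sub>\<infinity>k\<in>{1..}. forward_term Rf \<zeta> e t k) + op_powi H (- (t - t0)) c)"
    and "c \<in> U \<Longrightarrow> sol x \<and> past_value H t0 x c \<Longrightarrow> subexponential x \<longleftrightarrow> c = 0"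
proof -
  have nz: "\<zeta> \<noteq> 0" using \<zeta> by auto
  show "has_bounded_inverse H" using bounded_inverse_H[OF nz] by (auto simp: has_bounded_inverse_def)
  have s: "(1 + cmod \<zeta>) / 2 > 0" "(1 + cmod \<zeta>) / 2 < cmod \<zeta>" using \<zeta> by auto
  have series: "k \<ge> 1 \<Longrightarrow> nabla_term \<zeta> k e t summable_on UNIV"
    "forward_term Rf \<zeta> e t summable_on {1..}"
    "infsum (forward_term Rf \<zeta> e t) {1..} = flow_sum (op_inv H) (\<lambda>t. kernel (forward_weight \<zeta>) 0 (e t)) t" for k t
    using forward_series_bound[OF \<zeta>, of t] nabla_term_summable[OF nz, of "Rf", OF Rf s]
      forward_term_summable[OF nz, of "Rf", OF Rf s] forward_term_infsum[OF nz, of "Rf", OF Rf s] by blast+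
  then show "k \<ge> 1 \<Longrightarrow> nabla_term \<zeta> k e t summable_on UNIV"
    "forward_term Rf \<zeta> e t summable_on {1..}" by blast+
  \<comment> \<open>The power bound for \<open>op_inv H\<close> needs a rate above 1 / |\<zeta>|,
    contraction one below 1.\<close>
  define q where "q = (1 / cmod \<zeta> + 1) / 2"
  have "1 / cmod \<zeta> < 1" using \<zeta> by (simp add: divide_less_eq)
  then have q: "0 \<le> q" "q < 1" "q > 1 / cmod \<zeta>" by (auto simp: q_def)
  obtain C where C: "C \<ge> 0" "\<And>n x. x \<in> U \<Longrightarrow> norm ((blinfun_apply (op_inv H) ^^ n) x) \<le> C * q ^ n * norm x"
    using F_pow_bound[OF nz q(3)] by blast
  interpret contracting_flow "op_inv H" U "\<lambda>t. kernel (forward_weight \<zeta>) 0 (e t)" q C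
    by unfold_locales
      (use closed_U subspace_U F_mem[OF nz] kernel_mem[OF geometric_forward_weight[OF nz]] q C
        subexponential_blinfun_apply[OF e] in auto)
  have sol: "sol x \<and> past_value H t0 x c \<longleftrightarrow>
    (\<forall>t. x t \<in> U) \<and> (\<forall>t. x t = kernel (forward_weight \<zeta>) 0 (e t) + op_inv H (x (t - 1))) \<and>
     (\<lambda>r. (blinfun_apply (op_inv H) ^^ nat (int r + t0)) (x (- int r))) \<longlonglongrightarrow> c" for x c
    unfolding sol_def past_value_iff using forward_equation_iff[OF nz _ _ Qe] by blast
  note flow = invertible_flow[of H _ x t0, OF F_H[OF nz] H_F[OF nz] H_mem, folded sol op_powi_flow]
  show "c \<in> U \<Longrightarrow> sol x \<and> past_value H t0 x c \<longleftrightarrow>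
      (\<forall>t. x t = (\<Sum>\<^sub>\<infinity>k\<in>{1..}. forward_term Rf \<zeta> e t k) + op_powi H (- (t - t0)) c)"
    unfolding series(3) by (rule flow(1))
  show "c \<in> U \<Longrightarrow> sol x \<and> past_value H t0 x c \<Longrightarrow> subexponential x \<longleftrightarrow> c = 0"
    by (rule flow(2))
qed

lemma backward_flow:
  assumes \<zeta>: "0 < cmod \<zeta>" "cmod \<zeta> < 1"
  defines "sol \<equiv> (\<lambda>x. (\<forall>t. x t \<in> U) \<and> (\<forall>t. (B (x t) - \<zeta> *\<^sub>C A1 (x t)) + A1 (x (t - 1)) = e t))"
  shows "has_bounded_inverse H"
    and "k \<ge> 1 \<Longrightarrow> delta_term \<zeta> k e t summable_on UNIV"
    and "backward_term Rf \<zeta> e t summable_on {1..}"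
    and "c \<in> U \<Longrightarrow> sol x \<and> future_value H t0 x c \<longleftrightarrow>
      (\<forall>t. x t = (\<Sum>\<^sub>\<infinity>k\<in>{1..}. backward_term Rf \<zeta> e t k) + op_powi H (- (t - t0)) c)"
    and "c \<in> U \<Longrightarrow> sol x \<and> future_value H t0 x c \<Longrightarrow> subexponential x \<longleftrightarrow> c = 0"
proof -
  have nz: "\<zeta> \<noteq> 0" using \<zeta> by auto
  show "has_bounded_inverse H" using bounded_inverse_H[OF nz] by (auto simp: has_bounded_inverse_def)
  \<comment> \<open>Above 1 for the noise, below 1 / |\<zeta>| for the backward weights.\<close>
  define s where "s = (1 + 1 / cmod \<zeta>) / 2"
  have "1 / cmod \<zeta> > 1" using \<zeta> by simp
  then have s: "s > 1" "s > 0" by (auto simp: s_def)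
  have s_less: "s * cmod \<zeta> < 1" using \<zeta> by (simp add: s_def field_simps)
  have series: "k \<ge> 1 \<Longrightarrow> delta_term \<zeta> k e (t + int k) summable_on UNIV"
    "backward_term Rf \<zeta> e t summable_on {1..}"
    "infsum (backward_term Rf \<zeta> e t) {1..} = flow_sum H (\<lambda>t. R (- 1) (e (1 - t))) (- t)" for k t
    using backward_series_bound[OF s(1), of t] delta_term_summable[OF nz, of "Rf", OF Rf s(2) s_less]
      backward_term_summable[OF nz, of "Rf", OF Rf s(2) s_less] backward_term_infsum[OF nz, of "Rf", OF Rf s(2) s_less]
    by blast+
  show "k \<ge> 1 \<Longrightarrow> delta_term \<zeta> k e t summable_on UNIV"
    using series(1)[of k "t - int k"] by simp
  show "backward_term Rf \<zeta> e t summable_on {1..}" by (rule series(2))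
  define q where "q = (cmod \<zeta> + 1) / 2"
  have q: "0 \<le> q" "q < 1" "q > cmod \<zeta>" using \<zeta> by (auto simp: q_def)
  obtain C where C: "C \<ge> 0" "\<And>n x. x \<in> U \<Longrightarrow> norm ((blinfun_apply H ^^ n) x) \<le> C * q ^ n * norm x"
    using H_pow_bound[OF nz q(3)] by blast
  note F_U = F_mem[OF nz]
  interpret contracting_flow H U "\<lambda>t. R (- 1) (e (1 - t))" q C
    by unfold_locales
      (use closed_U subspace_U H_mem R_mem q C subexponential_blinfun_apply e in
        \<open>auto simp: subexponential_reflect[of "\<lambda>t. R (- 1) (e t)"]\<close>)
  have sol: "sol x \<and> future_value H t0 x c \<longleftrightarrow>
    (\<forall>t. x (- t) \<in> U) \<and> (\<forall>t. x (- t) = R (- 1) (e (1 - t)) + H (x (- (t - 1)))) \<and>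
     (\<lambda>r. (blinfun_apply H ^^ nat (int r + - t0)) (x (- (- int r)))) \<longlonglongrightarrow> c" for x c
  proof -
    have U: "(\<forall>t. x t \<in> U) \<longleftrightarrow> (\<forall>t. x (- t) \<in> U)"
      using all_int_reflect[of "\<lambda>t. x t \<in> U" 0] by simp
    \<comment> \<open>The equation at time 1 - t determines x (- t) from x (1 - t).\<close>
    have "(\<forall>t. (B (x t) - \<zeta> *\<^sub>C A1 (x t)) + A1 (x (t - 1)) = e t) \<longleftrightarrow>
        (\<forall>t. x (- t) = R (- 1) (e (1 - t)) + H (x (- (t - 1))))" if "\<forall>t. x t \<in> U"
      using that backward_equation_iff[OF nz _ _ Qe]
        all_int_reflect[of "\<lambda>t. (B (x t) - \<zeta> *\<^sub>C A1 (x t)) + A1 (x (t - 1)) = e t" 1] by simp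
    then show ?thesis unfolding sol_def future_value_iff U[symmetric] minus_minus by blast
  qed
  have powi: "op_powi H (- (- t - t0)) c = (if t \<ge> - t0 then (blinfun_apply H ^^ nat (t - - t0)) c
      else (blinfun_apply (op_inv H) ^^ nat (- t0 - t)) c)" for t c
    by (auto simp: op_powi_def op_pow_apply algebra_simps)
  note flow = invertible_flow[of "op_inv H" _ "\<lambda>t. x (- t)" "- t0", OF H_F[OF nz] F_H[OF nz] F_U,
      folded sol powi]
  show "c \<in> U \<Longrightarrow> sol x \<and> future_value H t0 x c \<longleftrightarrow>
      (\<forall>t. x t = (\<Sum>\<^sub>\<infinity>k\<in>{1..}. backward_term Rf \<zeta> e t k) + op_powi H (- (t - t0)) c)"
    unfolding series(3) using flow(1)[of c] by (subst all_int_reflect[where a = 0]) simp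
  show "c \<in> U \<Longrightarrow> sol x \<and> future_value H t0 x c \<Longrightarrow> subexponential x \<longleftrightarrow> c = 0"
    using flow(2)[of c] subexponential_reflect[of x 0] by simp
qed

text \<open>The equations with t > t0 determine x forwards from \<open>x t0\<close>, those with t <=
  t0 determine x (t - 1) backwards. Each equation is used once, and the noise splits at
  \<open>t0\<close> accordingly.\<close>

lemma outward_flow:
  fixes t0 :: int
  assumes \<zeta>: "cmod \<zeta> = 1"
  defines "sol \<equiv> (\<lambda>x. (\<forall>t. x t \<in> U) \<and> (\<forall>t. (B (x t) - \<zeta> *\<^sub>C A1 (x t)) + A1 (x (t - 1)) = e t))"
    and "ep \<equiv> trunc_plus t0 e" and "em \<equiv> trunc_minus t0 e"
  shows "has_bounded_inverse H"
    and "forward_term Rf \<zeta> ep t summable_on {1..}"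
    and "backward_term Rf \<zeta> em t summable_on {1..}"
    and "c \<in> U \<Longrightarrow> sol x \<and> x t0 = c \<longleftrightarrow> x t0 = c \<and>
      (\<forall>t>t0. x t = (\<Sum>\<^sub>\<infinity>k\<in>{1..}. forward_term Rf \<zeta> ep t k) + op_powi H (- (t - t0)) c) \<and>
      (\<forall>t<t0. x t = (\<Sum>\<^sub>\<infinity>k\<in>{1..}. backward_term Rf \<zeta> em t k) + op_powi H (t0 - t) c)"
    and "c \<in> U \<Longrightarrow> sol x \<and> x t0 = c \<Longrightarrow> subexponential x"
proof -
  have nz: "\<zeta> \<noteq> 0" using \<zeta> by auto
  show "has_bounded_inverse H" using bounded_inverse_H[OF nz] by (auto simp: has_bounded_inverse_def)
  \<comment> \<open>Each truncated noise has only finitely many nonzero values in the direction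
    summed over, so any rate in (0, 1) is admissible.\<close>
  have s: "1 / 2 > (0::real)" "1 / 2 < cmod \<zeta>" "1 / 2 * cmod \<zeta> < 1" using \<zeta> by auto
  have "\<exists>M. \<forall>l. norm (ep (t - int l)) \<le> M * (1 / 2) ^ l" for t
    by (rule finite_support_geometric_bound[of "nat (t - t0)"]) (auto simp: ep_def trunc_plus_def)
  then have fseries: "forward_term Rf \<zeta> ep t summable_on {1..}"
    "infsum (forward_term Rf \<zeta> ep t) {1..} = flow_sum (op_inv H) (\<lambda>t. kernel (forward_weight \<zeta>) 0 (ep t)) t" for t
    using forward_term_summable[OF nz, of "Rf", OF Rf s(1,2)] forward_term_infsum[OF nz, of "Rf", OF Rf s(1,2)]
    by blast+
  have "\<exists>M. \<forall>l. norm (em (t + 1 + int l)) \<le> M * (1 / 2) ^ l" for t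
    by (rule finite_support_geometric_bound[of "nat (t0 - t)"]) (auto simp: em_def trunc_minus_def)
  then have bseries: "backward_term Rf \<zeta> em t summable_on {1..}"
    "infsum (backward_term Rf \<zeta> em t) {1..} = flow_sum H (\<lambda>t. R (- 1) (em (1 - t))) (- t)" for t
    using backward_term_summable[OF nz, of "Rf", OF Rf s(1,3)] backward_term_infsum[OF nz, of "Rf", OF Rf s(1,3)]
    by blast+
  show "forward_term Rf \<zeta> ep t summable_on {1..}" "backward_term Rf \<zeta> em t summable_on {1..}"
    by (rule fseries bseries)+
  have trunc: "subexponential ep" "subexponential em"
    using e by (auto simp: subexponential_def ep_def em_def trunc_plus_def trunc_minus_def
        intro: summable_on_comparison_test)
  interpret fwd: truncated_flow "op_inv H" U "\<lambda>t. kernel (forward_weight \<zeta>) 0 (ep t)" t0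
    by unfold_locales
      (use closed_U subspace_U F_mem[OF nz] kernel_mem[OF geometric_forward_weight[OF nz]]
        F_pow_bound[OF nz] \<zeta> subexponential_blinfun_apply[OF trunc(1)] in
        \<open>auto simp: ep_def trunc_plus_def blinfun.zero_right\<close>)
  have R_em: "subexponential (\<lambda>t. R (- 1) (em (1 - t)))"
    using subexponential_blinfun_apply[OF trunc(2)] subexponential_reflect[of "\<lambda>t. R (- 1) (em t)" 1] by simp
  interpret bwd: truncated_flow H U "\<lambda>t. R (- 1) (em (1 - t))" "- t0"
    by unfold_locales
      (use closed_U subspace_U H_mem R_mem H_pow_bound[OF nz] \<zeta> R_em in
        \<open>auto simp: em_def trunc_minus_def blinfun.zero_right\<close>)
  define xf where "xf c t = flow_sum (op_inv H) (\<lambda>t. kernel (forward_weight \<zeta>) 0 (ep t)) t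
      + (blinfun_apply (op_inv H) ^^ nat (t - t0)) c" for c t
  define xb where "xb c t = flow_sum H (\<lambda>t. R (- 1) (em (1 - t))) t + (blinfun_apply H ^^ nat (t - - t0)) c" for c t
  have xf: "(\<Sum>\<^sub>\<infinity>k\<in>{1..}. forward_term Rf \<zeta> ep t k) + op_powi H (- (t - t0)) c = xf c t" if "t > t0" for t c
    unfolding fseries(2) xf_def using that by (auto simp: op_powi_def op_pow_apply)
  have xb: "(\<Sum>\<^sub>\<infinity>k\<in>{1..}. backward_term Rf \<zeta> em t k) + op_powi H (t0 - t) c = xb c (- t)" if "t < t0" for t c
    unfolding bseries(2) xb_def using that by (auto simp: op_powi_def op_pow_apply)
  have iff: "sol x \<and> x t0 = c \<longleftrightarrow> x t0 = c \<and> (\<forall>t>t0. x t = xf c t) \<and> (\<forall>t<t0. x t = xb c (- t))"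
    if c: "c \<in> U" for c x
  proof -
    have f: "(\<forall>t>t0. x t = kernel (forward_weight \<zeta>) 0 (ep t) + op_inv H (x (t - 1)))
        \<longleftrightarrow> (\<forall>t>t0. x t = xf (x t0) t)"
      unfolding xf_def by (rule fwd.initial_value_iff)
    have b: "(\<forall>t>- t0. x (- t) = R (- 1) (em (1 - t)) + H (x (- (t - 1))))
        \<longleftrightarrow> (\<forall>t>- t0. x (- t) = xb (x t0) t)"
      unfolding xb_def using bwd.initial_value_iff[of "\<lambda>t. x (- t)"] by simp
    have b': "(\<forall>t>- t0. x (- t) = xb (x t0) t) \<longleftrightarrow> (\<forall>t<t0. x t = xb (x t0) (- t))"
      using all_int_reflect[of "\<lambda>t. t < t0 \<longrightarrow> x t = xb (x t0) (- t)" 0] by (simp add: minus_less_iff)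
    have eqs: "(\<forall>t. (B (x t) - \<zeta> *\<^sub>C A1 (x t)) + A1 (x (t - 1)) = e t) \<longleftrightarrow>
        (\<forall>t>t0. x t = xf (x t0) t) \<and> (\<forall>t<t0. x t = xb (x t0) (- t))" (is "(\<forall>t. ?E t) \<longleftrightarrow> _")
      if U: "\<forall>t. x t \<in> U"
    proof -
      have 1: "?E t \<longleftrightarrow> x t = kernel (forward_weight \<zeta>) 0 (ep t) + op_inv H (x (t - 1))" if "t > t0" for t
        using forward_equation_iff[OF nz _ _ Qe] U that by (simp add: ep_def trunc_plus_def)
      have 2: "?E (1 - t) \<longleftrightarrow> x (- t) = R (- 1) (em (1 - t)) + H (x (- (t - 1)))" if "t > - t0" for t
        using backward_equation_iff[OF nz _ _ Qe] U that by (simp add: em_def trunc_minus_def)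
      have "(\<forall>t. ?E t) \<longleftrightarrow> (\<forall>t>t0. ?E t) \<and> (\<forall>t\<le>t0. ?E t)" by (meson not_le)
      \<comment> \<open>The equation at t0 belongs to the backward half: it yields x (t0 - 1) and
        contains the noise at t0, which \<open>trunc_minus\<close> keeps.\<close>
      also have "(\<forall>t\<le>t0. ?E t) \<longleftrightarrow> (\<forall>t>- t0. ?E (1 - t))"
      proof -
        have "1 - t \<le> t0 \<longleftrightarrow> t > - t0" for t by auto
        then show ?thesis using all_int_reflect[of "\<lambda>t. t \<le> t0 \<longrightarrow> ?E t" 1] by simp
      qed
      finally show ?thesis using 1 2 f b b' by simp
    qed
    have "\<forall>t. x t \<in> U" if "x t0 = c" "\<forall>t>t0. x t = xf c t" "\<forall>t<t0. x t = xb c (- t)"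
    proof
      fix t
      have "xf c t \<in> U" "xb c (- t) \<in> U"
        unfolding xf_def xb_def
        by (intro subspace_add subspace_U fwd.flow_sum_mem bwd.flow_sum_mem fwd.pow_mem bwd.pow_mem c)+
      then show "x t \<in> U" using that c by (metis linorder_neqE)
    qed
    then show ?thesis using eqs unfolding sol_def by blast
  qed
  show "sol x \<and> x t0 = c \<longleftrightarrow> x t0 = c \<and>
      (\<forall>t>t0. x t = (\<Sum>\<^sub>\<infinity>k\<in>{1..}. forward_term Rf \<zeta> ep t k) + op_powi H (- (t - t0)) c) \<and>
      (\<forall>t<t0. x t = (\<Sum>\<^sub>\<infinity>k\<in>{1..}. backward_term Rf \<zeta> em t k) + op_powi H (t0 - t) c)" if "c \<in> U"
  proof -
    have "(\<forall>t>t0. x t = (\<Sum>\<^sub>\<infinity>k\<in>{1..}. forward_term Rf \<zeta> ep t k) + op_powi H (- (t - t0)) c)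
        \<longleftrightarrow> (\<forall>t>t0. x t = xf c t)"
      using xf by metis
    moreover have "(\<forall>t<t0. x t = (\<Sum>\<^sub>\<infinity>k\<in>{1..}. backward_term Rf \<zeta> em t k) + op_powi H (t0 - t) c)
        \<longleftrightarrow> (\<forall>t<t0. x t = xb c (- t))"
      using xb by metis
    ultimately show ?thesis using iff[OF that] by (simp only:)
  qed
  assume c: "c \<in> U" and x: "sol x \<and> x t0 = c"
  \<comment> \<open>At t0 the backward expression also gives c, since its flow sum vanishes
    there.\<close>
  have x_cases: "x t = xf c t \<or> x t = xb c (- t)" for t
    using iff[OF c, of x] x bwd.flow_sum_zero[of "- t0"] by (cases t t0 rule: linorder_cases) (auto simp: xb_def)
  have "subexponential (xf c)" "subexponential (xb c)"
    unfolding xf_def[abs_def] xb_def[abs_def]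
    by (intro fwd.initial_value_subexponential bwd.initial_value_subexponential c)+
  then have sub: "subexponential (xf c)" "subexponential (\<lambda>t. xb c (- t))"
    using subexponential_reflect[of "xb c" 0] by simp_all
  show "subexponential x"
    unfolding subexponential_iff
  proof (intro allI impI)
    fix s :: real
    assume s: "s > 1"
    obtain M where M: "M \<ge> 0" "\<And>t. norm (xf c t) \<le> M * s ^ nat \<bar>t\<bar>"
      using sub(1) s by (rule subexponential_bound) blast
    obtain M' where M': "M' \<ge> 0" "\<And>t. norm (xb c (- t)) \<le> M' * s ^ nat \<bar>t\<bar>"
      using sub(2) s by (rule subexponential_bound) blast
    have "norm (x t) \<le> (M + M') * s ^ nat \<bar>t\<bar>" for t
    proof -
      have "0 \<le> M * s ^ nat \<bar>t\<bar>" "0 \<le> M' * s ^ nat \<bar>t\<bar>" using M(1) M'(1) s by simp_all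
      then show ?thesis using x_cases[of t] M(2)[of t] M'(2)[of t] by (auto simp: distrib_right)
    qed
    then show "\<exists>M. \<forall>t. norm (x t) \<le> M * s ^ nat \<bar>t\<bar>" by blast
  qed
qed

end

end

section \<open>Algebraic cores and quasinilpotent flows\<close>

lemma backward_orbit_Suc: "backward_orbit G U c u \<Longrightarrow> G (u (Suc p)) = u p"
proof -
  assume "backward_orbit G U c u"
  then have "\<forall>p\<ge>1. u (p - 1) = G (u p)" by (simp add: backward_orbit_def)
  from this[rule_format, of "Suc p"] show "G (u (Suc p)) = u p" by simp
qed

lemma backward_orbitI:
  assumes "u 0 = c" "\<And>p. u p \<in> U" "\<And>p. u p = blinfun_apply G (u (Suc p))"
  shows "backward_orbit G U c u"
  unfolding backward_orbit_def
proof (intro conjI allI impI)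
  fix p :: nat
  assume "1 \<le> p"
  then show "u (p - 1) = G (u p)" using assms(3)[of "p - 1"] by simp
qed (use assms(1,2) in auto)

lemma backward_orbit_mem_core:
  assumes "backward_orbit G U c u"
  shows "u p \<in> algebraic_core G U"
proof -
  have "backward_orbit G U (u p) (\<lambda>i. u (p + i))"
    using assms backward_orbit_Suc[OF assms] by (intro backward_orbitI) (auto simp: backward_orbit_def)
  then show ?thesis by (auto simp: algebraic_core_def)
qed

text \<open>For one inclusion an orbit is prolonged by prepending the image of its first element,
  for the other it is shortened by dropping that element.\<close>

lemma image_core:
  assumes "\<And>x. x \<in> U \<Longrightarrow> blinfun_apply G x \<in> U"
  shows "blinfun_apply G ` algebraic_core G U = algebraic_core G U"
proof (intro equalityI subsetI)
  fix y assume "y \<in> blinfun_apply G ` algebraic_core G U"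
  then obtain c u where y: "y = G c" and u: "backward_orbit G U c u" by (auto simp: algebraic_core_def)
  have u0: "u 0 = c" using u by (simp add: backward_orbit_def)
  have "backward_orbit G U y (case_nat y u)"
    using u assms y u0 backward_orbit_Suc[OF u]
    by (intro backward_orbitI) (auto simp: backward_orbit_def split: nat.splits)
  then show "y \<in> algebraic_core G U" by (auto simp: algebraic_core_def)
next
  fix c assume "c \<in> algebraic_core G U"
  then obtain u where u: "backward_orbit G U c u" by (auto simp: algebraic_core_def)
  then have "c = G (u 1)" using backward_orbit_Suc[OF u, of 0] by (simp add: backward_orbit_def)
  then show "c \<in> blinfun_apply G ` algebraic_core G U" using backward_orbit_mem_core[OF u] by blast
qed

text \<open>All elements of the orbit lie in the core, where \<open>G\<close> is injective, so each
  one is forced by its predecessor.\<close>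

lemma backward_orbit_inv_into:
  assumes inj: "inj_on (blinfun_apply G) (algebraic_core G U)" and u: "backward_orbit G U c u"
  shows "u p = (inv_into (algebraic_core G U) (blinfun_apply G) ^^ p) c"
proof (induction p)
  case 0
  then show ?case using u by (simp add: backward_orbit_def)
next
  case (Suc p)
  have "u (Suc p) = inv_into (algebraic_core G U) (blinfun_apply G) (u p)"
    using inv_into_f_f[OF inj backward_orbit_mem_core[OF u, of "Suc p"]] backward_orbit_Suc[OF u, of p] by simp
  with Suc show ?case by simp
qed

text \<open>Two core elements with the same image have orbits whose difference starts in the kernel
  of \<open>G\<close>; delayed by one step, it can be added to any orbit without changing c.\<close>

lemma two_backward_orbits:
  assumes "subspace U" and ninj: "\<not> inj_on (blinfun_apply G) (algebraic_core G U)"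
    and u: "backward_orbit G U c u"
  obtains w where "backward_orbit G U c w" "w 1 \<noteq> u 1"
proof -
  obtain a b ua ub where ab: "a \<noteq> b" "G a = G b"
    and ua: "backward_orbit G U a ua" and ub: "backward_orbit G U b ub"
    using ninj by (auto simp: inj_on_def algebraic_core_def)
  define w where "w p = (case p of 0 \<Rightarrow> c | Suc p' \<Rightarrow> u p + (ua p' - ub p'))" for p
  have 0: "ua 0 = a" "ub 0 = b" "u 0 = c" using ua ub u by (auto simp: backward_orbit_def)
  have "backward_orbit G U c w"
  proof (rule backward_orbitI)
    show "w p \<in> U" for p
      using assms(1) ua ub u unfolding w_def backward_orbit_def
      by (cases p) (auto intro!: subspace_add subspace_diff)
    show "w p = G (w (Suc p))" for p
      using ab(2) 0 backward_orbit_Suc[OF ua] backward_orbit_Suc[OF ub] backward_orbit_Suc[OF u]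
      by (cases p) (auto simp: w_def blinfun.add_right blinfun.diff_right)
  qed (simp add: w_def)
  moreover have "w 1 \<noteq> u 1" using ab(1) 0 by (simp add: w_def)
  ultimately show thesis by (rule that)
qed

section \<open>Solutions parametrised by backward orbits\<close>

lemma past_value_inf_iff:
  "past_value_inf G t0 x c \<longleftrightarrow> (\<lambda>r. (blinfun_apply (- G) ^^ nat (int r + t0)) (x (- int r))) \<longlonglongrightarrow> c"
  unfolding past_value_inf_def
proof (intro tendsto_cong eventually_sequentiallyI)
  fix r assume "nat \<bar>t0\<bar> \<le> r"
  then have "int r + t0 \<ge> 0" by linarith
  then show "(- 1) powi (int r + t0) *\<^sub>R op_pow G (nat (int r + t0)) (x (- int r))
      = (blinfun_apply (- G) ^^ nat (int r + t0)) (x (- int r))"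
    by (simp add: power_int_def op_pow_apply blinfun_pow_uminus)
qed

lemma minus_one_powi: "(- 1 :: real) powi n = (- 1) ^ nat \<bar>n\<bar>"
  by (auto simp: power_int_def)

text \<open>Nilpotent in the weak sense only: on \<open>U\<close> the powers decay faster than every
  geometric sequence.\<close>

locale nilpotent_flow = flow_space "- G" U f
  for G :: "'x::complex_banach \<Rightarrow>\<^sub>L 'x" and U :: "'x set" and f :: "int \<Rightarrow> 'x" +
  assumes pow_bound: "\<delta> > 0 \<Longrightarrow> \<exists>C\<ge>0. \<forall>n. \<forall>x\<in>U. norm ((blinfun_apply (- G) ^^ n) x) \<le> C * \<delta> ^ n * norm x"
begin

abbreviation core :: "'x set" where "core \<equiv> algebraic_core G U"

lemma contracting: "\<exists>C. contracting_flow (- G) U f (1 / 2) C"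
proof -
  obtain C where "C \<ge> 0" "\<And>n x. x \<in> U \<Longrightarrow> norm ((blinfun_apply (- G) ^^ n) x) \<le> C * (1 / 2) ^ n * norm x"
    using pow_bound[of "1 / 2"] by auto
  then show ?thesis by (intro exI[of _ C]) (unfold_locales, auto)
qed

lemma G_mem: "x \<in> U \<Longrightarrow> G x \<in> U"
  using F_mem[of x] subspace_neg[OF subspace, of "(- G) x"] by (simp add: blinfun.minus_left)

definition is_flow :: "int \<Rightarrow> 'x \<Rightarrow> (int \<Rightarrow> 'x) \<Rightarrow> bool" where
  "is_flow t0 c x \<longleftrightarrow> (\<forall>t. x t \<in> U) \<and> (\<forall>t. x t = f t - G (x (t - 1))) \<and> past_value_inf G t0 x c"

text \<open>Before \<open>t0\<close> the orbit \<open>u\<close> takes the place of negative powers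
  of \<open>G\<close>, which may not exist.\<close>

definition orbit_flow :: "int \<Rightarrow> 'x \<Rightarrow> (nat \<Rightarrow> 'x) \<Rightarrow> int \<Rightarrow> 'x" where
  "orbit_flow t0 c u t = flow_sum (- G) f t + (- 1) powi (t - t0) *\<^sub>R
    (if t \<ge> t0 then (blinfun_apply G ^^ nat (t - t0)) c else u (nat (t0 - t)))"

lemma is_flow_free_flow:
  "is_flow t0 c x \<longleftrightarrow> (\<exists>y. (\<forall>t. y t \<in> U) \<and> (\<forall>t. y t = (- G) (y (t - 1))) \<and> y t0 = c \<and>
    (\<forall>t. x t = flow_sum (- G) f t + y t))"
proof -
  obtain C where "contracting_flow (- G) U f (1 / 2) C" using contracting by blast
  then interpret contracting_flow "- G" U f "1 / 2" C .
  show ?thesis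
    unfolding is_flow_def past_value_inf_iff flow_solution_iff[symmetric] by (simp add: blinfun.minus_left)
qed

text \<open>Read backwards from \<open>t0\<close>, the free part is a backward orbit of c up to
  alternating signs, and every such orbit occurs; after \<open>t0\<close> it is determined by
  c.\<close>

lemma is_flow_iff: "is_flow t0 c x \<longleftrightarrow> (\<exists>u. backward_orbit G U c u \<and> x = orbit_flow t0 c u)"
proof
    assume "is_flow t0 c x"
    then obtain y where y_mem: "\<forall>t. y t \<in> U" and y_rec: "\<forall>t. y t = (- G) (y (t - 1))"
      and y0: "y t0 = c" and x: "\<forall>t. x t = flow_sum (- G) f t + y t"
      unfolding is_flow_free_flow by (elim exE conjE) (rule that)
    \<comment> \<open>The sign turns y_t = - G y_(t-1) into u_p = G u_(p+1).\<close>
    define u where "u p = (- 1) ^ p *\<^sub>R y (t0 - int p)" for p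
    have "backward_orbit G U c u"
    proof (rule backward_orbitI)
      fix p
      show "u p \<in> U" unfolding u_def using y_mem subspace_scale[OF subspace] by blast
      have "y (t0 - int p) = (- G) (y (t0 - int p - 1))" using y_rec by blast
      then show "u p = G (u (Suc p))"
        by (simp add: u_def blinfun.minus_left blinfun.minus_right blinfun.scaleR_right diff_diff_eq add.commute)
    qed (simp add: u_def y0)
    moreover have "x t = orbit_flow t0 c u t" for t
    proof (cases "t \<ge> t0")
      case True
      have "(blinfun_apply (- G) ^^ nat (t - t0)) (y (t - int (nat (t - t0)))) = y t"
        by (rule free_flow_pow) (use y_rec in blast)
      then have "y t = (blinfun_apply (- G) ^^ nat (t - t0)) c" using True y0 by simp
      then show ?thesis
        using True x by (simp add: orbit_flow_def blinfun_pow_uminus minus_one_powi)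
    next
      case False
      then have "u (nat (t0 - t)) = (- 1) ^ nat (t0 - t) *\<^sub>R y t" by (simp add: u_def)
      then show ?thesis
        using False x by (simp add: orbit_flow_def minus_one_powi power_mult_distrib[symmetric])
    qed
    ultimately show "\<exists>u. backward_orbit G U c u \<and> x = orbit_flow t0 c u" by blast
  next
    assume "\<exists>u. backward_orbit G U c u \<and> x = orbit_flow t0 c u"
    then obtain u where u: "backward_orbit G U c u" and x: "x = orbit_flow t0 c u" by blast
    define y where "y t = (- 1) powi (t - t0) *\<^sub>R
      (if t \<ge> t0 then (blinfun_apply G ^^ nat (t - t0)) c else u (nat (t0 - t)))" for t
    have u0: "u 0 = c" and u_mem: "u p \<in> U" for p using u by (auto simp: backward_orbit_def)
    have G_pow_mem: "(blinfun_apply G ^^ n) c \<in> U" for n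
      by (induction n) (auto simp: G_mem u_mem[of 0, unfolded u0])
    have "y t \<in> U" for t
      unfolding y_def using u_mem G_pow_mem by (intro subspace_scale subspace) auto
    moreover have "y t = (- G) (y (t - 1))" for t
    proof (cases "t > t0")
      case True
      then have "nat (t - t0) = Suc (nat (t - 1 - t0))" by auto
      then show ?thesis using True
        by (simp add: y_def minus_one_powi blinfun.minus_left blinfun.scaleR_right)
    next
      case False
      then have n: "nat (t0 - (t - 1)) = Suc (nat (t0 - t))" by auto
      \<comment> \<open>Both branches of the definition give c at t0, so the orbit formula is valid
        there too.\<close>
      have y: "y s = (- 1) ^ nat (t0 - s) *\<^sub>R u (nat (t0 - s))" if "s \<le> t0" for s
        using that by (cases "s = t0") (auto simp: y_def minus_one_powi u0)
      show ?thesis using False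
        by (simp add: y n blinfun.minus_left blinfun.scaleR_right blinfun.minus_right backward_orbit_Suc[OF u])
    qed
    moreover have "y t0 = c" by (simp add: y_def)
    moreover have "x t = flow_sum (- G) f t + y t" for t by (simp add: x orbit_flow_def y_def)
    ultimately show "is_flow t0 c x" unfolding is_flow_free_flow by blast
qed

lemma is_flow_subexponential_zero:
  assumes "is_flow t0 c x" "subexponential x"
  shows "c = 0"
proof -
  obtain C where C: "contracting_flow (- G) U f (1 / 2) C" using contracting by blast
  have "\<exists>y. (\<forall>t. y t \<in> U) \<and> (\<forall>t. y t = (- G) (y (t - 1))) \<and> y t0 = c \<and>
      (\<forall>t. x t = flow_sum (- G) f t + y t)"
    using assms(1) by (rule is_flow_free_flow[THEN iffD1])
  then obtain y where y_mem: "\<forall>t. y t \<in> U" and y_rec: "\<forall>t. y t = (- G) (y (t - 1))"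
    and y0: "y t0 = c" and x: "\<forall>t. x t = flow_sum (- G) f t + y t"
    by (elim exE conjE) (rule that)
  have "x = (\<lambda>t. flow_sum (- G) f t + y t)" by (rule ext) (rule x[rule_format])
  with assms(2) have sub: "subexponential (\<lambda>t. flow_sum (- G) f t + y t)" by (rule subst[rotated])
  have "y t0 = 0"
    by (rule contracting_flow.subexponential_free_flow_zero[OF C y_mem[rule_format] _ sub])
      (rule y_rec[rule_format])
  then show ?thesis using y0 by simp
qed

lemma subexponential_part: "subexponential (flow_sum (- G) f)"
  using contracting contracting_flow.flow_sum_subexponential by blast

lemma part_summable: "(\<lambda>l. (blinfun_apply (- G) ^^ l) (f (t - int l))) summable_on UNIV"
  using contracting contracting_flow.flow_sum_summable by blast

lemma core_flow:
  assumes "c \<in> core"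
  shows "\<exists>x. is_flow t0 c x"
    and "is_flow t0 c x \<Longrightarrow> t \<ge> t0 \<Longrightarrow>
      x t = flow_sum (- G) f t + (- 1) powi (t - t0) *\<^sub>R op_pow G (nat (t - t0)) c"
  using assms unfolding is_flow_iff by (auto simp: algebraic_core_def orbit_flow_def op_pow_apply)

lemma injective_core_flow:
  assumes inj: "inj_on (blinfun_apply G) core" and c: "c \<in> core"
  shows "is_flow t0 c x \<longleftrightarrow>
      (\<forall>t. x t = flow_sum (- G) f t + (- 1) powi (t - t0) *\<^sub>R core_powi G U (t - t0) c)"
    and "is_flow t0 c x \<Longrightarrow> subexponential x \<longleftrightarrow> c = 0"
proof -
  have powi: "orbit_flow t0 c u t = flow_sum (- G) f t + (- 1) powi (t - t0) *\<^sub>R core_powi G U (t - t0) c"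
    if "backward_orbit G U c u" for u t
    by (auto simp: orbit_flow_def core_powi_def backward_orbit_inv_into[OF inj that])
  obtain u where u: "backward_orbit G U c u" using c by (auto simp: algebraic_core_def)
  show iff: "is_flow t0 c x \<longleftrightarrow>
      (\<forall>t. x t = flow_sum (- G) f t + (- 1) powi (t - t0) *\<^sub>R core_powi G U (t - t0) c)"
    unfolding is_flow_iff using u powi by (metis ext)
  assume flow: "is_flow t0 c x"
  show "subexponential x \<longleftrightarrow> c = 0"
  proof
    assume c0: "c = 0"
    \<comment> \<open>The zero orbit starts at c = 0, so by uniqueness the negative powers on the
      core vanish at 0.\<close>
    have "backward_orbit G U c (\<lambda>p. 0)"
      by (rule backward_orbitI) (simp_all add: c0 subspace_0[OF subspace] blinfun.zero_right)
    from powi[OF this] have "x t = orbit_flow t0 c (\<lambda>p. 0) t" for t using flow iff by metis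
    then have "x = flow_sum (- G) f" by (auto simp: orbit_flow_def c0)
    then show "subexponential x" using subexponential_part by simp
  qed (rule is_flow_subexponential_zero[OF flow])
qed

lemma noninjective_core_flow:
  assumes ninj: "\<not> inj_on (blinfun_apply G) core" and c: "c \<in> core"
  shows "\<exists>x x'. is_flow t0 c x \<and> is_flow t0 c x' \<and> (\<exists>t<t0. x t \<noteq> x' t)"
    and "is_flow t0 c x \<longleftrightarrow>
      (\<forall>t\<ge>t0. x t = flow_sum (- G) f t + (- 1) powi (t - t0) *\<^sub>R op_pow G (nat (t - t0)) c) \<and>
      (\<exists>u. backward_orbit G U c u \<and>
        (\<forall>t<t0. x t = flow_sum (- G) f t + (- 1) powi (t - t0) *\<^sub>R u (nat (t0 - t))))"
proof -
  obtain u where u: "backward_orbit G U c u" using c by (auto simp: algebraic_core_def)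
  obtain w where w: "backward_orbit G U c w" "w 1 \<noteq> u 1"
    using two_backward_orbits[OF subspace ninj u] by blast
  have "orbit_flow t0 c u (t0 - 1) \<noteq> orbit_flow t0 c w (t0 - 1)"
    using w(2) by (simp add: orbit_flow_def)
  then show "\<exists>x x'. is_flow t0 c x \<and> is_flow t0 c x' \<and> (\<exists>t<t0. x t \<noteq> x' t)"
    using u w(1) unfolding is_flow_iff
    by (intro exI[of _ "orbit_flow t0 c u"] exI[of _ "orbit_flow t0 c w"]) (auto intro!: exI[of _ "t0 - 1"])
  have "x = orbit_flow t0 c u \<longleftrightarrow>
      (\<forall>t\<ge>t0. x t = flow_sum (- G) f t + (- 1) powi (t - t0) *\<^sub>R op_pow G (nat (t - t0)) c) \<and>
      (\<forall>t<t0. x t = flow_sum (- G) f t + (- 1) powi (t - t0) *\<^sub>R u (nat (t0 - t)))" for u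
    unfolding fun_eq_iff orbit_flow_def op_pow_apply by (auto simp: not_le)
  then show "is_flow t0 c x \<longleftrightarrow>
      (\<forall>t\<ge>t0. x t = flow_sum (- G) f t + (- 1) powi (t - t0) *\<^sub>R op_pow G (nat (t - t0)) c) \<and>
      (\<exists>u. backward_orbit G U c u \<and>
        (\<forall>t<t0. x t = flow_sum (- G) f t + (- 1) powi (t - t0) *\<^sub>R u (nat (t0 - t))))"
    unfolding is_flow_iff by blast
qed

end

section \<open>Quasinilpotence and failure of invertibility\<close>

lemma quasinilpotentI:
  assumes "\<And>\<delta>. \<delta> > 0 \<Longrightarrow> \<exists>C\<ge>0. \<forall>n\<ge>1. norm (op_pow G n) \<le> C * \<delta> ^ n"
  shows "quasinilpotent G"
  unfolding quasinilpotent_def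
proof (rule tendstoI)
  fix \<epsilon> :: real
  assume \<epsilon>: "\<epsilon> > 0"
  \<comment> \<open>Half of \<epsilon> leaves room for the n-th root of the constant; C is later
    raised to C + 1, whose roots tend to 1 even if C = 0.\<close>
  then obtain C where C: "C \<ge> 0" "\<And>n. n \<ge> 1 \<Longrightarrow> norm (op_pow G n) \<le> C * (\<epsilon> / 2) ^ n"
    using assms[of "\<epsilon> / 2"] by auto
  have "(\<lambda>n. root n (C + 1) * (\<epsilon> / 2)) \<longlonglongrightarrow> 1 * (\<epsilon> / 2)"
    using C(1) by (intro tendsto_mult_right LIMSEQ_root_const) auto
  then have "\<forall>\<^sub>F n in sequentially. root n (C + 1) * (\<epsilon> / 2) < \<epsilon>"
    by (rule order_tendstoD(2)) (use \<epsilon> in simp)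
  then show "\<forall>\<^sub>F n in sequentially. dist (root n (norm (op_pow G n))) 0 < \<epsilon>"
    using eventually_ge_at_top[of 1]
  proof eventually_elim
    case (elim n)
    have "norm (op_pow G n) \<le> (C + 1) * (\<epsilon> / 2) ^ n"
      using C(2)[OF elim(2)] by (rule order_trans) (use \<epsilon> in \<open>simp add: mult_right_mono\<close>)
    then have "root n (norm (op_pow G n)) \<le> root n ((C + 1) * (\<epsilon> / 2) ^ n)"
      using elim(2) by (intro real_root_le_mono) auto
    also have "\<dots> = root n (C + 1) * (\<epsilon> / 2)"
      using elim(2) \<epsilon> by (simp add: real_root_mult real_root_power_cancel)
    finally show ?case using elim by (simp add: dist_real_def real_root_ge_zero)
  qed
qed

text \<open>An inverse S would satisfy S^n G^n z = z, but the powers of \<open>G\<close> decay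
  faster than those of S can grow.\<close>

lemma not_has_bounded_inverse_if_nilpotent:
  fixes G :: "'x::complex_banach \<Rightarrow>\<^sub>L 'x"
  assumes bound: "\<And>\<delta>. \<delta> > 0 \<Longrightarrow> \<exists>C\<ge>0. \<forall>n\<ge>1. norm (op_pow G n) \<le> C * \<delta> ^ n" and z: "(z::'x) \<noteq> 0"
  shows "\<not> has_bounded_inverse G"
proof
  assume "has_bounded_inverse G"
  then obtain S where S: "S o\<^sub>L G = id_blinfun" by (auto simp: has_bounded_inverse_def bounded_inverse_def)
  have SG: "S (G x) = x" for x
    using S by (metis blinfun_apply_blinfun_compose blinfun_apply_id_blinfun id_apply)
  \<comment> \<open>Positive in every case, so that 1 / (2 K) can be used as a decay rate.\<close>
  define K where "K = norm S + 1"
  have K: "K > 0" by (simp add: K_def add_nonneg_pos)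
  have S_pow: "norm ((blinfun_apply S ^^ n) x) \<le> K ^ n * norm x" for n x
  proof (induction n)
    case (Suc n)
    have "norm ((blinfun_apply S ^^ Suc n) x) \<le> K * norm ((blinfun_apply S ^^ n) x)"
      using norm_blinfun[of S "(blinfun_apply S ^^ n) x"] by (simp add: K_def distrib_right add_increasing2)
    also have "\<dots> \<le> K * (K ^ n * norm x)" using Suc K by (intro mult_left_mono) auto
    finally show ?case by simp
  qed simp
  have SG_pow: "(blinfun_apply S ^^ n) ((blinfun_apply G ^^ n) x) = x" for n x
    by (induction n arbitrary: x) (auto simp: SG funpow_swap1)
  obtain C where C: "C \<ge> 0" "\<And>n. n \<ge> 1 \<Longrightarrow> norm (op_pow G n) \<le> C * (1 / (2 * K)) ^ n"
    using bound[of "1 / (2 * K)"] K by auto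
  have "norm z \<le> C * norm z * (1 / 2) ^ n" if "n \<ge> 1" for n
  proof -
    have "norm z \<le> K ^ n * norm (op_pow G n z)"
      using S_pow[of n "(blinfun_apply G ^^ n) z"] by (simp add: SG_pow op_pow_apply)
    also have "\<dots> \<le> K ^ n * (C * (1 / (2 * K)) ^ n * norm z)"
      using K C(2)[OF that]
      by (intro mult_left_mono order_trans[OF norm_blinfun] mult_right_mono) auto
    also have "\<dots> = C * norm z * (1 / 2) ^ n" using K by (simp add: power_divide power_mult_distrib)
    finally show ?thesis .
  qed
  moreover have "(\<lambda>n. C * norm z * (1 / 2) ^ n) \<longlonglongrightarrow> 0"
    by (intro tendsto_mult_right_zero LIMSEQ_power_zero) auto
  ultimately have "norm z \<le> 0"
    by (intro LIMSEQ_le_const[of "\<lambda>n. C * norm z * (1 / 2) ^ n"]) auto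
  then show False using z by simp
qed

section \<open>The spectral points zero and infinity\<close>

text \<open>Serves both exceptional points: \<open>T n\<close> is R_(-1-n) at 0 and R_n at infinity,
  and in either case it is (-G)^n T_0.\<close>

context
  fixes G :: "'x::complex_banach \<Rightarrow>\<^sub>L 'x" and T :: "nat \<Rightarrow> 'y::complex_banach \<Rightarrow>\<^sub>L 'x"
  assumes G_T: "\<And>m y. G (T m y) = - T (Suc m) y"
    and T_decay: "\<And>\<delta>. \<delta> > 0 \<Longrightarrow> \<exists>M\<ge>0. \<forall>n. norm (T n) \<le> M * \<delta> ^ n"
begin

lemma uminus_pow_T: "(blinfun_apply (- G) ^^ l) (T m y) = T (m + l) y"
  by (induction l) (auto simp: blinfun.minus_left G_T)

text \<open>With V = A_1 at 0 and V = A_0 at infinity, the set in question is the range of the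
  projection; there the powers of - G on x are the decaying \<open>T n (V x)\<close>.\<close>

lemma uminus_pow_T_bound:
  assumes "\<delta> > 0"
  shows "\<exists>C\<ge>0. \<forall>n. \<forall>x\<in>{x. T 0 (blinfun_apply V x) = x}. norm ((blinfun_apply (- G) ^^ n) x) \<le> C * \<delta> ^ n * norm x"
proof -
  obtain M where M: "M \<ge> 0" "\<And>n. norm (T n) \<le> M * \<delta> ^ n" using T_decay[OF assms] by blast
  have "norm ((blinfun_apply (- G) ^^ n) x) \<le> (M * norm V) * \<delta> ^ n * norm x" if "T 0 (V x) = x" for n x
  proof -
    have "(blinfun_apply (- G) ^^ n) x = T n (V x)" using uminus_pow_T[of n 0 "V x"] that by simp
    also have "norm (T n (V x)) \<le> (M * \<delta> ^ n) * (norm V * norm x)"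
      using M assms by (intro order_trans[OF norm_blinfun] mult_mono norm_blinfun) auto
    finally show ?thesis by (simp add: mult_ac)
  qed
  then show ?thesis using M(1) by (intro exI[of _ "M * norm V"]) auto
qed

text \<open>On the whole space one factor \<open>G\<close> is spent on reaching the range of
  \<open>T 0\<close>; hence n >= 1 and the division by \<delta> in the constant.\<close>

lemma op_pow_T_bound:
  assumes W: "\<And>x. G x = T 0 (blinfun_apply W x)" and \<delta>: "\<delta> > 0"
  shows "\<exists>C\<ge>0. \<forall>n\<ge>1. norm (op_pow G n) \<le> C * \<delta> ^ n"
proof -
  obtain M where M: "M \<ge> 0" "\<And>n. norm (T n) \<le> M * \<delta> ^ n" using T_decay[OF \<delta>] by blast
  have "norm (op_pow G n) \<le> (M * norm W / \<delta>) * \<delta> ^ n" if n: "n \<ge> 1" for n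
  proof -
    obtain m where m: "n = Suc m" using n by (cases n) auto
    have "norm (op_pow G n x) \<le> (M * norm W * \<delta> ^ m) * norm x" for x
    proof -
      have "(blinfun_apply (- G) ^^ m) (G x) = T m (W x)" using uminus_pow_T[of m 0 "W x"] W by simp
      moreover have "norm ((blinfun_apply (- G) ^^ m) (G x)) = norm ((blinfun_apply G ^^ m) (G x))"
        unfolding blinfun_pow_uminus by simp
      moreover have "op_pow G n x = (blinfun_apply G ^^ m) (G x)"
        by (simp add: m op_pow_apply funpow_swap1)
      ultimately have "norm (op_pow G n x) = norm (T m (W x))" by simp
      also have "\<dots> \<le> (M * \<delta> ^ m) * (norm W * norm x)"
        using M \<delta> by (intro order_trans[OF norm_blinfun] mult_mono norm_blinfun) auto
      finally show ?thesis by (simp add: mult_ac)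
    qed
    then have "norm (op_pow G n) \<le> M * norm W * \<delta> ^ m"
      using M(1) \<delta> by (intro norm_blinfun_bound) auto
    then show ?thesis using \<delta> by (simp add: m)
  qed
  then show ?thesis using M(1) \<delta> by (intro exI[of _ "M * norm W / \<delta>"]) auto
qed

end

text \<open>The mirror image of a finite point: A_0 and A_1 exchange roles, and it is the
  nonnegative coefficients that decay, because the series converges for arbitrarily large
  |z|.\<close>

locale infinite_spectral_point = laurent_pencil A0 A1 R
  for A0 A1 :: "'x::complex_banach \<Rightarrow>\<^sub>L 'y::complex_banach" and R :: "int \<Rightarrow> 'y \<Rightarrow>\<^sub>L 'x" +
  assumes decay: "\<delta> > 0 \<Longrightarrow> \<exists>M\<ge>0. \<forall>n::nat. norm (R (int n)) \<le> M * \<delta> ^ n"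
begin

definition G :: "'x \<Rightarrow>\<^sub>L 'x" where "G = R 0 o\<^sub>L A1"

definition U :: "'x set" where "U = range (blinfun_apply (R 0 o\<^sub>L A0))"

lemma P_R: "R 0 (A0 (R (int n) y)) = R (int n) y"
  by (simp add: product_B)

lemma G_R: "G (R (int n) y) = - R (int (Suc n)) y"
  by (simp add: G_def product_A1 add.commute)

lemma U_eq: "U = {x. R (int 0) (A0 x) = x}"
proof (intro equalityI subsetI)
  fix x assume "x \<in> U"
  then obtain z where "x = R 0 (A0 z)" by (auto simp: U_def)
  then show "x \<in> {x. R (int 0) (A0 x) = x}" using P_R[of 0 "A0 z"] by simp
next
  fix x assume "x \<in> {x. R (int 0) (A0 x) = x}"
  then have "x = (R 0 o\<^sub>L A0) x" by simp
  then show "x \<in> U" unfolding U_def by blast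
qed

lemma closed_U: "closed U"
  unfolding U_eq by (intro closed_Collect_eq continuous_intros)

lemma subspace_U: "subspace U"
  unfolding subspace_def U_eq by (auto simp: blinfun.add_right blinfun.scaleR_right blinfun.zero_right)

lemma R_mem: "R (int n) y \<in> U"
  using P_R by (simp add: U_eq)

lemma projected_equation_iff:
  assumes x: "x \<in> U" and x': "x' \<in> U" and y: "A0 (R 0 y) = y"
  shows "A0 x + A1 x' = y \<longleftrightarrow> x = R 0 y - G x'"
proof
  assume "A0 x + A1 x' = y"
  then have "R 0 (A0 x) + R 0 (A1 x') = R 0 y" by (metis blinfun.add_right)
  then show "x = R 0 y - G x'" using x by (simp add: U_eq G_def algebra_simps)
next
  assume eq: "x = R 0 y - G x'"
  \<comment> \<open>On \<open>U\<close> this leads to A_0 G x' = A_1 x': the vector A_1 x' lies in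
    the range of A_0 R_0, so the reduced equation loses nothing.\<close>
  have "R 0 (A1 (R 0 (A0 x'))) = - R 1 (A0 x')" using G_R[of 0 "A0 x'"] by (simp add: G_def)
  then have "A0 (G x') = - A0 (R 1 (A0 x'))"
    using x' by (simp add: U_eq G_def blinfun.minus_right)
  also have "\<dots> = A1 (R 0 (A0 x'))"
    using right_resolvent_apply[of 1 "A0 x'"] by (simp add: neg_eq_iff_add_eq_0)
  also have "\<dots> = A1 x'" using x' by (simp add: U_eq)
  finally show "A0 x + A1 x' = y" using y by (simp add: eq blinfun.diff_right)
qed

lemma nilpotent_flow:
  assumes "subexponential e"
  shows "nilpotent_flow G U (\<lambda>t. R 0 (e t))"
proof
  show "closed U" "subspace U" by (rule closed_U subspace_U)+
  show "(- G) x \<in> U" for x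
    using subspace_neg[OF subspace_U R_mem[of 0 "A1 x"]] by (simp add: G_def blinfun.minus_left)
  show "R 0 (e t) \<in> U" for t using R_mem[of 0] by simp
  show "subexponential (\<lambda>t. R 0 (e t))" by (rule subexponential_blinfun_apply[OF assms])
  show "\<exists>C\<ge>0. \<forall>n. \<forall>x\<in>U. norm ((blinfun_apply (- G) ^^ n) x) \<le> C * \<delta> ^ n * norm x" if "\<delta> > 0" for \<delta>
    unfolding U_eq using uminus_pow_T_bound[of G "\<lambda>n. R (int n)", OF G_R decay that] .
qed

lemma part_term: "(blinfun_apply (- G) ^^ l) (R 0 y) = R (int l) y"
  using uminus_pow_T[of G "\<lambda>n. R (int n)" l 0 y, OF G_R decay] by simp

lemma op_pow_bound: "\<delta> > 0 \<Longrightarrow> \<exists>C\<ge>0. \<forall>n\<ge>1. norm (op_pow G n) \<le> C * \<delta> ^ n"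
  using op_pow_T_bound[of G "\<lambda>n. R (int n)" A1, OF G_R decay] by (simp add: G_def)

end

text \<open>At \<zeta> = 0 the operator \<open>H\<close> is - G, and the construction of the
  inverse, which divides by \<zeta>, does not apply.\<close>

locale zero_spectral_point = finite_spectral_point B A1 R 0
  for B A1 :: "'x::complex_banach \<Rightarrow>\<^sub>L 'y::complex_banach" and R :: "int \<Rightarrow> 'y \<Rightarrow>\<^sub>L 'x"
begin

definition G :: "'x \<Rightarrow>\<^sub>L 'x" where "G = R (- 1) o\<^sub>L B"

lemma G_S: "G (S k y) = - S (Suc k) y"
  by (simp only: G_def blinfun_apply_blinfun_compose N_S)

lemma zero_equation_iff:
  assumes "x \<in> U" "x' \<in> U" "A1 (R (- 1) y) = y"
  shows "B x + A1 x' = y \<longleftrightarrow> x' = R (- 1) y - G x"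
  using projected_equation_iff[OF assms(1,2), of y] assms(3)
  by (simp add: H_apply G_def scaleC.zero_left)

lemma nilpotent_flow:
  assumes "subexponential e"
  shows "nilpotent_flow G U (\<lambda>t. R (- 1) (e (1 - t)))"
proof
  show "closed U" "subspace U" by (rule closed_U subspace_U)+
  show "(- G) x \<in> U" for x
    using subspace_neg[OF subspace_U R_mem[of "B x"]] by (simp add: G_def blinfun.minus_left)
  show "R (- 1) (e (1 - t)) \<in> U" for t by (rule R_mem)
  show "subexponential (\<lambda>t. R (- 1) (e (1 - t)))"
    using subexponential_blinfun_apply[OF assms] subexponential_reflect[of "\<lambda>t. R (- 1) (e t)" 1] by simp
  have U_eq: "U = {x. S 0 (A1 x) = x}" using U_iff by auto
  show "\<exists>C\<ge>0. \<forall>n. \<forall>x\<in>U. norm ((blinfun_apply (- G) ^^ n) x) \<le> C * \<delta> ^ n * norm x" if "\<delta> > 0" for \<delta>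
    unfolding U_eq using uminus_pow_T_bound[of G S, OF G_S S_norm that] .
qed

lemma part_term: "(blinfun_apply (- G) ^^ l) (R (- 1) y) = S l y"
  using uminus_pow_T[of G S l 0 y, OF G_S S_norm] by simp

lemma op_pow_bound: "\<delta> > 0 \<Longrightarrow> \<exists>C\<ge>0. \<forall>n\<ge>1. norm (op_pow G n) \<le> C * \<delta> ^ n"
  using op_pow_T_bound[of G S B, OF G_S S_norm] by (simp add: G_def)

end

section \<open>Isolated spectral points\<close>

lemma has_bounded_inverse_op_inv: "has_bounded_inverse T \<Longrightarrow> bounded_inverse T (op_inv T)"
  using op_inv_eq by (auto simp: has_bounded_inverse_def)

lemma clinear_pencil:
  assumes "clinear_op A0" "clinear_op A1"
  shows "clinear_op (pencil A0 A1 z)"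
  using assms by (simp add: clinear_op_def pencil_def blinfun.add_left blinfun_apply_scaleC_aux
      scaleC.add_right scaleC_scaleC mult.commute)

context
  fixes A0 A1 :: "'x::complex_banach \<Rightarrow>\<^sub>L 'y::complex_banach"
    and R :: "complex option \<Rightarrow> int \<Rightarrow> ('y \<Rightarrow>\<^sub>L 'x)"
  assumes lin: "clinear_op A0" "clinear_op A1"
    and fin: "finite (spectral_set A0 A1)"
    and lin_R: "\<And>\<zeta> j. \<zeta> \<in> spectral_set A0 A1 \<Longrightarrow> clinear_op (R \<zeta> j)"
    and laurent: "\<And>\<zeta>. \<zeta> \<in> spectral_set A0 A1 \<Longrightarrow> laurent_series_at (resolvent A0 A1) \<zeta> (R \<zeta>)"
begin

lemma finite_singular: "finite {z. \<not> has_bounded_inverse (pencil A0 A1 z)}"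
  using fin by (simp add: spectral_set_def finite_image_iff)

lemma finite_spectral_pointI:
  assumes \<zeta>: "Some \<zeta> \<in> spectral_set A0 A1"
  shows "finite_spectral_point (pencil A0 A1 \<zeta>) A1 (R (Some \<zeta>))"
proof -
  define F where "F = {z. \<not> has_bounded_inverse (pencil A0 A1 z)}"
  have "open (- (F - {\<zeta>}))"
    using finite_singular unfolding F_def by (intro open_Compl finite_imp_closed finite_Diff)
  then have "\<forall>\<^sub>F z in nhds \<zeta>. z \<in> - (F - {\<zeta>})" by (rule eventually_nhds_in_open) simp
  then have "\<forall>\<^sub>F z in at \<zeta>. z \<notin> F"
    unfolding eventually_at_filter by (rule eventually_mono) auto
  moreover have "\<forall>\<^sub>F z in at \<zeta>. ((\<lambda>j. ((z - \<zeta>) powi j) *\<^sub>C R (Some \<zeta>) j) has_sum resolvent A0 A1 z) UNIV"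
    using laurent[OF \<zeta>] by simp
  ultimately have "\<forall>\<^sub>F z in at \<zeta>. z \<notin> F \<and>
      ((\<lambda>j. ((z - \<zeta>) powi j) *\<^sub>C R (Some \<zeta>) j) has_sum resolvent A0 A1 z) UNIV"
    by (rule eventually_conj)
  then obtain d where d: "d > 0" and near: "\<And>z. z \<noteq> \<zeta> \<Longrightarrow> dist z \<zeta> < d \<Longrightarrow>
      has_bounded_inverse (pencil A0 A1 z) \<and>
      ((\<lambda>j. ((z - \<zeta>) powi j) *\<^sub>C R (Some \<zeta>) j) has_sum resolvent A0 A1 z) UNIV"
    unfolding eventually_at F_def by auto
  have ann: "\<exists>S. bounded_inverse (pencil A0 A1 \<zeta> + w *\<^sub>C A1) S \<and>
      ((\<lambda>j. (w powi j) *\<^sub>C R (Some \<zeta>) j) has_sum S) UNIV" if "0 < cmod w" "cmod w < d" for w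
  proof -
    have "pencil A0 A1 \<zeta> + w *\<^sub>C A1 = pencil A0 A1 (\<zeta> + w)"
      by (simp add: pencil_def scaleC.add_left)
    then show ?thesis
      using near[of "\<zeta> + w"] that has_bounded_inverse_op_inv
      by (intro exI[of _ "resolvent A0 A1 (\<zeta> + w)"]) (auto simp: resolvent_def dist_norm)
  qed
  show ?thesis
  proof
    show "clinear_op (pencil A0 A1 \<zeta>)" "clinear_op A1" "clinear_op (R (Some \<zeta>) j)" for j
      using lin lin_R[OF \<zeta>] clinear_pencil by blast+
    show "\<exists>r1 r2. 0 \<le> r1 \<and> r1 < r2 \<and> (\<forall>w. r1 < cmod w \<and> cmod w < r2 \<longrightarrow>
      (\<exists>S. bounded_inverse (pencil A0 A1 \<zeta> + w *\<^sub>C A1) S \<and>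
        ((\<lambda>j. (w powi j) *\<^sub>C R (Some \<zeta>) j) has_sum S) UNIV))"
      using d ann by (intro exI[of _ 0] exI[of _ d]) auto
    fix \<delta> :: real
    assume \<delta>: "\<delta> > 0"
    \<comment> \<open>A radius inside the punctured disc and at most \<delta>; boundedness of the
      Laurent terms there gives the claimed decay.\<close>
    define \<rho> where "\<rho> = min \<delta> (d / 2)"
    have \<rho>: "0 < \<rho>" "\<rho> \<le> \<delta>" "\<rho> < d" using \<delta> d by (auto simp: \<rho>_def)
    obtain S where "((\<lambda>j. (of_real \<rho> powi j) *\<^sub>C R (Some \<zeta>) j) has_sum S) UNIV"
      using ann[of "of_real \<rho>"] \<rho> by auto
    from laurent_terms_bounded[OF has_sum_imp_summable[OF this]]
    obtain M where M: "M \<ge> 0" "\<And>j. \<rho> powi j * norm (R (Some \<zeta>) j) \<le> M" using \<rho> by auto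
    have "norm (R (Some \<zeta>) (- int k)) \<le> M * \<delta> ^ k" for k
    proof -
      have "norm (R (Some \<zeta>) (- int k)) \<le> M * \<rho> ^ k"
        using M(2)[of "- int k"] \<rho> by (simp add: power_int_minus field_simps)
      also have "\<dots> \<le> M * \<delta> ^ k" using M(1) \<rho> by (intro mult_left_mono power_mono) auto
      finally show ?thesis .
    qed
    then show "\<exists>M\<ge>0. \<forall>k. norm (R (Some \<zeta>) (- int k)) \<le> M * \<delta> ^ k" using M(1) by blast
  qed
qed

lemma infinite_spectral_pointI:
  assumes inf: "None \<in> spectral_set A0 A1"
  shows "infinite_spectral_point A0 A1 (R None)"
proof -
  obtain b0 where b0: "\<And>z. \<not> has_bounded_inverse (pencil A0 A1 z) \<Longrightarrow> norm z \<le> b0"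
    using finite_imp_bounded[OF finite_singular] by (auto simp: bounded_iff)
  have "\<forall>\<^sub>F z in at_infinity. ((\<lambda>j. (z powi j) *\<^sub>C R None j) has_sum resolvent A0 A1 z) UNIV"
    using laurent[OF inf] by simp
  then obtain b1 where b1: "\<And>z. b1 \<le> norm z \<Longrightarrow>
      ((\<lambda>j. (z powi j) *\<^sub>C R None j) has_sum resolvent A0 A1 z) UNIV"
    by (auto simp: eventually_at_infinity)
  \<comment> \<open>Past all singular points and inside the region where the series represents the
    resolvent.\<close>
  define r where "r = max 1 (max b0 b1)"
  have ann: "\<exists>S. bounded_inverse (A0 + w *\<^sub>C A1) S \<and>
      ((\<lambda>j. (w powi j) *\<^sub>C R None j) has_sum S) UNIV" if "r < cmod w" for w
  proof -
    have "has_bounded_inverse (pencil A0 A1 w)" using b0[of w] that by (auto simp: r_def)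
    then show ?thesis
      using b1[of w] that has_bounded_inverse_op_inv
      by (intro exI[of _ "resolvent A0 A1 w"]) (auto simp: resolvent_def pencil_def r_def)
  qed
  show ?thesis
  proof
    show "clinear_op A0" "clinear_op A1" "clinear_op (R None j)" for j
      using lin lin_R[OF inf] by blast+
    show "\<exists>r1 r2. 0 \<le> r1 \<and> r1 < r2 \<and> (\<forall>w. r1 < cmod w \<and> cmod w < r2 \<longrightarrow>
      (\<exists>S. bounded_inverse (A0 + w *\<^sub>C A1) S \<and> ((\<lambda>j. (w powi j) *\<^sub>C R None j) has_sum S) UNIV))"
      using ann by (intro exI[of _ r] exI[of _ "r + 1"]) (auto simp: r_def)
    fix \<delta> :: real
    assume \<delta>: "\<delta> > 0"
    \<comment> \<open>A radius in the region of convergence with 1 / \<rho> <= \<delta>.\<close>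
    define \<rho> where "\<rho> = max (r + 1) (1 / \<delta>)"
    have \<rho>: "0 < \<rho>" "1 / \<delta> \<le> \<rho>" "r < \<rho>" by (auto simp: \<rho>_def r_def)
    obtain S where "((\<lambda>j. (of_real \<rho> powi j) *\<^sub>C R None j) has_sum S) UNIV"
      using ann[of "of_real \<rho>"] \<rho> by auto
    from laurent_terms_bounded[OF has_sum_imp_summable[OF this]]
    obtain M where M: "M \<ge> 0" "\<And>j. \<rho> powi j * norm (R None j) \<le> M" using \<rho> by auto
    have "norm (R None (int n)) \<le> M * \<delta> ^ n" for n
    proof -
      have "norm (R None (int n)) \<le> M * (1 / \<rho>) ^ n"
        using M(2)[of "int n"] \<rho> by (simp add: power_divide field_simps)
      also have "\<dots> \<le> M * \<delta> ^ n"
        using M(1) \<rho> \<delta> by (intro mult_left_mono power_mono) (auto simp: field_simps)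
      finally show ?thesis .
    qed
    then show "\<exists>M\<ge>0. \<forall>n. norm (R None (int n)) \<le> M * \<delta> ^ n" using M(1) by blast
  qed
qed

end

lemma all_ge_uminus: "(\<forall>s\<ge>- a. P s) \<longleftrightarrow> (\<forall>t\<le>a. P (- t))"
  for a :: int
proof (intro iffI allI impI)
  fix s assume "\<forall>t\<le>a. P (- t)" "s \<ge> - a"
  then show "P s" by (auto dest: spec[of _ "- s"])
qed simp

lemma all_less_uminus: "(\<forall>s < - a. P s) \<longleftrightarrow> (\<forall>t>a. P (- t))"
  for a :: int
proof (intro iffI allI impI)
  fix s assume "\<forall>t>a. P (- t)" "s < - a"
  then show "P s" by (auto dest: spec[of _ "- s"])
qed simp

theorem theorem1:
  fixes A0 A1 :: "'x::complex_banach \<Rightarrow>\<^sub>L 'y::complex_banach"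
    and R :: "complex option \<Rightarrow> int \<Rightarrow> ('y \<Rightarrow>\<^sub>L 'x)"
    and \<epsilon> :: "int \<Rightarrow> 'y"
    and t0 :: int
  assumes "clinear_op A0" and "clinear_op A1" and "A0 \<noteq> 0" and "A1 \<noteq> 0"
    and "spectral_set A0 A1 \<noteq> {}" and "finite (spectral_set A0 A1)"
    and "\<And>\<zeta>. \<zeta> \<notin> spectral_set A0 A1 \<Longrightarrow> vector_analytic_at (resolvent A0 A1) \<zeta>"
    and "\<And>\<zeta> j. \<zeta> \<in> spectral_set A0 A1 \<Longrightarrow> clinear_op (R \<zeta> j)"
    and "\<And>\<zeta>. \<zeta> \<in> spectral_set A0 A1 \<Longrightarrow> laurent_series_at (resolvent A0 A1) \<zeta> (R \<zeta>)"
    and "subexponential \<epsilon>"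
  shows
    "\<comment> \<open>(i)\<close>
    (\<forall>\<zeta>. Some \<zeta> \<in> spectral_set A0 A1 \<and> 1 < cmod \<zeta> \<longrightarrow>
       (let H = opH A0 A1 R \<zeta>; X\<zeta> = spaceX A0 A1 R (Some \<zeta>); e = proj_noise A0 A1 R \<epsilon> (Some \<zeta>);
            sol = proj_solution A0 A1 R \<epsilon> (Some \<zeta>)
        in has_bounded_inverse H \<and>
           (\<forall>k\<ge>1. \<forall>t. nabla_term \<zeta> k e t summable_on UNIV) \<and>
           (\<forall>t. forward_term R \<zeta> e t summable_on {1..}) \<and>
           (\<forall>c\<in>X\<zeta>. \<forall>x.
              (sol x \<and> past_value H t0 x c \<longleftrightarrow>
                 (\<forall>t. x t = (\<Sum>\<^sub>\<infinity>k\<in>{1..}. forward_term R \<zeta> e t k)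
                        + blinfun_apply (op_powi H (- (t - t0))) c)) \<and>
              (sol x \<and> past_value H t0 x c \<longrightarrow> (subexponential x \<longleftrightarrow> c = 0)))))
    \<and> \<comment> \<open>(ii)\<close> (\<forall>\<zeta>. Some \<zeta> \<in> spectral_set A0 A1 \<and> 0 < cmod \<zeta> \<and> cmod \<zeta> < 1 \<longrightarrow>
       (let H = opH A0 A1 R \<zeta>; X\<zeta> = spaceX A0 A1 R (Some \<zeta>); e = proj_noise A0 A1 R \<epsilon> (Some \<zeta>);
            sol = proj_solution A0 A1 R \<epsilon> (Some \<zeta>)
        in has_bounded_inverse H \<and>
           (\<forall>k\<ge>1. \<forall>t. delta_term \<zeta> k e t summable_on UNIV) \<and>
           (\<forall>t. backward_term R \<zeta> e t summable_on {1..}) \<and>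
           (\<forall>c\<in>X\<zeta>. \<forall>x.
              (sol x \<and> future_value H t0 x c \<longleftrightarrow>
                 (\<forall>t. x t = (\<Sum>\<^sub>\<infinity>k\<in>{1..}. backward_term R \<zeta> e t k)
                        + blinfun_apply (op_powi H (- (t - t0))) c)) \<and>
              (sol x \<and> future_value H t0 x c \<longrightarrow> (subexponential x \<longleftrightarrow> c = 0)))))
    \<and> \<comment> \<open>(iii)\<close> (\<forall>\<zeta>. Some \<zeta> \<in> spectral_set A0 A1 \<and> cmod \<zeta> = 1 \<longrightarrow>
       (let H = opH A0 A1 R \<zeta>; X\<zeta> = spaceX A0 A1 R (Some \<zeta>); e = proj_noise A0 A1 R \<epsilon> (Some \<zeta>);
            ep = trunc_plus t0 e; em = trunc_minus t0 e;
            sol = proj_solution A0 A1 R \<epsilon> (Some \<zeta>)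
        in has_bounded_inverse H \<and>
           (\<forall>t>t0. forward_term R \<zeta> ep t summable_on {1..}) \<and>
           (\<forall>t<t0. backward_term R \<zeta> em t summable_on {1..}) \<and>
           (\<forall>c\<in>X\<zeta>. \<forall>x.
              (sol x \<and> x t0 = c \<longleftrightarrow>
                 x t0 = c \<and>
                 (\<forall>t>t0. x t = (\<Sum>\<^sub>\<infinity>k\<in>{1..}. forward_term R \<zeta> ep t k)
                        + blinfun_apply (op_powi H (- (t - t0))) c) \<and>
                 (\<forall>t<t0. x t = (\<Sum>\<^sub>\<infinity>k\<in>{1..}. backward_term R \<zeta> em t k)
                        + blinfun_apply (op_powi H (t0 - t)) c)) \<and>
              (sol x \<and> x t0 = c \<longrightarrow> subexponential x)) \<and>
           (\<forall>k\<ge>1. \<forall>t. t < t0 \<longrightarrow> nabla_npow \<zeta> k ep t = 0) \<and>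
           (\<forall>k\<ge>1. \<forall>t. t + int k > t0 \<longrightarrow> delta_npow \<zeta> k em (t + int k) = 0)))
    \<and> \<comment> \<open>(iv)\<close> (None \<in> spectral_set A0 A1 \<longrightarrow>
       (let G = opGinf A1 R; Xinf = spaceX A0 A1 R None; e = proj_noise A0 A1 R \<epsilon> None;
            core = algebraic_core G Xinf; sol = proj_solution A0 A1 R \<epsilon> None;
            part = (\<lambda>t. \<Sum>\<^sub>\<infinity>l::nat. blinfun_apply (R None (int l)) (e (t - int l)))
        in (\<forall>x. (\<forall>t. x t \<in> Xinf) \<longrightarrow>
              (sol x \<longleftrightarrow>
                 (\<forall>t. x t = blinfun_apply (R None 0) (e t) - blinfun_apply G (x (t - 1))))) \<and>
           (\<forall>t. (\<lambda>l::nat. blinfun_apply (R None (int l)) (e (t - int l))) summable_on UNIV) \<and>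
           (\<forall>c\<in>core.
              (\<exists>x. sol x \<and> past_value_inf G t0 x c) \<and>
              (\<forall>x. sol x \<and> past_value_inf G t0 x c \<longrightarrow>
                 (\<forall>t\<ge>t0. x t = part t
                    + ((-1) powi (t - t0)) *\<^sub>R blinfun_apply (op_pow G (nat (t - t0))) c))) \<and>
           (inj_on (blinfun_apply G) core \<longrightarrow>
              bij_betw (blinfun_apply G) core core \<and>
              (\<forall>c\<in>core. \<forall>x.
                 (sol x \<and> past_value_inf G t0 x c \<longleftrightarrow>
                    (\<forall>t. x t = part t + ((-1) powi (t - t0)) *\<^sub>R core_powi G Xinf (t - t0) c)) \<and>
                 (sol x \<and> past_value_inf G t0 x c \<longrightarrow> (subexponential x \<longleftrightarrow> c = 0)))) \<and>
           (\<not> inj_on (blinfun_apply G) core \<longrightarrow>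
              (\<forall>c\<in>core.
                 (\<exists>x x'. sol x \<and> past_value_inf G t0 x c \<and> sol x' \<and> past_value_inf G t0 x' c \<and>
                    (\<exists>t<t0. x t \<noteq> x' t)) \<and>
                 (\<forall>x. sol x \<and> past_value_inf G t0 x c \<longleftrightarrow>
                    (\<forall>t\<ge>t0. x t = part t
                       + ((-1) powi (t - t0)) *\<^sub>R blinfun_apply (op_pow G (nat (t - t0))) c) \<and>
                    (\<exists>u. backward_orbit G Xinf c u \<and>
                       (\<forall>t<t0. x t = part t + ((-1) powi (t - t0)) *\<^sub>R u (nat (t0 - t))))))) \<and>
           quasinilpotent G \<and> \<not> has_bounded_inverse G))
    \<and> \<comment> \<open>(v)\<close> (Some 0 \<in> spectral_set A0 A1 \<longrightarrow>
       (let G = opG0 A0 R; X0 = spaceX A0 A1 R (Some 0); e = proj_noise A0 A1 R \<epsilon> (Some 0);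
            core = algebraic_core G X0; sol = proj_solution A0 A1 R \<epsilon> (Some 0);
            part = (\<lambda>t. \<Sum>\<^sub>\<infinity>k\<in>{1::nat..}. blinfun_apply (R (Some 0) (- int k)) (e (t + int k)))
        in (\<forall>x. (\<forall>t. x t \<in> X0) \<longrightarrow>
              (sol x \<longleftrightarrow>
                 (\<forall>t. x t = blinfun_apply (R (Some 0) (-1)) (e (t + 1))
                        - blinfun_apply G (x (t + 1))))) \<and>
           (\<forall>t. (\<lambda>k::nat. blinfun_apply (R (Some 0) (- int k)) (e (t + int k)))
                  summable_on {1..}) \<and>
           (\<forall>c\<in>core.
              (\<exists>x. sol x \<and> future_value_zero G t0 x c) \<and>
              (\<forall>x. sol x \<and> future_value_zero G t0 x c \<longrightarrow>
                 (\<forall>t\<le>t0. x t = part t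
                    + ((-1) powi (t0 - t)) *\<^sub>R blinfun_apply (op_pow G (nat (t0 - t))) c))) \<and>
           (inj_on (blinfun_apply G) core \<longrightarrow>
              bij_betw (blinfun_apply G) core core \<and>
              (\<forall>c\<in>core. \<forall>x.
                 (sol x \<and> future_value_zero G t0 x c \<longleftrightarrow>
                    (\<forall>t. x t = part t + ((-1) powi (t0 - t)) *\<^sub>R core_powi G X0 (t0 - t) c)) \<and>
                 (sol x \<and> future_value_zero G t0 x c \<longrightarrow> (subexponential x \<longleftrightarrow> c = 0)))) \<and>
           (\<not> inj_on (blinfun_apply G) core \<longrightarrow>
              (\<forall>c\<in>core.
                 (\<exists>x x'. sol x \<and> future_value_zero G t0 x c \<and>
                    sol x' \<and> future_value_zero G t0 x' c \<and> (\<exists>t>t0. x t \<noteq> x' t)) \<and>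
                 (\<forall>x. sol x \<and> future_value_zero G t0 x c \<longleftrightarrow>
                    (\<forall>t\<le>t0. x t = part t
                       + ((-1) powi (t0 - t)) *\<^sub>R blinfun_apply (op_pow G (nat (t0 - t))) c) \<and>
                    (\<exists>u. backward_orbit G X0 c u \<and>
                       (\<forall>t>t0. x t = part t + ((-1) powi (t - t0)) *\<^sub>R u (nat (t - t0))))))) \<and>
           quasinilpotent G \<and> \<not> has_bounded_inverse G))"
proof -
  note fin = assms(6) and lin_R = assms(8) and laurent = assms(9) and sub = assms(10)
  note finite_pointI = finite_spectral_pointI[OF assms(1,2) fin lin_R laurent]
  note infinite_pointI = infinite_spectral_pointI[OF assms(1,2) fin lin_R laurent]
  have pencil: "A0 x = pencil A0 A1 \<zeta> x - \<zeta> *\<^sub>C A1 x" for \<zeta> x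
    by (simp add: pencil_def blinfun.add_left blinfun_apply_scaleC_aux)
  have noise: "subexponential (proj_noise A0 A1 R \<epsilon> \<zeta>)" for \<zeta>
    unfolding proj_noise_def[abs_def] by (rule subexponential_blinfun_apply[OF sub])
  \<comment> \<open>A nonzero A_0 forces X to be nontrivial; on the zero space even the zero
    operator would be invertible.\<close>
  have nz: "\<exists>z::'x. z \<noteq> 0"
  proof -
    obtain z where "A0 z \<noteq> A0 0"
      using \<open>A0 \<noteq> 0\<close> by (metis blinfun.zero_left blinfun.zero_right blinfun_eqI)
    then show ?thesis by metis
  qed
  show ?thesis
  proof (intro conjI allI impI, goal_cases)
    case (1 \<zeta>)
    then interpret finite_spectral_point "pencil A0 A1 \<zeta>" A1 "R (Some \<zeta>)" \<zeta> by (intro finite_pointI) auto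
    have eqs: "opH A0 A1 R \<zeta> = H" "spaceX A0 A1 R (Some \<zeta>) = U"
      by (simp_all add: opH_def H_def spaceX_def U_def)
    \<comment> \<open>The projection onto the noise space is idempotent, so it fixes the projected
      noise.\<close>
    have Q: "A1 (R (Some \<zeta>) (- 1) (proj_noise A0 A1 R \<epsilon> (Some \<zeta>) t)) = proj_noise A0 A1 R \<epsilon> (Some \<zeta>) t" for t
      using P_S[of 0 "\<epsilon> t"] by (simp add: proj_noise_def)
    have sol: "proj_solution A0 A1 R \<epsilon> (Some \<zeta>) x \<longleftrightarrow> (\<forall>t. x t \<in> U) \<and>
        (\<forall>t. A0 (x t) + A1 (x (t - 1)) = proj_noise A0 A1 R \<epsilon> (Some \<zeta>) t)" for x
      by (simp add: proj_solution_def eqs)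
    note flow = forward_flow(1-3)[where Rf = R, OF refl noise Q conjunct2[OF 1]]
      forward_flow(4,5)[where Rf = R and ?t0.0 = t0, OF refl noise Q conjunct2[OF 1], folded pencil, folded sol]
    show ?case
      unfolding Let_def eqs by (intro conjI allI impI ballI flow) blast+
  next
    case (2 \<zeta>)
    then interpret finite_spectral_point "pencil A0 A1 \<zeta>" A1 "R (Some \<zeta>)" \<zeta> by (intro finite_pointI) auto
    have eqs: "opH A0 A1 R \<zeta> = H" "spaceX A0 A1 R (Some \<zeta>) = U"
      by (simp_all add: opH_def H_def spaceX_def U_def)
    have Q: "A1 (R (Some \<zeta>) (- 1) (proj_noise A0 A1 R \<epsilon> (Some \<zeta>) t)) = proj_noise A0 A1 R \<epsilon> (Some \<zeta>) t" for t
      using P_S[of 0 "\<epsilon> t"] by (simp add: proj_noise_def)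
    have sol: "proj_solution A0 A1 R \<epsilon> (Some \<zeta>) x \<longleftrightarrow> (\<forall>t. x t \<in> U) \<and>
        (\<forall>t. A0 (x t) + A1 (x (t - 1)) = proj_noise A0 A1 R \<epsilon> (Some \<zeta>) t)" for x
      by (simp add: proj_solution_def eqs)
    note mod = conjunct1[OF conjunct2[OF 2]] conjunct2[OF conjunct2[OF 2]]
    note flow = backward_flow(1-3)[where Rf = R, OF refl noise Q mod]
      backward_flow(4,5)[where Rf = R and ?t0.0 = t0, OF refl noise Q mod, folded pencil, folded sol]
    show ?case
      unfolding Let_def eqs by (intro conjI allI impI ballI flow) blast+
  next
    case (3 \<zeta>)
    then interpret finite_spectral_point "pencil A0 A1 \<zeta>" A1 "R (Some \<zeta>)" \<zeta> by (intro finite_pointI) auto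
    have eqs: "opH A0 A1 R \<zeta> = H" "spaceX A0 A1 R (Some \<zeta>) = U"
      by (simp_all add: opH_def H_def spaceX_def U_def)
    have Q: "A1 (R (Some \<zeta>) (- 1) (proj_noise A0 A1 R \<epsilon> (Some \<zeta>) t)) = proj_noise A0 A1 R \<epsilon> (Some \<zeta>) t" for t
      using P_S[of 0 "\<epsilon> t"] by (simp add: proj_noise_def)
    have sol: "proj_solution A0 A1 R \<epsilon> (Some \<zeta>) x \<longleftrightarrow> (\<forall>t. x t \<in> U) \<and>
        (\<forall>t. A0 (x t) + A1 (x (t - 1)) = proj_noise A0 A1 R \<epsilon> (Some \<zeta>) t)" for x
      by (simp add: proj_solution_def eqs)
    note flow = outward_flow(1)[where Rf = R, OF refl noise Q conjunct2[OF 3]]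
      outward_flow(2-5)[where Rf = R and ?t0.0 = t0, OF refl noise Q conjunct2[OF 3], folded pencil, folded sol]
    have nabla: "nabla_npow \<zeta> k (trunc_plus t0 e) t = 0" if "t < t0" for k t and e :: "int \<Rightarrow> 'y"
      unfolding nabla_npow_def using that
      by (intro infsum_0) (simp add: nabla_term_def trunc_plus_def scaleC.zero_right)
    have delta: "delta_npow \<zeta> k (trunc_minus t0 e) t = 0" if "t > t0" for k t and e :: "int \<Rightarrow> 'y"
    proof -
      have "(\<Sum>\<^sub>\<infinity>r. delta_term \<zeta> k (trunc_minus t0 e) t r) = 0"
        using that by (intro infsum_0) (simp add: delta_term_def trunc_minus_def scaleC.zero_right)
      then show ?thesis by (simp add: delta_npow_def)
    qed
    show ?case
      unfolding Let_def eqs by (intro conjI allI impI ballI flow nabla delta) blast+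
  next
    case 4
    then interpret infinite_spectral_point A0 A1 "R None" by (intro infinite_pointI) auto
    define e where "e = proj_noise A0 A1 R \<epsilon> None"
    have Q: "A0 (R None 0 (e t)) = e t" for t
      using P_R[of 0 "\<epsilon> t"] by (simp add: e_def proj_noise_def)
    interpret flow: nilpotent_flow G U "\<lambda>t. R None 0 (e t)"
      unfolding e_def by (rule nilpotent_flow[OF noise])
    have eqs: "opGinf A1 R = G" "spaceX A0 A1 R None = U"
      by (simp_all add: opGinf_def G_def spaceX_def U_def)
    have sol: "proj_solution A0 A1 R \<epsilon> None x \<longleftrightarrow>
        (\<forall>t. x t \<in> U) \<and> (\<forall>t. x t = R None 0 (e t) - G (x (t - 1)))" for x
      unfolding proj_solution_def eqs e_def[symmetric] using projected_equation_iff[OF _ _ Q] by blast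
    have part: "(\<Sum>\<^sub>\<infinity>l. R None (int l) (e (t - int l))) = flow_sum (- G) (\<lambda>t. R None 0 (e t)) t" for t
      by (simp add: flow_sum_def part_term)
    have flow: "proj_solution A0 A1 R \<epsilon> None x \<and> past_value_inf G t0 x c \<longleftrightarrow> flow.is_flow t0 c x" for x c
      unfolding sol flow.is_flow_def by blast
    have summable: "(\<lambda>l. R None (int l) (e (t - int l))) summable_on UNIV" for t
      using flow.part_summable[of t] by (simp add: part_term)
    have bij: "inj_on (blinfun_apply G) flow.core \<Longrightarrow> bij_betw (blinfun_apply G) flow.core flow.core"
      using image_core[of U G] flow.G_mem by (auto simp: bij_betw_def)
    obtain z :: 'x where z: "z \<noteq> 0" using nz by blast
    have two: "\<exists>x x'. proj_solution A0 A1 R \<epsilon> None x \<and> past_value_inf G t0 x c \<and>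
        proj_solution A0 A1 R \<epsilon> None x' \<and> past_value_inf G t0 x' c \<and> (\<exists>t<t0. x t \<noteq> x' t)"
      if "\<not> inj_on (blinfun_apply G) flow.core" "c \<in> flow.core" for c
      using flow.noninjective_core_flow(1)[OF that, of t0] unfolding flow[symmetric] by blast
    note flows = flow.core_flow[of _ t0, folded flow] flow.injective_core_flow[of _ t0, folded flow]
      flow.noninjective_core_flow(2)[of _ t0, folded flow]
    have rec: "proj_solution A0 A1 R \<epsilon> None x \<longleftrightarrow> (\<forall>t. x t = R None 0 (e t) - G (x (t - 1)))"
      if "\<forall>t. x t \<in> U" for x
      unfolding sol using that by blast
    show ?case
      unfolding Let_def eqs e_def[symmetric] part
      by (intro conjI allI impI ballI rec summable bij two flows
            quasinilpotentI[of G] not_has_bounded_inverse_if_nilpotent[of G, OF _ z] op_pow_bound)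
        blast+
  next
    case 5
    then have "finite_spectral_point (pencil A0 A1 0) A1 (R (Some 0))" by (intro finite_pointI) auto
    moreover have "pencil A0 A1 0 = A0" by (simp add: pencil_def scaleC.zero_left)
    ultimately interpret zero_spectral_point A0 A1 "R (Some 0)" by (simp add: zero_spectral_point_def)
    define e where "e = proj_noise A0 A1 R \<epsilon> (Some 0)"
    have Q: "A1 (R (Some 0) (- 1) (e t)) = e t" for t
      using P_S[of 0 "\<epsilon> t"] by (simp add: e_def proj_noise_def)
    interpret flow: nilpotent_flow G U "\<lambda>t. R (Some 0) (- 1) (e (1 - t))"
      unfolding e_def by (rule nilpotent_flow[OF noise])
    have eqs: "opG0 A0 R = G" "spaceX A0 A1 R (Some 0) = U"
      by (simp_all add: opG0_def G_def spaceX_def U_def)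
    have sol: "proj_solution A0 A1 R \<epsilon> (Some 0) x \<longleftrightarrow>
        (\<forall>t. x t \<in> U) \<and> (\<forall>t. x t = R (Some 0) (- 1) (e (t + 1)) - G (x (t + 1)))" for x
    proof -
      have "(\<forall>t. A0 (x t) + A1 (x (t - 1)) = e t) \<longleftrightarrow>
          (\<forall>t. x (t - 1) = R (Some 0) (- 1) (e t) - G (x t))" if "\<forall>t. x t \<in> U"
        using that zero_equation_iff[OF _ _ Q] by simp
      also have "(\<forall>t. x (t - 1) = R (Some 0) (- 1) (e t) - G (x t)) \<longleftrightarrow>
          (\<forall>t. x t = R (Some 0) (- 1) (e (t + 1)) - G (x (t + 1)))"
        by (metis add_diff_cancel diff_add_cancel)
      finally show ?thesis unfolding proj_solution_def eqs e_def[symmetric] by blast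
    qed
    \<comment> \<open>Reversing time sends t0 to - t0 and a boundary value in the far future to one
      in the far past.\<close>
    have flow: "proj_solution A0 A1 R \<epsilon> (Some 0) x \<and> future_value_zero G t0 x c \<longleftrightarrow>
        flow.is_flow (- t0) c (\<lambda>s. x (- s))" for x c
    proof -
      have "(\<forall>t. x t \<in> U) \<longleftrightarrow> (\<forall>t. x (- t) \<in> U)"
        using all_int_reflect[of "\<lambda>t. x t \<in> U" 0] by simp
      moreover have "(\<forall>t. x t = R (Some 0) (- 1) (e (t + 1)) - G (x (t + 1))) \<longleftrightarrow>
          (\<forall>t. x (- t) = R (Some 0) (- 1) (e (1 - t)) - G (x (- (t - 1))))"
        by (subst all_int_reflect[where a = 0]) simp
      moreover have "future_value_zero G t0 x c \<longleftrightarrow> past_value_inf G (- t0) (\<lambda>s. x (- s)) c"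
        by (simp add: future_value_zero_def past_value_inf_def)
      ultimately show ?thesis unfolding sol flow.is_flow_def by (simp only: conj_assoc)
    qed
    have flow': "flow.is_flow (- t0) c x \<longleftrightarrow>
        proj_solution A0 A1 R \<epsilon> (Some 0) (\<lambda>t. x (- t)) \<and> future_value_zero G t0 (\<lambda>t. x (- t)) c" for x c
      unfolding flow by simp
    have series: "(\<lambda>k. R (Some 0) (- int k) (e (t + int k))) summable_on {1..}"
      "(\<Sum>\<^sub>\<infinity>k\<in>{1..}. R (Some 0) (- int k) (e (t + int k)))
        = flow_sum (- G) (\<lambda>t. R (Some 0) (- 1) (e (1 - t))) (- t)" for t
    proof -
      \<comment> \<open>The series of the statement starts at k = 1 and the flow sum at l = 0, so k
        = l + 1.\<close>
      have eq: "(blinfun_apply (- G) ^^ l) (R (Some 0) (- 1) (e (1 - (- t - int l))))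
          = R (Some 0) (- int (Suc l)) (e (t + int (Suc l)))" for l
        by (simp add: part_term algebra_simps)
      show "(\<lambda>k. R (Some 0) (- int k) (e (t + int k))) summable_on {1..}"
        using flow.part_summable[of "- t"]
          summable_on_reindex_bij_betw[OF bij_betw_Suc_atLeast, of "\<lambda>k. R (Some 0) (- int k) (e (t + int k))"]
        unfolding eq by simp
      show "(\<Sum>\<^sub>\<infinity>k\<in>{1..}. R (Some 0) (- int k) (e (t + int k)))
          = flow_sum (- G) (\<lambda>t. R (Some 0) (- 1) (e (1 - t))) (- t)"
        using infsum_reindex_bij_betw[OF bij_betw_Suc_atLeast, of "\<lambda>k. R (Some 0) (- int k) (e (t + int k))"]
        unfolding flow_sum_def eq by simp
    qed
    have bij: "inj_on (blinfun_apply G) flow.core \<Longrightarrow> bij_betw (blinfun_apply G) flow.core flow.core"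
      using image_core[of U G] flow.G_mem by (auto simp: bij_betw_def)
    obtain z :: 'x where z: "z \<noteq> 0" using nz by blast
    let ?sol = "\<lambda>x c. proj_solution A0 A1 R \<epsilon> (Some 0) x \<and> future_value_zero G t0 x c"
    let ?p = "\<lambda>t. flow_sum (- G) (\<lambda>t. R (Some 0) (- 1) (e (1 - t))) (- t)"
    have ex: "\<exists>x. ?sol x c" if "c \<in> flow.core" for c
      using flow.core_flow(1)[OF that, of "- t0"] unfolding flow' by blast
    have past: "x t = ?p t + (- 1) powi (t0 - t) *\<^sub>R op_pow G (nat (t0 - t)) c"
      if "c \<in> flow.core" "?sol x c" "t \<le> t0" for x c t
      using flow.core_flow(2)[OF that(1), of "- t0" "\<lambda>s. x (- s)" "- t"] that(2,3) unfolding flow by simp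
    have inj: "?sol x c \<longleftrightarrow> (\<forall>t. x t = ?p t + (- 1) powi (t0 - t) *\<^sub>R core_powi G U (t0 - t) c)"
      "?sol x c \<Longrightarrow> subexponential x \<longleftrightarrow> c = 0"
      if "inj_on (blinfun_apply G) flow.core" "c \<in> flow.core" for x c
    proof -
      show "?sol x c \<longleftrightarrow> (\<forall>t. x t = ?p t + (- 1) powi (t0 - t) *\<^sub>R core_powi G U (t0 - t) c)"
        unfolding flow flow.injective_core_flow(1)[OF that]
        by (subst all_int_reflect[where a = 0]) simp
      show "?sol x c \<Longrightarrow> subexponential x \<longleftrightarrow> c = 0"
        using flow.injective_core_flow(2)[OF that, of "- t0" "\<lambda>s. x (- s)"] subexponential_reflect[of x 0]
        unfolding flow by simp
    qed
    have two: "\<exists>x x'. proj_solution A0 A1 R \<epsilon> (Some 0) x \<and> future_value_zero G t0 x c \<and>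
        proj_solution A0 A1 R \<epsilon> (Some 0) x' \<and> future_value_zero G t0 x' c \<and> (\<exists>t>t0. x t \<noteq> x' t)"
      if ninj: "\<not> inj_on (blinfun_apply G) flow.core" "c \<in> flow.core" for c
    proof -
      obtain x x' t where x: "flow.is_flow (- t0) c x" "flow.is_flow (- t0) c x'" "t < - t0" "x t \<noteq> x' t"
        using flow.noninjective_core_flow(1)[OF ninj, of "- t0"] by blast
      then have "- t > t0 \<and> x (- (- t)) \<noteq> x' (- (- t))" by auto
      then have "\<exists>t>t0. x (- t) \<noteq> x' (- t)" by (rule exI)
      moreover note x(1,2)[unfolded flow']
      ultimately show ?thesis
        by (intro exI[of _ "\<lambda>t. x (- t)"] exI[of _ "\<lambda>t. x' (- t)"]) (simp only:)
    qed
    have noninj: "?sol x c \<longleftrightarrow>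
        (\<forall>t\<le>t0. x t = ?p t + (- 1) powi (t0 - t) *\<^sub>R op_pow G (nat (t0 - t)) c) \<and>
        (\<exists>u. backward_orbit G U c u \<and> (\<forall>t>t0. x t = ?p t + (- 1) powi (t - t0) *\<^sub>R u (nat (t - t0))))"
      if ninj: "\<not> inj_on (blinfun_apply G) flow.core" "c \<in> flow.core" for x c
    proof -
      \<comment> \<open>Reversal produces the exponent t0 - t where the statement has t - t0; only
        its parity matters.\<close>
      have sign: "(- 1 :: real) powi (- t + t0) = (- 1) powi (t - t0)" for t
      proof -
        have "nat \<bar>- t + t0\<bar> = nat \<bar>t - t0\<bar>" by arith
        then show ?thesis by (simp only: minus_one_powi)
      qed
      show ?thesis
        unfolding flow flow.noninjective_core_flow(2)[OF ninj] all_ge_uminus all_less_uminus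
        using sign by (simp add: add.commute)
    qed
    have rec: "proj_solution A0 A1 R \<epsilon> (Some 0) x \<longleftrightarrow>
        (\<forall>t. x t = R (Some 0) (- 1) (e (t + 1)) - G (x (t + 1)))" if "\<forall>t. x t \<in> U" for x
      unfolding sol using that by blast
    show ?case
      unfolding Let_def eqs e_def[symmetric] series(2)
      by (intro conjI allI impI ballI rec series(1) bij two ex past inj noninj
            quasinilpotentI[of G] not_has_bounded_inverse_if_nilpotent[of G, OF _ z] op_pow_bound)
        blast+
  qed
qed

end
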